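(* Let $X$ be a metric space with bounded geometry and let $\delta:\ell^\infty(X)\to C^*_u(X)$ be the inclusion of the diagonal. If the asymptotic dimension of $X$ is at most one, then the induced map $$\delta_*:K_0(\ell^\infty(X))\to K_0(C^*_u(X))$$ is surjective.
   Context: A metric space $X$ has bounded geometry if for every $r>0$ there is a uniform (finite) bound on the cardinalities of all $r$-balls in $X$. A collection $\mathcal{U}$ of subsets of a metric space is $r$-separated if $d(A,B)>r$ for all distinct $A,B\in\mathcal{U}$. $X$ has asymptotic dimension at most one if for every $r>0$ there is a decomposition $X=U\sqcup V$ such that each of $U$ and $V$ in turn decomposes as a disjoint union of an $r$-separated collection of subsets of uniformly bounded diameter. Uniform Roe algebra: $\mathbb{C}_u[X]$ is the $*$-algebra of $X$-by-$X$ complex matrices $(a_{xy})$ with uniformly bounded entries and finite propagation $\sup\{d(x,y)\mid a_{xy}\neq 0\}<\infty$. $C^*_u(X)$ is the operator norm closure of $\mathbb{C}_u[X]$ in $\mathcal{B}(\ell^2(X))$. It contains $\ell^\infty(X)$ as the diagonal matrices (multiplication operators); this inclusion is $\delta$. *)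

theory Defs
  imports
    "HOL-Analysis.Analysis"
    "HOL-Library.Function_Algebras"
    "HOL-Library.Disjoint_Sets"
    "HOL-Algebra.Group"
    "Jordan_Normal_Form.Matrix"
begin

section \<open>Coarse geometry\<close>

definition bounded_geometry :: "'x::metric_space itself \<Rightarrow> bool" where
  "bounded_geometry _ \<longleftrightarrow>
     (\<forall>r>0. \<exists>N. \<forall>x::'x. finite (ball x r) \<and> card (ball x r) \<le> N)"

definition r_separated :: "real \<Rightarrow> 'x::metric_space set set \<Rightarrow> bool" where
  "r_separated r \<A> \<longleftrightarrow> (\<forall>A\<in>\<A>. \<forall>B\<in>\<A>. A \<noteq> B \<longrightarrow> setdist A B > r)"

definition uniformly_bounded :: "'x::metric_space set set \<Rightarrow> bool" where
  "uniformly_bounded \<A> \<longleftrightarrow> (\<exists>D. \<forall>A\<in>\<A>. bounded A \<and> diameter A \<le> D)"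

text \<open>The pieces of a \<^const>\<open>partition_on\<close> are nonempty, so the library convention
  that \<^const>\<open>setdist\<close> to the empty set is 0 plays no role.\<close>

definition asdim_le_one :: "'x::metric_space itself \<Rightarrow> bool" where
  "asdim_le_one _ \<longleftrightarrow>
     (\<forall>r>0. \<exists>U V :: 'x set. U \<union> V = UNIV \<and> U \<inter> V = {} \<and>
        (\<exists>\<A>. partition_on U \<A> \<and> r_separated r \<A> \<and> uniformly_bounded \<A>) \<and>
        (\<exists>\<B>. partition_on V \<B> \<and> r_separated r \<B> \<and> uniformly_bounded \<B>))"


section \<open>The Hilbert space of square-summable functions\<close>

typedef 'x ell2 = "{u :: 'x \<Rightarrow> complex. (\<lambda>x. (cmod (u x))\<^sup>2) summable_on UNIV}"
  morphisms ell2_apply Abs_ell2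
  by (rule exI[of _ "\<lambda>_. 0"]) simp

setup_lifting type_definition_ell2

lemma ell2_eqI: "(\<And>x. ell2_apply u x = ell2_apply v x) \<Longrightarrow> u = v"
  by (simp add: ell2_apply_inject[symmetric] fun_eq_iff)

lemma summable_ell2: "(\<lambda>x. (cmod (ell2_apply u x))\<^sup>2) summable_on UNIV"
  using ell2_apply by blast

lemma square_summable_dominated:
  fixes u v w :: "'x \<Rightarrow> complex"
  assumes "(\<lambda>x. (cmod (u x))\<^sup>2) summable_on UNIV" "(\<lambda>x. (cmod (v x))\<^sup>2) summable_on UNIV"
    and "\<And>x. norm (f x :: 'b::banach) \<le> a * ((cmod (u x))\<^sup>2 + (cmod (v x))\<^sup>2)"
  shows "f summable_on UNIV"
proof (rule abs_summable_summable)
  show "f abs_summable_on UNIV"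
  proof (rule Infinite_Sum.abs_summable_on_comparison_test')
  show "(\<lambda>x. a * ((cmod (u x))\<^sup>2 + (cmod (v x))\<^sup>2)) summable_on UNIV"
    using assms by (intro summable_on_cmult_right summable_on_add)
qed (use assms in auto)
qed

lemma square_summable_add:
  fixes u v :: "'x \<Rightarrow> complex"
  assumes "(\<lambda>x. (cmod (u x))\<^sup>2) summable_on UNIV" "(\<lambda>x. (cmod (v x))\<^sup>2) summable_on UNIV"
  shows "(\<lambda>x. (cmod (u x + v x))\<^sup>2) summable_on UNIV"
proof (rule square_summable_dominated[OF assms])
  fix x
  have "(cmod (u x + v x))\<^sup>2 \<le> (cmod (u x) + cmod (v x))\<^sup>2"
    by (intro power_mono norm_triangle_ineq) auto
  also have "\<dots> \<le> 2 * ((cmod (u x))\<^sup>2 + (cmod (v x))\<^sup>2)"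
    using zero_le_power2[of "cmod (u x) - cmod (v x)"] by (simp add: power2_sum power2_diff)
  finally show "norm ((cmod (u x + v x))\<^sup>2) \<le> 2 * ((cmod (u x))\<^sup>2 + (cmod (v x))\<^sup>2)"
    by simp
qed

lemma square_summable_mult:
  fixes u :: "'x \<Rightarrow> complex"
  assumes "(\<lambda>x. (cmod (u x))\<^sup>2) summable_on UNIV" "bounded (range f)"
  shows "(\<lambda>x. (cmod (f x * u x))\<^sup>2) summable_on UNIV"
proof -
  obtain C where C: "cmod (f x) \<le> C" for x
    using assms(2) by (auto simp: bounded_iff)
  show ?thesis
  proof (rule square_summable_dominated[OF assms(1,1)])
    fix x
    have "(cmod (f x))\<^sup>2 * (cmod (u x))\<^sup>2 \<le> C\<^sup>2 * (cmod (u x))\<^sup>2"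
      by (intro mult_right_mono power_mono C) auto
    then show "norm ((cmod (f x * u x))\<^sup>2) \<le> C\<^sup>2 / 2 * ((cmod (u x))\<^sup>2 + (cmod (u x))\<^sup>2)"
      by (simp add: norm_mult power_mult_distrib)
  qed
qed

lift_definition cscale :: "complex \<Rightarrow> 'x ell2 \<Rightarrow> 'x ell2" is "\<lambda>c u x. c * u x"
  by (rule square_summable_mult) auto

definition cinner :: "'x ell2 \<Rightarrow> 'x ell2 \<Rightarrow> complex" where
  "cinner u v = (\<Sum>\<^sub>\<infinity>x. cnj (ell2_apply u x) * ell2_apply v x)"

lemma cinner_summable: "(\<lambda>x. cnj (ell2_apply u x) * ell2_apply v x) summable_on UNIV"
proof (rule square_summable_dominated[OF summable_ell2 summable_ell2])
  have aux: "a * b \<le> 1 * (a\<^sup>2 + b\<^sup>2)" if "0 \<le> a" "0 \<le> b" for a b :: real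
    using sum_squares_bound[of a b] mult_nonneg_nonneg[OF that] by auto
  fix x
  show "norm (cnj (ell2_apply u x) * ell2_apply v x)
          \<le> 1 * ((cmod (ell2_apply u x))\<^sup>2 + (cmod (ell2_apply v x))\<^sup>2)"
    unfolding norm_mult complex_mod_cnj by (rule aux) auto
qed

lemma cinner_commute: "cinner u v = cnj (cinner v u)"
  unfolding cinner_def infsum_cnj[symmetric] by (simp add: mult.commute)

instantiation ell2 :: (type) real_inner
begin

lift_definition zero_ell2 :: "'a ell2" is "\<lambda>_. 0" by simp
lift_definition plus_ell2 :: "'a ell2 \<Rightarrow> 'a ell2 \<Rightarrow> 'a ell2" is "\<lambda>u v x. u x + v x"
  by (rule square_summable_add)
lift_definition uminus_ell2 :: "'a ell2 \<Rightarrow> 'a ell2" is "\<lambda>u x. - u x" by simp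
lift_definition minus_ell2 :: "'a ell2 \<Rightarrow> 'a ell2 \<Rightarrow> 'a ell2" is "\<lambda>u v x. u x - v x"
  subgoal for u v using square_summable_add[of u "\<lambda>x. - v x"] by simp
  done
definition scaleR_ell2 :: "real \<Rightarrow> 'a ell2 \<Rightarrow> 'a ell2" where "r *\<^sub>R u = cscale (of_real r) u"
definition inner_ell2 :: "'a ell2 \<Rightarrow> 'a ell2 \<Rightarrow> real" where "inner u v = Re (cinner u v)"
definition norm_ell2 :: "'a ell2 \<Rightarrow> real" where
  "norm u = sqrt (\<Sum>\<^sub>\<infinity>x. (cmod (ell2_apply u x))\<^sup>2)"
definition dist_ell2 :: "'a ell2 \<Rightarrow> 'a ell2 \<Rightarrow> real" where "dist_ell2 u v = norm (u - v)"
definition sgn_ell2 :: "'a ell2 \<Rightarrow> 'a ell2" where "sgn_ell2 u = inverse (norm u) *\<^sub>R u"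
definition uniformity_ell2 :: "('a ell2 \<times> 'a ell2) filter" where
  "uniformity_ell2 = (INF e\<in>{0<..}. principal {(u, v). dist u v < e})"
definition open_ell2 :: "'a ell2 set \<Rightarrow> bool" where
  "open_ell2 S = (\<forall>u\<in>S. \<forall>\<^sub>F (u', v) in uniformity. u' = u \<longrightarrow> v \<in> S)"

instance
proof
  fix u v w :: "'a ell2" and r s :: real
  show "u + v + w = u + (v + w)" "u + v = v + u" "0 + u = u" "- u + u = 0" "u - v = u + - v"
    by (transfer; simp add: algebra_simps)+
  show "r *\<^sub>R (u + v) = r *\<^sub>R u + r *\<^sub>R v" "(r + s) *\<^sub>R u = r *\<^sub>R u + s *\<^sub>R u"
       "r *\<^sub>R s *\<^sub>R u = (r * s) *\<^sub>R u" "1 *\<^sub>R u = u"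
    unfolding scaleR_ell2_def by (transfer; simp add: algebra_simps)+
  show "inner u v = inner v u"
    unfolding inner_ell2_def by (subst cinner_commute) simp
  show "inner (u + v) w = inner u w + inner v w"
    unfolding inner_ell2_def cinner_def plus_complex.sel(1)[symmetric]
    by (simp add: plus_ell2.rep_eq distrib_right infsum_add cinner_summable)
  show "inner (r *\<^sub>R u) v = r * inner u v"
    unfolding inner_ell2_def cinner_def scaleR_ell2_def
    by (simp add: cscale.rep_eq mult.assoc infsum_cmult_right')
  have sq: "inner u u = (\<Sum>\<^sub>\<infinity>x. (cmod (ell2_apply u x))\<^sup>2)" for u :: "'a ell2"
    unfolding inner_ell2_def cinner_def
    by (subst infsum_Re[symmetric])
       (auto intro: cinner_summable intro!: infsum_cong simp: cmod_power2 simp flip: power2_eq_square)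
  show "0 \<le> inner u u"
    unfolding sq by (rule infsum_nonneg) simp
  show "norm u = sqrt (inner u u)"
    unfolding sq norm_ell2_def ..
  show "inner u u = 0 \<longleftrightarrow> u = 0"
  proof
    assume "inner u u = 0"
    then have "(cmod (ell2_apply u x))\<^sup>2 = 0" for x
      unfolding sq by (intro nonneg_infsum_le_0D[where A = UNIV]) (auto intro: summable_ell2)
    then show "u = 0" by (intro ell2_eqI) (simp add: zero_ell2.rep_eq)
  qed (simp add: sq zero_ell2.rep_eq)
qed (auto simp: dist_ell2_def sgn_ell2_def uniformity_ell2_def open_ell2_def)

end

lift_definition ket :: "'x \<Rightarrow> 'x ell2" is "\<lambda>y x. if x = y then 1 else 0"
  by (rule summable_on_cong_neutral[THEN iffD1, OF _ _ _ summable_on_finite[of "{_}"]]) auto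


section \<open>Bounded operators\<close>

text \<open>The library type \<open>\<Rightarrow>\<^sub>L\<close> consists of the real-linear bounded maps; bounded operators on the complex
  Hilbert space are the complex-linear ones among them.\<close>

typedef 'x bop = "{T :: 'x ell2 \<Rightarrow>\<^sub>L 'x ell2. \<forall>c u. T (cscale c u) = cscale c (T u)}"
  morphisms blinfun_of_bop Abs_bop
  by (rule exI[of _ 0]) (simp add: ell2_eqI cscale.rep_eq zero_ell2.rep_eq)

setup_lifting type_definition_bop

lemma cscale_add: "cscale c (u + v) = cscale c u + cscale c v"
  by transfer (simp add: algebra_simps)

lemma cscale_minus: "cscale c (- u) = - cscale c u"
  by transfer simp

lemma cscale_diff: "cscale c (u - v) = cscale c u - cscale c v"
  by transfer (simp add: algebra_simps)

lemma cscale_scaleR: "cscale c (r *\<^sub>R u) = r *\<^sub>R cscale c u"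
  unfolding scaleR_ell2_def by transfer (simp add: algebra_simps)

lemma cscale_zero: "cscale c 0 = 0"
  by transfer simp

instantiation bop :: (type) real_normed_algebra_1
begin

lift_definition zero_bop :: "'a bop" is 0 by (simp add: cscale_zero)
lift_definition one_bop :: "'a bop" is id_blinfun by simp
lift_definition plus_bop :: "'a bop \<Rightarrow> 'a bop \<Rightarrow> 'a bop" is "(+)"
  by (simp add: blinfun.add_left cscale_add)
lift_definition uminus_bop :: "'a bop \<Rightarrow> 'a bop" is uminus
  by (simp add: blinfun.minus_left cscale_minus)
lift_definition minus_bop :: "'a bop \<Rightarrow> 'a bop \<Rightarrow> 'a bop" is "(-)"
  by (simp add: blinfun.diff_left cscale_diff)
lift_definition times_bop :: "'a bop \<Rightarrow> 'a bop \<Rightarrow> 'a bop" is "(o\<^sub>L)" by simp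
lift_definition scaleR_bop :: "real \<Rightarrow> 'a bop \<Rightarrow> 'a bop" is "(*\<^sub>R)"
  by (simp add: blinfun.scaleR_left cscale_scaleR)
lift_definition norm_bop :: "'a bop \<Rightarrow> real" is norm .
definition dist_bop :: "'a bop \<Rightarrow> 'a bop \<Rightarrow> real" where "dist_bop S T = norm (S - T)"
definition sgn_bop :: "'a bop \<Rightarrow> 'a bop" where "sgn_bop T = inverse (norm T) *\<^sub>R T"
definition uniformity_bop :: "('a bop \<times> 'a bop) filter" where
  "uniformity_bop = (INF e\<in>{0<..}. principal {(S, T). dist S T < e})"
definition open_bop :: "'a bop set \<Rightarrow> bool" where
  "open_bop \<S> = (\<forall>S\<in>\<S>. \<forall>\<^sub>F (S', T) in uniformity. S' = S \<longrightarrow> T \<in> \<S>)"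

instance
proof
  fix R S T :: "'a bop" and r s :: real
  show "R + S + T = R + (S + T)" "R + S = S + R" "0 + R = R" "- R + R = 0" "R - S = R + - S"
    by (transfer; simp)+
  show "r *\<^sub>R (S + T) = r *\<^sub>R S + r *\<^sub>R T" "(r + s) *\<^sub>R S = r *\<^sub>R S + s *\<^sub>R S"
       "r *\<^sub>R s *\<^sub>R S = (r * s) *\<^sub>R S" "1 *\<^sub>R S = S"
    by (transfer; simp add: algebra_simps)+
  show "R * S * T = R * (S * T)" "(R + S) * T = R * T + S * T" "R * (S + T) = R * S + R * T"
       "r *\<^sub>R S * T = r *\<^sub>R (S * T)" "S * r *\<^sub>R T = r *\<^sub>R (S * T)" "1 * S = S" "S * 1 = S"
    by (transfer; auto intro!: blinfun_eqI simp: blinfun.bilinear_simps)+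
  have k: "ket undefined \<noteq> (0 :: 'a ell2)"
    by (metis ket.rep_eq zero_ell2.rep_eq zero_neq_one)
  then have "\<exists>u :: 'a ell2. u \<noteq> 0" by blast
  show "norm (1 :: 'a bop) = 1"
  proof (transfer, rule antisym)
    show "norm (id_blinfun :: 'a ell2 \<Rightarrow>\<^sub>L 'a ell2) \<le> 1"
      by (rule norm_blinfun_bound) auto
    show "1 \<le> norm (id_blinfun :: 'a ell2 \<Rightarrow>\<^sub>L 'a ell2)"
      using norm_blinfun[of "id_blinfun :: 'a ell2 \<Rightarrow>\<^sub>L 'a ell2" "ket undefined"] k by simp
  qed
  then show "(0 :: 'a bop) \<noteq> 1"
    by (metis norm_zero zero_bop.rep_eq norm_bop.rep_eq zero_neq_one)
  show "norm T = 0 \<longleftrightarrow> T = 0" "norm (r *\<^sub>R T) = \<bar>r\<bar> * norm T"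
    by (transfer; simp)+
  show "norm (S + T) \<le> norm S + norm T" by transfer (rule norm_triangle_ineq)
  show "norm (S * T) \<le> norm S * norm T" by transfer (rule norm_blinfun_compose)
qed (auto simp: dist_bop_def sgn_bop_def uniformity_bop_def open_bop_def)

end

abbreviation bop_apply :: "'x bop \<Rightarrow> 'x ell2 \<Rightarrow> 'x ell2" where
  "bop_apply T u \<equiv> blinfun_apply (blinfun_of_bop T) u"

class star = fixes star :: "'a \<Rightarrow> 'a"

instantiation complex :: star
begin
definition star_complex :: "complex \<Rightarrow> complex" where "star_complex = cnj"
instance ..
end

instantiation "fun" :: (type, star) star
begin
definition star_fun :: "('a \<Rightarrow> 'b) \<Rightarrow> 'a \<Rightarrow> 'b" where "star_fun f = (\<lambda>x. star (f x))"
instance ..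
end

text \<open>The Hilbert space adjoint; \<^const>\<open>cinner\<close> is conjugate-linear in its first argument.\<close>

instantiation bop :: (type) star
begin
definition star_bop :: "'a bop \<Rightarrow> 'a bop" where
  "star_bop T = (THE S. \<forall>u v. cinner (bop_apply S u) v = cinner u (bop_apply T v))"
instance ..
end

definition matrix_of :: "'x bop \<Rightarrow> 'x \<Rightarrow> 'x \<Rightarrow> complex" where
  "matrix_of T x y = ell2_apply (bop_apply T (ket y)) x"


section \<open>The uniform Roe algebra and its diagonal\<close>

definition uniform_Roe_matrices :: "('x::metric_space \<Rightarrow> 'x \<Rightarrow> complex) set" where
  "uniform_Roe_matrices =
     {a. (\<exists>C. \<forall>x y. cmod (a x y) \<le> C) \<and> (\<exists>R. \<forall>x y. a x y \<noteq> 0 \<longrightarrow> dist x y \<le> R)}"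

text \<open>The closure below is in the operator norm. If the space has bounded geometry, then every uniform Roe matrix acts as a bounded operator
  on the Hilbert space (Schur test), so \<open>algebraic_uniform_Roe\<close> is a copy of the whole
  matrix algebra.\<close>

definition algebraic_uniform_Roe :: "'x::metric_space bop set" where
  "algebraic_uniform_Roe = {T. matrix_of T \<in> uniform_Roe_matrices}"

definition uniform_Roe :: "'x::metric_space bop set" where
  "uniform_Roe = closure algebraic_uniform_Roe"

definition ell_infty :: "('x \<Rightarrow> complex) set" where
  "ell_infty = {f. bounded (range f)}"

definition diag_op :: "('x \<Rightarrow> complex) \<Rightarrow> 'x bop" where
  "diag_op f = Abs_bop (Blinfun (\<lambda>u. Abs_ell2 (\<lambda>x. f x * ell2_apply u x)))"

lemma diag_op_apply:
  assumes "f \<in> ell_infty"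
  shows "ell2_apply (bop_apply (diag_op f) u) x = f x * ell2_apply u x"
proof -
  have b: "bounded (range f)" using assms by (simp add: ell_infty_def)
  then obtain C where C: "cmod (f x) \<le> C" for x by (auto simp: bounded_iff)
  define M where "M = (\<lambda>u. Abs_ell2 (\<lambda>x. f x * ell2_apply u x))"
  have M: "ell2_apply (M u) x = f x * ell2_apply u x" for u x
    unfolding M_def by (subst Abs_ell2_inverse) (auto intro: square_summable_mult summable_ell2 b)
  have "bounded_linear M"
  proof
    fix u v :: "'a ell2" and r :: real
    show "M (u + v) = M u + M v"
      by (rule ell2_eqI) (simp add: M plus_ell2.rep_eq algebra_simps)
    show "M (r *\<^sub>R u) = r *\<^sub>R M u"
      by (rule ell2_eqI) (simp add: M scaleR_ell2_def cscale.rep_eq)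
    have C0: "0 \<le> C" using C norm_ge_zero order_trans by blast
    have "norm (M u) \<le> norm u * C" for u
    proof -
      have "(\<Sum>\<^sub>\<infinity>x. (cmod (ell2_apply (M u) x))\<^sup>2) \<le> (\<Sum>\<^sub>\<infinity>x. C\<^sup>2 * (cmod (ell2_apply u x))\<^sup>2)"
        by (intro infsum_mono summable_ell2 summable_on_cmult_right)
           (auto simp: M norm_mult power_mult_distrib intro!: mult_right_mono power_mono C)
      also have "\<dots> = C\<^sup>2 * (\<Sum>\<^sub>\<infinity>x. (cmod (ell2_apply u x))\<^sup>2)"
        by (rule infsum_cmult_right')
      finally have "norm (M u) \<le> sqrt (C\<^sup>2 * (\<Sum>\<^sub>\<infinity>x. (cmod (ell2_apply u x))\<^sup>2))"
        unfolding norm_ell2_def by (rule real_sqrt_le_mono)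
      then show ?thesis using C0 by (simp add: real_sqrt_mult norm_ell2_def mult.commute)
    qed
    then show "\<exists>K. \<forall>u. norm (M u) \<le> norm u * K" by blast
  qed
  then have B: "blinfun_apply (Blinfun M) = M" by (rule bounded_linear_Blinfun_apply)
  have "blinfun_of_bop (diag_op f) = Blinfun M"
    unfolding diag_op_def M_def[symmetric]
    by (rule Abs_bop_inverse) (auto simp: B M cscale.rep_eq intro!: ell2_eqI)
  then show ?thesis by (simp add: B M)
qed

lemma diag_op_in_uniform_Roe:
  assumes "f \<in> ell_infty"
  shows "diag_op f \<in> uniform_Roe"
proof -
  obtain C where C: "cmod (f x) \<le> C" for x
    using assms by (auto simp: ell_infty_def bounded_iff)
  have "0 \<le> C" using C norm_ge_zero order_trans by blast
  moreover have "matrix_of (diag_op f) x y = (if x = y then f x else 0)" for x y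
    by (simp add: matrix_of_def diag_op_apply[OF assms] ket.rep_eq)
  ultimately have "matrix_of (diag_op f) \<in> uniform_Roe_matrices"
    unfolding uniform_Roe_matrices_def mem_Collect_eq
    using C by (intro conjI exI[of _ C] exI[of _ 0]) auto
  then show ?thesis
    unfolding uniform_Roe_def algebraic_uniform_Roe_def
    by (intro subsetD[OF closure_subset]) simp
qed


section \<open>The group \<open>K\<^sub>0\<close>\<close>

text \<open>A unital \<open>C\<^sup>*\<close>-algebra \<open>A\<close> enters as a *-closed subring of an ambient ring with
  involution. \<open>K\<^sub>0(A)\<close> is the Grothendieck group of the monoid of Murray--von Neumann classes
  of projections in the matrix algebras over \<open>A\<close> (the empty \<open>0 \<times> 0\<close> matrix is included and
  is equivalent to every zero projection).\<close>

definition mat_star :: "'a::star mat \<Rightarrow> 'a mat" where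
  "mat_star P = map_mat star (transpose_mat P)"

definition projections :: "'a::{ring_1,star} set \<Rightarrow> 'a mat set" where
  "projections A = {P. square_mat P \<and> elements_mat P \<subseteq> A \<and> P * P = P \<and> mat_star P = P}"

definition mvn_rel :: "'a::{ring_1,star} set \<Rightarrow> ('a mat \<times> 'a mat) set" where
  "mvn_rel A = {(P, Q). P \<in> projections A \<and> Q \<in> projections A \<and>
     (\<exists>V \<in> carrier_mat (dim_row Q) (dim_row P).
        elements_mat V \<subseteq> A \<and> mat_star V * V = P \<and> V * mat_star V = Q)}"

definition direct_sum :: "'a::zero mat \<Rightarrow> 'a mat \<Rightarrow> 'a mat" where
  "direct_sum P Q =
     four_block_mat P (0\<^sub>m (dim_row P) (dim_col Q)) (0\<^sub>m (dim_row Q) (dim_col P)) Q"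

definition proj_monoid :: "'a::{ring_1,star} set \<Rightarrow> 'a mat set monoid" where
  "proj_monoid A =
     \<lparr>carrier = projections A // mvn_rel A,
      mult = (\<lambda>C D. \<Union>P\<in>C. \<Union>Q\<in>D. mvn_rel A `` {direct_sum P Q}),
      one = mvn_rel A `` {0\<^sub>m 0 0}\<rparr>"

definition grothendieck_rel :: "'m monoid \<Rightarrow> (('m \<times> 'm) \<times> ('m \<times> 'm)) set" where
  "grothendieck_rel M = {((a, b), (c, d)).
     a \<in> carrier M \<and> b \<in> carrier M \<and> c \<in> carrier M \<and> d \<in> carrier M \<and>
     (\<exists>e \<in> carrier M. a \<otimes>\<^bsub>M\<^esub> d \<otimes>\<^bsub>M\<^esub> e = c \<otimes>\<^bsub>M\<^esub> b \<otimes>\<^bsub>M\<^esub> e)}"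

definition grothendieck_group :: "'m monoid \<Rightarrow> ('m \<times> 'm) set monoid" where
  "grothendieck_group M =
     \<lparr>carrier = (carrier M \<times> carrier M) // grothendieck_rel M,
      mult = (\<lambda>X Y. \<Union>(a, b)\<in>X. \<Union>(c, d)\<in>Y.
                grothendieck_rel M `` {(a \<otimes>\<^bsub>M\<^esub> c, b \<otimes>\<^bsub>M\<^esub> d)}),
      one = grothendieck_rel M `` {(\<one>\<^bsub>M\<^esub>, \<one>\<^bsub>M\<^esub>)}\<rparr>"

definition K0 :: "'a::{ring_1,star} set \<Rightarrow> ('a mat set \<times> 'a mat set) set monoid" where
  "K0 A = grothendieck_group (proj_monoid A)"

text \<open>The maps induced by a *-homomorphism into \<open>B\<close>, on classes of projections and on
  \<open>K\<^sub>0\<close>: apply the homomorphism entrywise to representatives.\<close>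

definition proj_map ::
  "'b::{ring_1,star} set \<Rightarrow> ('a \<Rightarrow> 'b) \<Rightarrow> 'a mat set \<Rightarrow> 'b mat set" where
  "proj_map B \<phi> C = (\<Union>P\<in>C. mvn_rel B `` {map_mat \<phi> P})"

definition K0_map ::
  "'b::{ring_1,star} set \<Rightarrow> ('a \<Rightarrow> 'b) \<Rightarrow> ('a mat set \<times> 'a mat set) set
     \<Rightarrow> ('b mat set \<times> 'b mat set) set" where
  "K0_map B \<phi> X =
     (\<Union>(c, d)\<in>X. grothendieck_rel (proj_monoid B) `` {(proj_map B \<phi> c, proj_map B \<phi> d)})"

end

theory Submission
  imports Defs "Jordan_Normal_Form.Spectral_Radius"
begin

text \<open>Let \<open>P\<close> be a projection over the Roe algebra, seen as an operator on \<open>\<ell>\<^sup>2(X \<times> {0..<n})\<close>, and let \<open>a\<close> be a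
  self-adjoint operator of finite propagation close to \<open>P\<close>. If the pieces of \<open>X = U \<squnion> V\<close> are separated
  far beyond the propagation of \<open>a\<close>, there is a slowly varying \<open>h : X \<rightarrow> [0, 1]\<close>, equal to \<open>0\<close> on \<open>U\<close> and to
  \<open>1\<close> far from \<open>U\<close>, such that \<open>a\<close> is block diagonal with uniformly bounded blocks over \<open>{h < 1/2}\<close> and
  over \<open>{h > 1/2}\<close>. Being slowly varying, \<open>h\<close> almost commutes with \<open>a\<close>.

  The compression of \<open>P\<close> by \<open>\<chi>(h < 1/2)\<close> need not be close to a projection, the obstruction being the unitary
  \<open>u\<close> near \<open>1 + P (exp(2 \<pi> i h) - 1) P\<close>. But \<open>u - 1\<close> lives where \<open>h\<close> is not locally constant, hence \<open>u\<close> is block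
  diagonal too. Finite matrices can be diagonalised, so the projections \<open>e\<^sub>+\<close> and \<open>e\<^sub>- = 1 - e\<^sub>+\<close> onto the spectral
  parts of \<open>u\<close> with positive and with nonpositive imaginary part are again block diagonal operators. With
  \<open>c\<^sub>+\<close> and \<open>c\<^sub>-\<close> the positive and negative parts of \<open>cos(\<pi> h)\<close>, the operators
  \<open>c\<^sub>+ P c\<^sub>+ + P sin\<^sup>2(\<pi> h) e\<^sub>+\<close> and \<open>c\<^sub>- P c\<^sub>- + P sin\<^sup>2(\<pi> h) e\<^sub>-\<close> have sum \<open>P\<close> and product \<open>0\<close> up to small errors, and
  each of them is block diagonal. Therefore \<open>P\<close> is equivalent to the direct sum of two block diagonal projections,
  and a block diagonal projection, diagonalised block by block, is equivalent to a diagonal one.\<close>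

section \<open>The \<open>*\<close>-algebra of bounded operators\<close>

text \<open>The unitary \<open>u\<close> plays the part of the boundary class in K_1 of a
  Mayer-Vietoris argument. It lives on blocks of finite matrices, where every unitary has a
  logarithm, so the obstruction dies; the spectral projections of \<open>u\<close> make this
  explicit. They come from cutting the circle at 1 and -1, where the sign of the imaginary part
  jumps. The point 1 corresponds to \<open>h\<close> in {0, 1}, where the weight sin^2(pi h)
  vanishes; the point -1 corresponds to \<open>h\<close> = 1/2, where both cosine parts vanish and
  any sharing out of the weight will do. In between, 4 cos^2(pi h) sin^2(pi h) = sin^2(2 pi h), so
  each cross term carries exactly the sign of the imaginary part that its spectral projection
  excludes.

  These projections are discontinuous functions of \<open>u\<close>. They are shown to commute, up
  to vanishing errors, with P sin^2(pi h), but not with \<open>P\<close> or \<open>h\<close>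
  separately; so the cross terms are removed by a contraction argument. The errors tend to 0 while
  the blocks may grow without bound, hence no estimate in the cutting step may depend on the size of
  a block.\<close>

class star_ring = ring_1 + star +
  assumes star_add: "star (a + b) = star a + star b"
    and star_mult: "star (a * b) = star b * star a"
    and star_star [simp]: "star (star a) = a"
begin

lemma star_zero [simp]: "star 0 = 0"
  using star_add[of 0 0] by simp

lemma star_one [simp]: "star 1 = 1"
  using star_mult[of "star 1" 1] by simp

lemma star_minus: "star (- a) = - star a"
  using star_add[of a "- a"] by (simp add: eq_neg_iff_add_eq_0 add.commute)

lemma star_diff: "star (a - b) = star a - star b"
  using star_add[of a "- b"] by (simp add: star_minus)

lemma star_sum: "star (sum f A) = (\<Sum>x\<in>A. star (f x))"
  by (induction A rule: infinite_finite_induct) (auto simp: star_add)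

end

instance complex :: star_ring
  by standard (auto simp: star_complex_def)

instance "fun" :: (type, star_ring) star_ring
  by standard (auto simp: star_fun_def star_add star_mult fun_eq_iff)

section \<open>Coordinates of vectors, operators and the complex inner product\<close>

lemmas ell2_simps = plus_ell2.rep_eq minus_ell2.rep_eq uminus_ell2.rep_eq zero_ell2.rep_eq cscale.rep_eq ket.rep_eq

lemma ell2_apply_scaleR: "ell2_apply (r *\<^sub>R u) x = of_real r * ell2_apply u x"
  by (simp add: scaleR_ell2_def cscale.rep_eq)

lemma ell2_apply_sum: "ell2_apply (sum f A) x = (\<Sum>a\<in>A. ell2_apply (f a) x)"
  by (induction A rule: infinite_finite_induct) (auto simp: ell2_simps)

lemma cscale_cscale: "cscale a (cscale b u) = cscale (a * b) u"
  by (rule ell2_eqI) (simp add: ell2_simps)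

lemma cscale_add_left: "cscale (a + b) u = cscale a u + cscale b u"
  by (rule ell2_eqI) (simp add: ell2_simps algebra_simps)

lemma bop_apply_simps:
  "bop_apply (S + T) u = bop_apply S u + bop_apply T u"
  "bop_apply (S - T) u = bop_apply S u - bop_apply T u"
  "bop_apply (- T) u = - bop_apply T u"
  "bop_apply (S * T) u = bop_apply S (bop_apply T u)"
  "bop_apply 0 u = 0" "bop_apply 1 u = u"
  "bop_apply (r *\<^sub>R T) u = r *\<^sub>R bop_apply T u"
  by (simp_all add: plus_bop.rep_eq minus_bop.rep_eq uminus_bop.rep_eq times_bop.rep_eq zero_bop.rep_eq
      one_bop.rep_eq scaleR_bop.rep_eq blinfun.bilinear_simps)

lemma bop_apply_cscale: "bop_apply T (cscale c u) = cscale c (bop_apply T u)"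
  using blinfun_of_bop[of T] by simp

lemma bop_eqI: "(\<And>u. bop_apply S u = bop_apply T u) \<Longrightarrow> S = T"
  by (simp add: blinfun_of_bop_inject[symmetric] blinfun_eqI)

lemma norm_bop_apply: "norm (bop_apply T u) \<le> norm T * norm u"
  using norm_blinfun[of "blinfun_of_bop T" u] by (simp add: norm_bop.rep_eq)

lemma norm_bop_le: "0 \<le> b \<Longrightarrow> (\<And>u. norm (bop_apply T u) \<le> b * norm u) \<Longrightarrow> norm T \<le> b"
  unfolding norm_bop.rep_eq by (rule norm_blinfun_bound)

lemma norm_ell2_sq: "(norm u)\<^sup>2 = (\<Sum>\<^sub>\<infinity>x. (cmod (ell2_apply u x))\<^sup>2)"
  by (simp add: norm_ell2_def infsum_nonneg)

lemma cinner_self: "cinner u u = of_real ((norm u)\<^sup>2)"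
proof -
  have "cinner u u = (\<Sum>\<^sub>\<infinity>x. of_real ((cmod (ell2_apply u x))\<^sup>2))"
    unfolding cinner_def by (rule infsum_cong) (metis complex_norm_square mult.commute)
  also have "\<dots> = of_real ((norm u)\<^sup>2)"
    unfolding norm_ell2_sq by (rule infsumI has_sum_of_real has_sum_infsum summable_ell2)+
  finally show ?thesis .
qed

lemma cinner_add_left: "cinner (u + v) w = cinner u w + cinner v w"
  unfolding cinner_def by (simp add: ell2_simps distrib_right infsum_add cinner_summable)

lemma cinner_add_right: "cinner w (u + v) = cinner w u + cinner w v"
  unfolding cinner_def by (simp add: ell2_simps distrib_left infsum_add cinner_summable)

lemma cinner_cscale_right: "cinner w (cscale c u) = c * cinner w u"
  unfolding cinner_def by (simp add: ell2_simps mult.left_commute infsum_cmult_right')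

lemma cinner_cscale_left: "cinner (cscale c u) w = cnj c * cinner u w"
  unfolding cinner_def by (simp add: ell2_simps mult.assoc infsum_cmult_right')

lemma cinner_zero [simp]: "cinner 0 u = 0" "cinner u 0 = 0"
  unfolding cinner_def by (simp_all add: ell2_simps)

lemma cinner_diff_left: "cinner (u - v) w = cinner u w - cinner v w"
  using cinner_add_left[of "u - v" v w] by (simp add: algebra_simps)

lemma cinner_diff_right: "cinner w (u - v) = cinner w u - cinner w v"
  using cinner_add_right[of w "u - v" v] by (simp add: algebra_simps)

lemma cinner_sum_right: "cinner w (sum f A) = (\<Sum>a\<in>A. cinner w (f a))"
  by (induction A rule: infinite_finite_induct) (auto simp: cinner_add_right)

lemma cinner_ket_left: "cinner (ket x) u = ell2_apply u x"
proof -
  have "cinner (ket x) u = (\<Sum>\<^sub>\<infinity>y\<in>{x}. cnj (ell2_apply (ket x) y) * ell2_apply u y)"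
    unfolding cinner_def by (rule infsum_cong_neutral) (auto simp: ket.rep_eq)
  then show ?thesis by (simp add: ket.rep_eq)
qed

lemma norm_cscale: "norm (cscale c u) = cmod c * norm u"
proof -
  have "(norm (cscale c u))\<^sup>2 = (cmod c * norm u)\<^sup>2"
    by (simp only: norm_ell2_sq cscale.rep_eq norm_mult power_mult_distrib infsum_cmult_right')
  then show ?thesis by (simp add: power2_eq_iff_nonneg)
qed

text \<open>\<open>Blinfun\<close> and \<open>Abs_bop\<close> are total, so the value means
  something only for bounded complex linear maps; the lemma of the same name settles this for rank
  one operators and for the passage between matrices and their entries.\<close>

definition bop_of :: "('a ell2 \<Rightarrow> 'a ell2) \<Rightarrow> 'a bop" where
  "bop_of A = Abs_bop (Blinfun A)"

lemma bop_of:
  assumes "\<And>u v. A (u + v) = A u + A v" "\<And>c u. A (cscale c u) = cscale c (A u)" "\<And>u. norm (A u) \<le> K * norm u"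
  shows "bop_apply (bop_of A) u = A u"
proof -
  have "bounded_linear A"
    using assms by (intro bounded_linear_intro[where K = K]) (auto simp: scaleR_ell2_def mult.commute)
  then have B: "blinfun_apply (Blinfun A) = A" by (rule bounded_linear_Blinfun_apply)
  have "blinfun_of_bop (Abs_bop (Blinfun A)) = Blinfun A"
    by (rule Abs_bop_inverse) (auto simp: B assms)
  then show ?thesis by (simp add: B bop_of_def)
qed

lemma cinner_bound: "cmod (cinner u v) \<le> norm u * norm v"
proof (cases "cinner u v = 0")
  case False
  \<comment> \<open>Rotating \<open>v\<close> by this phase makes the product real and positive, so
    the Cauchy-Schwarz inequality of the real inner product, which only sees real parts, gives the
    complex one.\<close>
  define c where "c = cnj (cinner u v) / cmod (cinner u v)"
  have c: "cmod c = 1" using False by (simp add: c_def norm_divide)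
  have "c * cinner u v = of_real (cmod (cinner u v))"
    using False unfolding c_def
    by (simp add: divide_eq_eq complex_norm_square[symmetric] mult.commute power2_eq_square)
  then have "cmod (cinner u v) = inner u (cscale c v)"
    by (simp add: inner_ell2_def cinner_cscale_right)
  also have "\<dots> \<le> norm u * norm (cscale c v)"
    by (rule norm_cauchy_schwarz)
  finally show ?thesis by (simp add: norm_cscale c)
qed simp

lemma norm_ket [simp]: "norm (ket x) = 1"
proof -
  have "cinner (ket x) (ket x) = 1" by (simp add: cinner_ket_left ket.rep_eq)
  then have "(norm (ket x))\<^sup>2 = 1" unfolding cinner_self by (metis of_real_eq_1_iff)
  then show ?thesis by (simp add: power2_eq_1_iff) (metis norm_ge_zero neg_0_le_iff_le not_one_le_zero)
qed

lemma ell2_apply_bound: "cmod (ell2_apply u x) \<le> norm u"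
  using cinner_bound[of "ket x" u] by (simp add: cinner_ket_left)

lemma cinner_eqI: "(\<And>w. cinner u w = cinner v w) \<Longrightarrow> u = v"
proof -
  assume "\<And>w. cinner u w = cinner v w"
  then have "cinner (u - v) (u - v) = 0" by (simp add: cinner_diff_left)
  then show "u = v" by (simp add: cinner_self)
qed

section \<open>Truncation to finite sets and adjoints\<close>

lift_definition restrict :: "'x set \<Rightarrow> 'x ell2 \<Rightarrow> 'x ell2" is "\<lambda>A u x. if x \<in> A then u x else 0"
  subgoal for A u
    by (rule square_summable_dominated[where a = 1, of u u]) auto
  done

lemma restrict_finite: "finite F \<Longrightarrow> restrict F u = (\<Sum>x\<in>F. cscale (ell2_apply u x) (ket x))"
  by (rule ell2_eqI) (simp add: restrict.rep_eq ell2_apply_sum ell2_simps if_distrib cong: if_cong)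

text \<open>The square of the norm is an infinite sum, and the tail of that sum is the squared norm
  of what the truncation removes.\<close>

lemma restrict_tail:
  assumes "e > 0"
  obtains F where "finite F" "norm (u - restrict F u) < e"
proof -
  let ?f = "\<lambda>x. (cmod (ell2_apply u x))\<^sup>2"
  have "(?f has_sum (norm u)\<^sup>2) UNIV"
    unfolding norm_ell2_sq by (rule has_sum_infsum[OF summable_ell2])
  then have "(sum ?f \<longlongrightarrow> (norm u)\<^sup>2) (finite_subsets_at_top UNIV)"
    by (simp add: has_sum_def)
  from tendstoD[OF this, of "e\<^sup>2"]
  have "\<forall>\<^sub>F F in finite_subsets_at_top UNIV. dist (sum ?f F) ((norm u)\<^sup>2) < e\<^sup>2"
    using assms by simp
  then obtain F where F: "finite F" "dist (sum ?f F) ((norm u)\<^sup>2) < e\<^sup>2"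
    unfolding eventually_finite_subsets_at_top by blast
  have "(norm (u - restrict F u))\<^sup>2 = (\<Sum>\<^sub>\<infinity>x\<in>UNIV - F. ?f x)"
    unfolding norm_ell2_sq
    by (rule infsum_cong_neutral) (auto simp: ell2_simps restrict.rep_eq)
  also have "\<dots> = (norm u)\<^sup>2 - sum ?f F"
    unfolding norm_ell2_sq using F(1) summable_ell2[of u]
    by (subst infsum_Diff) auto
  also have "\<dots> < e\<^sup>2" using F(2) by (simp add: dist_real_def)
  finally show thesis using that F(1) assms by (simp add: power_less_imp_less_base)
qed

lemma bop_apply_restrict:
  "finite F \<Longrightarrow> bop_apply T (restrict F u) = (\<Sum>x\<in>F. cscale (ell2_apply u x) (bop_apply T (ket x)))"
  by (simp add: restrict_finite blinfun.sum_right bop_apply_cscale)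

text \<open>The coordinates of the adjoint are forced: pairing with \<open>ket x\<close> gives
  \<open>w u x\<close>. Square summability is the point; the adjoint relation then holds on finitely
  supported vectors by linearity and everywhere by density.\<close>

lemma adjoint_exists:
  fixes T :: "'x bop"
  obtains S where "\<And>u v. cinner (bop_apply S u) v = cinner u (bop_apply T v)"
proof -
  define w where "w u x = cnj (cinner u (bop_apply T (ket x)))" for u x
  have fin: "(\<Sum>x\<in>F. (cmod (w u x))\<^sup>2) \<le> (norm T * norm u)\<^sup>2" if "finite F" for F u
  proof -
    \<comment> \<open>Testing \<open>T\<close> on the truncation of \<open>w u\<close> itself gives
      \<open>(norm v)^2 \<le> norm T * norm u * norm v\<close>, and one factor cancels.\<close>
    define v where "v = (\<Sum>x\<in>F. cscale (w u x) (ket x))"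
    define s where "s = (\<Sum>x\<in>F. (cmod (w u x))\<^sup>2)"
    have s0: "0 \<le> s" unfolding s_def by (rule sum_nonneg) simp
    have v: "ell2_apply v x = (if x \<in> F then w u x else 0)" for x
      using that by (simp add: v_def ell2_apply_sum ell2_simps if_distrib cong: if_cong)
    have "(norm v)\<^sup>2 = (\<Sum>\<^sub>\<infinity>x\<in>F. (cmod (w u x))\<^sup>2)"
      unfolding norm_ell2_sq by (rule infsum_cong_neutral) (auto simp: v)
    then have nv: "(norm v)\<^sup>2 = s" using that by (simp add: s_def)
    have "cinner u (bop_apply T v) = (\<Sum>x\<in>F. w u x * cinner u (bop_apply T (ket x)))"
      by (simp add: v_def blinfun.sum_right bop_apply_cscale cinner_sum_right cinner_cscale_right)
    also have "\<dots> = of_real s"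
      unfolding s_def of_real_sum
      by (rule sum.cong[OF refl]) (simp only: complex_norm_square w_def complex_cnj_cnj)
    finally have "s = cmod (cinner u (bop_apply T v))" using s0 by simp
    also have "\<dots> \<le> norm u * (norm T * norm v)"
      by (rule order_trans[OF cinner_bound mult_left_mono[OF norm_bop_apply]]) simp
    finally have "(norm v)\<^sup>2 \<le> (norm T * norm u) * norm v" by (simp add: nv algebra_simps)
    then have "norm v \<le> norm T * norm u"
      by (cases "norm v = 0") (auto simp: power2_eq_square)
    then show ?thesis unfolding s_def[symmetric] nv[symmetric] by (rule power_mono) simp
  qed
  have summ: "(\<lambda>x. (cmod (w u x))\<^sup>2) summable_on UNIV" for u
    by (rule nonneg_bdd_above_summable_on) (auto intro!: bdd_aboveI2 fin)
  define A where "A u = Abs_ell2 (w u)" for u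
  have A: "ell2_apply (A u) x = w u x" for u x
    unfolding A_def by (subst Abs_ell2_inverse) (auto simp: summ)
  have nA: "norm (A u) \<le> norm u * norm T" for u
  proof -
    have "(norm (A u))\<^sup>2 \<le> (norm T * norm u)\<^sup>2"
      unfolding norm_ell2_sq A using summ fin
      by (intro infsum_le_finite_sums) auto
    then show ?thesis by (simp add: mult.commute power2_le_iff_abs_le)
  qed
  have "bounded_linear A"
  proof (rule bounded_linear_intro[where K = "norm T"])
    show "A (u + v) = A u + A v" for u v
      by (rule ell2_eqI) (simp add: A ell2_simps w_def cinner_add_left)
    show "A (r *\<^sub>R u) = r *\<^sub>R A u" for r u
      by (rule ell2_eqI) (simp add: A scaleR_ell2_def cscale.rep_eq, simp add: w_def cinner_cscale_left)
  qed (rule nA)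
  then have B: "blinfun_apply (Blinfun A) = A" by (rule bounded_linear_Blinfun_apply)
  have C: "blinfun_of_bop (Abs_bop (Blinfun A)) = Blinfun A"
    by (rule Abs_bop_inverse) (auto simp: B A w_def ell2_simps cinner_cscale_left intro!: ell2_eqI)
  have "cinner (A u) v = cinner u (bop_apply T v)" for u v
  proof -
    have "cmod (cinner (A u) v - cinner u (bop_apply T v)) < e" if "e > 0" for e
    proof -
      \<comment> \<open>\<open>K\<close> collects the constants of both error terms; the summand 1
        keeps it positive when \<open>u\<close> or \<open>T\<close> is 0.\<close>
      define K where "K = 2 * norm u * norm T + 1"
      have K: "K > 0" unfolding K_def by (intro add_nonneg_pos mult_nonneg_nonneg) auto
      from restrict_tail[of "e / K" v] \<open>e > 0\<close> K obtain F where
        F: "finite F" and lt: "norm (v - restrict F v) < e / K" by auto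
      let ?d = "v - restrict F v"
      have "cinner (A u) (restrict F v) = cinner u (bop_apply T (restrict F v))"
        unfolding bop_apply_restrict[OF F] unfolding restrict_finite[OF F]
        by (simp add: cinner_sum_right cinner_cscale_right)
           (simp add: cinner_commute[of "A u"] cinner_ket_left A w_def)
      then have "cinner (A u) v - cinner u (bop_apply T v) = cinner (A u) ?d - cinner u (bop_apply T ?d)"
        by (simp add: cinner_diff_right blinfun.diff_right)
      also have "cmod \<dots> \<le> norm (A u) * norm ?d + norm u * (norm T * norm ?d)"
        by (rule order_trans[OF norm_triangle_ineq4])
           (intro add_mono cinner_bound order_trans[OF cinner_bound] mult_left_mono norm_bop_apply norm_ge_zero)
      also have "\<dots> \<le> (norm u * norm T) * norm ?d + norm u * (norm T * norm ?d)"
        by (intro add_right_mono mult_right_mono nA) simp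
      also have "\<dots> \<le> K * norm ?d" by (simp add: K_def algebra_simps)
      also have "\<dots> < e" using lt K by (simp add: field_simps)
      finally show ?thesis .
    qed
    then have "cmod (cinner (A u) v - cinner u (bop_apply T v)) \<le> 0" by (meson not_less order_less_irrefl)
    then show ?thesis by simp
  qed
  then show thesis by (intro that[of "Abs_bop (Blinfun A)"]) (simp add: C B)
qed

lemma cinner_star_left: "cinner (bop_apply (star T) u) v = cinner u (bop_apply T v)"
proof -
  obtain S where S: "\<forall>u v. cinner (bop_apply S u) v = cinner u (bop_apply T v)"
    using adjoint_exists[of T] by blast
  have "star T = S" unfolding star_bop_def
  proof (rule the_equality[where P = "\<lambda>S. \<forall>u v. cinner (bop_apply S u) v = cinner u (bop_apply T v)"])
    fix R assume "\<forall>u v. cinner (bop_apply R u) v = cinner u (bop_apply T v)"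
    then show "R = S" using S by (intro bop_eqI cinner_eqI) simp
  qed (rule S)
  then show ?thesis using S by simp
qed

lemma cinner_star_right: "cinner u (bop_apply (star T) v) = cinner (bop_apply T u) v"
  by (metis cinner_commute cinner_star_left)

lemma star_bopI: "(\<And>u v. cinner (bop_apply S u) v = cinner u (bop_apply T v)) \<Longrightarrow> star T = S"
  by (intro bop_eqI cinner_eqI) (simp add: cinner_star_left)

instance bop :: (type) star_ring
proof
  fix S T :: "'a bop"
  show "star (S + T) = star S + star T"
    by (rule star_bopI) (simp add: bop_apply_simps cinner_add_left cinner_add_right cinner_star_left)
  show "star (S * T) = star T * star S"
    by (rule star_bopI) (simp add: bop_apply_simps cinner_star_left)
  show "star (star T) = T"
    by (rule star_bopI) (simp add: cinner_star_right)
qed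

lemma star_scaleR: "star (r *\<^sub>R (T :: 'x bop)) = r *\<^sub>R star T"
  by (rule star_bopI) (simp add: bop_apply_simps scaleR_ell2_def cinner_cscale_left cinner_cscale_right cinner_star_left)

text \<open>The half of the C-star identity that submultiplicativity does not give: the squared norm
  of \<open>T u\<close> is the inner product of \<open>u\<close> with \<open>star T * T\<close>
  applied to \<open>u\<close>. It turns identities for \<open>star v * v\<close> into norm bounds
  for \<open>v\<close>.\<close>

lemma norm_star_mult: "(norm (T :: 'x bop))\<^sup>2 \<le> norm (star T * T)"
proof -
  have "norm (bop_apply T u) \<le> sqrt (norm (star T * T)) * norm u" for u
  proof -
    have "(norm (bop_apply T u))\<^sup>2 = cmod (cinner u (bop_apply (star T * T) u))"
      by (simp add: bop_apply_simps cinner_star_right cinner_self norm_power)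
    also have "\<dots> \<le> norm u * (norm (star T * T) * norm u)"
      by (rule order_trans[OF cinner_bound mult_left_mono[OF norm_bop_apply]]) simp
    finally have "sqrt ((norm (bop_apply T u))\<^sup>2) \<le> sqrt (norm (star T * T) * (norm u)\<^sup>2)"
      by (intro real_sqrt_le_mono) (simp add: power2_eq_square algebra_simps)
    then show ?thesis by (simp add: real_sqrt_mult)
  qed
  then have "norm T \<le> sqrt (norm (star T * T))" by (intro norm_bop_le) auto
  then show ?thesis by (simp add: sqrt_ge_absD)
qed

lemma norm_star [simp]: "norm (star (T :: 'x bop)) = norm T"
proof -
  have le: "norm T \<le> norm (star T)" for T :: "'x bop"
  proof (cases "norm T = 0")
    case False
    have "norm T * norm T \<le> norm (star T) * norm T"
      using order_trans[OF norm_star_mult norm_mult_ineq[of "star T" T]] by (simp add: power2_eq_square)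
    then show ?thesis using False by (simp add: mult_le_cancel_right)
  qed simp
  from le[of T] le[of "star T"] show ?thesis by simp
qed

lemma bounded_linear_star: "bounded_linear (star :: 'x bop \<Rightarrow> 'x bop)"
  by (rule bounded_linear_intro[where K = 1]) (auto simp: star_add star_scaleR)

lemma norm_isometry: "star T * T = 1 \<Longrightarrow> norm (T :: 'x bop) \<le> 1"
  using norm_star_mult[of T] by (simp add: power_le_one_iff abs_square_le_1)

lemma norm_projection: "star p = p \<Longrightarrow> p * p = p \<Longrightarrow> norm (p :: 'x bop) \<le> 1"
  using norm_star_mult[of p] by (cases "norm p = 0") (auto simp: power2_eq_square)

section \<open>Matrix coefficients\<close>

lemma matrix_of_inner: "matrix_of T x y = cinner (ket x) (bop_apply T (ket y))"
  by (simp add: matrix_of_def cinner_ket_left)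

lemma matrix_of_simps:
  "matrix_of (S + T) x y = matrix_of S x y + matrix_of T x y"
  "matrix_of (S - T) x y = matrix_of S x y - matrix_of T x y"
  "matrix_of (- T) x y = - matrix_of T x y"
  "matrix_of 0 x y = 0"
  "matrix_of 1 x y = (if x = y then 1 else 0)"
  "matrix_of (r *\<^sub>R T) x y = of_real r * matrix_of T x y"
  by (simp_all add: matrix_of_def bop_apply_simps ell2_simps ell2_apply_scaleR)

lemma matrix_of_sum: "matrix_of (sum f A) x y = (\<Sum>a\<in>A. matrix_of (f a) x y)"
  by (induction A rule: infinite_finite_induct) (auto simp: matrix_of_simps)

lemma matrix_of_star: "matrix_of (star T) x y = cnj (matrix_of T y x)"
  by (metis cinner_commute cinner_star_left matrix_of_inner)

lemma matrix_of_bound: "cmod (matrix_of T x y) \<le> norm T"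
  unfolding matrix_of_def using order_trans[OF ell2_apply_bound norm_bop_apply[of T "ket y"]] by simp

text \<open>A row of the matrix is the conjugate of the vector \<open>star T\<close> applied to
  \<open>ket x\<close>, hence square summable; that is why the infinite sum converges for every
  \<open>u\<close>.\<close>

lemma bop_apply_matrix: "ell2_apply (bop_apply T u) x = (\<Sum>\<^sub>\<infinity>y. matrix_of T x y * ell2_apply u y)"
proof -
  have "ell2_apply (bop_apply T u) x = cinner (bop_apply (star T) (ket x)) u"
    by (simp add: cinner_star_left cinner_ket_left)
  then show ?thesis
    by (simp add: cinner_def matrix_of_def[symmetric] matrix_of_star)
qed

lemma matrix_of_eqI: "(\<And>x y. matrix_of S x y = matrix_of T x y) \<Longrightarrow> S = T"
  by (intro bop_eqI ell2_eqI) (simp add: bop_apply_matrix)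

lemma matrix_of_mult: "matrix_of (S * T) x y = (\<Sum>\<^sub>\<infinity>z. matrix_of S x z * matrix_of T z y)"
proof -
  have "matrix_of (S * T) x y = ell2_apply (bop_apply S (bop_apply T (ket y))) x"
    by (simp only: matrix_of_def bop_apply_simps)
  also have "\<dots> = (\<Sum>\<^sub>\<infinity>z. matrix_of S x z * matrix_of T z y)"
    unfolding bop_apply_matrix[of S] by (simp only: matrix_of_def)
  finally show ?thesis .
qed

lemma matrix_of_mult_nonzero:
  assumes "matrix_of (S * T) x y \<noteq> 0"
  obtains z where "matrix_of S x z \<noteq> 0" "matrix_of T z y \<noteq> 0"
proof -
  have "\<exists>z. matrix_of S x z * matrix_of T z y \<noteq> 0"
  proof (rule ccontr)
    assume "\<nexists>z. matrix_of S x z * matrix_of T z y \<noteq> 0"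
    then have "matrix_of (S * T) x y = 0"
      unfolding matrix_of_mult by (intro infsum_0) auto
    with assms show False by simp
  qed
  then show thesis using that by auto
qed

section \<open>Completeness\<close>

instance ell2 :: (type) banach
proof
  fix X :: "nat \<Rightarrow> 'a ell2"
  assume X: "Cauchy X"
  have "\<exists>l. (\<lambda>n. ell2_apply (X n) x) \<longlonglongrightarrow> l" for x
  proof -
    have "Cauchy (\<lambda>n. ell2_apply (X n) x)"
    proof (rule metric_CauchyI)
      fix e :: real assume "e > 0"
      then obtain M where M: "\<forall>m\<ge>M. \<forall>n\<ge>M. dist (X m) (X n) < e"
        using X by (auto simp: Cauchy_def)
      have "dist (ell2_apply (X m) x) (ell2_apply (X n) x) \<le> dist (X m) (X n)" for m n
        using ell2_apply_bound[of "X m - X n" x] by (simp add: dist_norm ell2_simps)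
      then show "\<exists>M. \<forall>m\<ge>M. \<forall>n\<ge>M. dist (ell2_apply (X m) x) (ell2_apply (X n) x) < e"
        using M le_less_trans by blast
    qed
    then show ?thesis using Cauchy_convergent_iff convergent_def by blast
  qed
  then obtain l where l: "(\<lambda>n. ell2_apply (X n) x) \<longlonglongrightarrow> l x" for x by metis
  \<comment> \<open>Fatou's argument: finite partial sums pass to the coordinatewise limit, and the
    bound does not depend on the finite set.\<close>
  have fin: "(\<Sum>x\<in>F. (cmod (ell2_apply (X m) x - l x))\<^sup>2) \<le> e\<^sup>2"
    if "finite F" "e > 0" "\<forall>n\<ge>M. norm (X m - X n) < e" for F e m M
  proof (rule tendsto_upperbound)
    show "(\<lambda>n. \<Sum>x\<in>F. (cmod (ell2_apply (X m) x - ell2_apply (X n) x))\<^sup>2) \<longlonglongrightarrow>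
        (\<Sum>x\<in>F. (cmod (ell2_apply (X m) x - l x))\<^sup>2)"
      by (intro tendsto_intros l)
    have "(\<Sum>x\<in>F. (cmod (ell2_apply (X m) x - ell2_apply (X n) x))\<^sup>2) \<le> (norm (X m - X n))\<^sup>2" for n
      unfolding norm_ell2_sq using summable_ell2[of "X m - X n"] that(1)
      by (auto simp: ell2_simps intro!: finite_sum_le_infsum)
    then show "\<forall>\<^sub>F n in sequentially. (\<Sum>x\<in>F. (cmod (ell2_apply (X m) x - ell2_apply (X n) x))\<^sup>2) \<le> e\<^sup>2"
      unfolding eventually_sequentially
      by (intro exI[of _ M] allI impI) (rule order_trans, assumption,
          rule power_mono, use that(3) in \<open>auto intro: less_imp_le\<close>)
  qed simp
  have summ: "(\<lambda>x. (cmod (ell2_apply (X m) x - l x))\<^sup>2) summable_on UNIV"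
    if "e > 0" "\<forall>n\<ge>M. norm (X m - X n) < e" for e m M
    by (rule nonneg_bdd_above_summable_on) (auto intro!: bdd_aboveI2 fin[OF _ that])
  obtain M1 where "\<forall>m\<ge>M1. \<forall>n\<ge>M1. dist (X m) (X n) < 1"
    using X[unfolded Cauchy_def, rule_format, of 1] by auto
  then have "\<forall>n\<ge>M1. norm (X M1 - X n) < 1" by (simp add: dist_norm)
  from summ[OF _ this] have s1: "(\<lambda>x. (cmod (ell2_apply (X M1) x - l x))\<^sup>2) summable_on UNIV" by simp
  \<comment> \<open>What is known to be square summable is the difference from a fixed member of the
    sequence, so the limit is recovered from it.\<close>
  define d where "d = Abs_ell2 (\<lambda>x. ell2_apply (X M1) x - l x)"
  have d: "ell2_apply d x = ell2_apply (X M1) x - l x" for x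
    unfolding d_def using s1 by (subst Abs_ell2_inverse) auto
  define L where "L = X M1 - d"
  have L: "ell2_apply L x = l x" for x by (simp add: L_def ell2_simps d)
  have "X \<longlonglongrightarrow> L"
  proof (rule metric_LIMSEQ_I)
    fix r :: real assume "r > 0"
    then obtain M where M: "\<forall>m\<ge>M. \<forall>n\<ge>M. dist (X m) (X n) < r / 2"
      using X[unfolded Cauchy_def, rule_format, of "r / 2"] by auto
    have "dist (X m) L < r" if "m \<ge> M" for m
    proof -
      have m: "\<forall>n\<ge>M. norm (X m - X n) < r / 2" using M that by (simp add: dist_norm)
      have "(norm (X m - L))\<^sup>2 \<le> (r / 2)\<^sup>2"
        unfolding norm_ell2_sq using \<open>r > 0\<close> m
        by (auto simp: ell2_simps L intro!: infsum_le_finite_sums summ fin)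
      then show ?thesis using \<open>r > 0\<close> by (simp add: dist_norm power2_le_iff_abs_le)
    qed
    then show "\<exists>no. \<forall>n\<ge>no. dist (X n) L < r" by blast
  qed
  then show "convergent X" by (auto simp: convergent_def)
qed

lemma bounded_linear_cscale: "bounded_linear (cscale c)"
  by (rule bounded_linear_intro[where K = "cmod c"]) (auto simp: cscale_add cscale_scaleR norm_cscale)

instance bop :: (type) banach
proof
  fix X :: "nat \<Rightarrow> 'a bop"
  assume "Cauchy X"
  then have "Cauchy (\<lambda>n. blinfun_of_bop (X n))"
    by (simp add: Cauchy_def dist_bop_def norm_bop.rep_eq minus_bop.rep_eq dist_norm)
  then obtain L where L: "(\<lambda>n. blinfun_of_bop (X n)) \<longlonglongrightarrow> L"
    using Cauchy_convergent_iff convergent_def by blast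
  have p: "(\<lambda>n. bop_apply (X n) u) \<longlonglongrightarrow> L u" for u
    by (intro tendsto_intros L)
  have "L (cscale c u) = cscale c (L u)" for c u
  proof (rule LIMSEQ_unique[OF p])
    show "(\<lambda>n. bop_apply (X n) (cscale c u)) \<longlonglongrightarrow> cscale c (L u)"
      unfolding bop_apply_cscale by (rule bounded_linear.tendsto[OF bounded_linear_cscale p])
  qed
  then have "blinfun_of_bop (Abs_bop L) = L" by (intro Abs_bop_inverse) simp
  then have "X \<longlonglongrightarrow> Abs_bop L"
    using L by (simp add: lim_sequentially dist_bop_def norm_bop.rep_eq minus_bop.rep_eq dist_norm)
  then show "convergent X" by (auto simp: convergent_def)
qed

section \<open>Polar parts of approximate partial isometries\<close>

text \<open>The binomial series of \<open>(1 - y)\<^sup>-\<^sup>1\<^sup>/\<^sup>2\<close>.\<close>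

definition inv_sqrt_coeff :: "nat \<Rightarrow> real" where
  "inv_sqrt_coeff k = pochhammer (1/2) k / fact k"

definition inv_sqrt :: "'a::{real_normed_algebra_1,banach} \<Rightarrow> 'a" where
  "inv_sqrt y = (\<Sum>k. inv_sqrt_coeff k *\<^sub>R y ^ k)"

lemma inv_sqrt_coeff_nonneg: "0 \<le> inv_sqrt_coeff k"
  unfolding inv_sqrt_coeff_def by (intro divide_nonneg_nonneg pochhammer_nonneg) auto

lemma inv_sqrt_coeff_le: "inv_sqrt_coeff k \<le> 1"
proof -
  have "pochhammer (1/2 :: real) k \<le> fact k"
  proof (induction k)
    case (Suc k)
    have "pochhammer (1/2 :: real) k * (1/2 + real k) \<le> fact k * (real k + 1)"
      by (intro mult_mono Suc) auto
    then show ?case by (simp add: pochhammer_rec' algebra_simps)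
  qed simp
  then show ?thesis by (simp add: inv_sqrt_coeff_def)
qed

text \<open>The coefficients are the binomial coefficients of -1/2 up to the sign (-1)^k.
  Vandermonde's identity leads to the binomial coefficients of -1, so the squared series is the
  geometric one.\<close>

lemma inv_sqrt_coeff_convolution: "(\<Sum>i\<le>k. inv_sqrt_coeff i * inv_sqrt_coeff (k - i)) = 1"
proof -
  have c: "inv_sqrt_coeff k = (-1) ^ k * ((-1/2) gchoose k)" for k
    by (simp add: inv_sqrt_coeff_def gbinomial_pochhammer)
  have "(\<Sum>i\<le>k. inv_sqrt_coeff i * inv_sqrt_coeff (k - i))
      = (\<Sum>i\<in>{0..k}. (-1) ^ k * (((-1/2) gchoose i) * ((-1/2 :: real) gchoose (k - i))))"
  proof (rule sum.cong)
    fix i assume "i \<in> {0..k}"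
    then have "(- 1 :: real) ^ k = (-1) ^ i * (-1) ^ (k - i)"
      by (simp flip: power_add)
    then show "inv_sqrt_coeff i * inv_sqrt_coeff (k - i)
        = (-1) ^ k * (((-1/2) gchoose i) * ((-1/2 :: real) gchoose (k - i)))"
      by (simp add: c)
  qed auto
  also have "\<dots> = (-1) ^ k * ((-1/2 + -1/2 :: real) gchoose k)"
    unfolding gbinomial_Vandermonde[symmetric] by (simp add: sum_distrib_left)
  also have "\<dots> = 1" by (simp add: gbinomial_pochhammer flip: pochhammer_fact)
  finally show ?thesis .
qed

lemma norm_inv_sqrt_term: "norm (inv_sqrt_coeff k *\<^sub>R y ^ k) \<le> norm (y :: 'a::real_normed_algebra_1) ^ k"
proof -
  have "inv_sqrt_coeff k * norm (y ^ k) \<le> 1 * norm y ^ k"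
    by (intro mult_mono inv_sqrt_coeff_le norm_power_ineq) auto
  then show ?thesis by (simp add: inv_sqrt_coeff_nonneg)
qed

context
  fixes y :: "'a::{real_normed_algebra_1,banach}"
  assumes y: "norm y < 1"
begin

lemma inv_sqrt_summable_norm: "summable (\<lambda>k. norm (inv_sqrt_coeff k *\<^sub>R y ^ k))"
  by (rule summable_comparison_test'[of "\<lambda>k. norm y ^ k"])
     (use y in \<open>auto intro: summable_geometric order_trans[OF _ norm_inv_sqrt_term]\<close>)

lemma inv_sqrt_sums: "(\<lambda>k. inv_sqrt_coeff k *\<^sub>R y ^ k) sums inv_sqrt y"
  unfolding inv_sqrt_def by (rule summable_sums[OF summable_norm_cancel[OF inv_sqrt_summable_norm]])

text \<open>By the convolution identity the square is the geometric series, whose product with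
  \<open>1 - y\<close> telescopes.\<close>

lemma inv_sqrt_square: "inv_sqrt y * inv_sqrt y * (1 - y) = 1"
proof -
  have s: "summable (\<lambda>k. y ^ k)"
    by (rule summable_norm_cancel, rule summable_comparison_test'[of "\<lambda>k. norm y ^ k"])
       (use y in \<open>auto intro: summable_geometric norm_power_ineq\<close>)
  have "inv_sqrt y * inv_sqrt y
      = (\<Sum>k. \<Sum>i\<le>k. (inv_sqrt_coeff i *\<^sub>R y ^ i) * (inv_sqrt_coeff (k - i) *\<^sub>R y ^ (k - i)))"
    unfolding inv_sqrt_def by (rule Cauchy_product[OF inv_sqrt_summable_norm inv_sqrt_summable_norm])
  also have "\<dots> = (\<Sum>k. (\<Sum>i\<le>k. inv_sqrt_coeff i * inv_sqrt_coeff (k - i)) *\<^sub>R y ^ k)"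
    unfolding scaleR_sum_left
    by (intro suminf_cong sum.cong refl) (simp flip: power_add)
  also have "\<dots> = (\<Sum>k. y ^ k)"
    by (simp add: inv_sqrt_coeff_convolution)
  finally have "inv_sqrt y * inv_sqrt y * (1 - y) = (\<Sum>k. y ^ k) - (\<Sum>k. y ^ k) * y"
    by (simp add: algebra_simps)
  also have "(\<Sum>k. y ^ k) * y = (\<Sum>k. y ^ Suc k)"
    using suminf_mult2[OF s, of y] by (simp add: power_Suc2 del: power_Suc)
  also have "(\<Sum>k. y ^ k) - (\<Sum>k. y ^ Suc k) = 1"
    using suminf_split_head[OF s] by simp
  finally show ?thesis .
qed

lemma inv_sqrt_commute:
  assumes "z * y = y * z"
  shows "z * inv_sqrt y = inv_sqrt y * z"
proof -
  have "z * y ^ k = y ^ k * z" for k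
    by (rule power_commuting_commutes[OF assms[symmetric], symmetric])
  then have "(\<lambda>k. z * (inv_sqrt_coeff k *\<^sub>R y ^ k)) = (\<lambda>k. (inv_sqrt_coeff k *\<^sub>R y ^ k) * z)" by auto
  with sums_mult[OF inv_sqrt_sums, of z] sums_mult2[OF inv_sqrt_sums, of z]
  show ?thesis using sums_unique2 by metis
qed

text \<open>The coefficients are at most 1, so the series without its first term is dominated by a
  geometric one. Hence passing to a polar part is a vanishing change whenever \<open>y\<close>
  vanishes in the limit.\<close>

lemma norm_inv_sqrt_diff_one: "norm (inv_sqrt y - 1) \<le> norm y / (1 - norm y)"
proof -
  have "(\<lambda>k. inv_sqrt_coeff (Suc k) *\<^sub>R y ^ Suc k) sums (inv_sqrt y - 1)"
    using inv_sqrt_sums by (subst sums_Suc_iff) (simp add: inv_sqrt_coeff_def)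
  then have "inv_sqrt y - 1 = (\<Sum>k. inv_sqrt_coeff (Suc k) *\<^sub>R y ^ Suc k)"
    by (rule sums_unique)
  also have "norm \<dots> \<le> (\<Sum>k. norm y * norm y ^ k)"
  proof (rule norm_suminf_le)
    show "norm (inv_sqrt_coeff (Suc k) *\<^sub>R y ^ Suc k) \<le> norm y * norm y ^ k" for k
      using norm_inv_sqrt_term[of "Suc k" y] by simp
    show "summable (\<lambda>k. norm y * norm y ^ k)"
      using y by (intro summable_mult summable_geometric) auto
  qed
  also have "\<dots> = norm y / (1 - norm y)"
    using y by (subst suminf_mult) (auto simp: suminf_geometric summable_geometric)
  finally show ?thesis .
qed

text \<open>The factor \<open>x\<close> is kept so that \<open>A\<close> may lack a unit: the term
  with k = 0 is \<open>x\<close> and not 1.\<close>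

lemma mult_inv_sqrt_closed:
  assumes "closed A" "real_vector.subspace A" "\<And>k. x * y ^ k \<in> A"
  shows "x * inv_sqrt y \<in> A"
proof -
  have "(\<lambda>n. \<Sum>k<n. x * (inv_sqrt_coeff k *\<^sub>R y ^ k)) \<longlonglongrightarrow> x * inv_sqrt y"
    using sums_mult[OF inv_sqrt_sums] by (simp add: sums_def)
  moreover have "(\<Sum>k<n. x * (inv_sqrt_coeff k *\<^sub>R y ^ k)) \<in> A" for n
    using assms(2,3) by (intro real_vector.subspace_sum) (auto simp: real_vector.subspace_scale)
  ultimately show ?thesis using closed_sequentially[OF assms(1)] by metis
qed

end

lemma star_power: "star (a ^ k) = star (a :: 'a::star_ring) ^ k"
  by (induction k) (auto simp: star_mult power_commutes)

lemma star_inv_sqrt: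
  assumes "norm (y :: 'x bop) < 1" "star y = y"
  shows "star (inv_sqrt y) = inv_sqrt y"
proof -
  have "(\<lambda>k. inv_sqrt_coeff k *\<^sub>R y ^ k) sums star (inv_sqrt y)"
    using bounded_linear.sums[OF bounded_linear_star inv_sqrt_sums[OF assms(1)]] assms(2)
    by (simp add: star_scaleR star_power)
  with inv_sqrt_sums[OF assms(1)] show ?thesis using sums_unique2 by blast
qed

text \<open>The partial isometry is the polar part \<open>x (x\<^sup>* x)\<^sup>-\<^sup>1\<^sup>/\<^sup>2\<close>, the inverse square root being
  taken in the corner of \<open>p\<close>.\<close>

lemma polar_partial_isometry:
  fixes x p q :: "'x bop"
  assumes A: "closed A" "real_vector.subspace A" "\<And>a b. a \<in> A \<Longrightarrow> b \<in> A \<Longrightarrow> a * b \<in> A"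
    "\<And>a. a \<in> A \<Longrightarrow> star a \<in> A" and "x \<in> A" "p \<in> A"
    and p: "star p = p" "p * p = p" "x * p = x" and q: "star q = q" "q * q = q" "q * x = x"
    and lt: "norm (p - star x * x) < 1" "norm (q - x * star x) < 1"
  obtains v where "v = x * inv_sqrt (p - star x * x)" "v \<in> A" "star v * v = p" "v * star v = q"
proof
  \<comment> \<open>Taking \<open>p\<close> instead of 1 makes \<open>1 - y\<close> equal to
    \<open>star x * x\<close> on the corner of \<open>p\<close> and to 1 on its complement, so it is
    invertible although \<open>star x * x\<close> need not be.\<close>
  define y where "y = p - star x * x"
  define r where "r = inv_sqrt y"
  define v where "v = x * r"
  show "v = x * inv_sqrt (p - star x * x)" by (simp add: v_def r_def y_def)
  have y: "norm y < 1" using lt by (simp add: y_def)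
  have px: "p * star x = star x" using p star_mult[of x p] by simp
  have pxx: "p * (star x * x) = star x * x" "star x * x * p = star x * x"
    by (simp_all add: px p(3) flip: mult.assoc) (simp add: p(3) mult.assoc)
  have py: "p * y = y" "y * p = y"
    by (simp_all add: y_def right_diff_distrib left_diff_distrib p pxx)
  have sy: "star y = y" by (simp add: y_def star_diff star_mult p)
  have yr: "y * r = r * y" and pr: "p * r = r * p"
    unfolding r_def using py by (auto intro: inv_sqrt_commute[OF y])
  have rr: "r * r * (1 - y) = 1" unfolding r_def by (rule inv_sqrt_square[OF y])
  have sr: "star r = r" unfolding r_def by (rule star_inv_sqrt[OF y sy])
  have yA: "y \<in> A" using assms by (auto simp: y_def intro!: real_vector.subspace_diff)
  have "x * y ^ k \<in> A" for k
  proof (induction k)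
    case (Suc k)
    then show ?case using A(3)[OF Suc yA] by (simp add: mult.assoc power_commutes)
  qed (use \<open>x \<in> A\<close> in simp)
  then show "v \<in> A" unfolding v_def r_def by (rule mult_inv_sqrt_closed[OF y A(1,2)])
  have xx: "star x * x = p * (1 - y)" by (simp add: y_def right_diff_distrib p pxx)
  have yr1: "(1 - y) * r = r * (1 - y)" by (simp add: left_diff_distrib right_diff_distrib yr)
  have "star v * v = r * (star x * x) * r" by (simp add: v_def star_mult sr mult.assoc)
  also have "\<dots> = p * (r * r * (1 - y))"
  proof -
    have "r * (p * (1 - y)) * r = (r * p) * (r * (1 - y))" by (simp only: mult.assoc yr1)
    also have "\<dots> = p * (r * r * (1 - y))" unfolding pr[symmetric] by (simp only: mult.assoc)
    finally show ?thesis unfolding xx .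
  qed
  finally show vv: "star v * v = p" by (simp add: rr)
  \<comment> \<open>\<open>g\<close> is the part of \<open>q\<close> that the range projection of
    \<open>v\<close> misses. It kills \<open>v\<close>, hence \<open>x\<close>, so multiplying it by
    \<open>q - x * star x\<close> changes nothing; as that factor has norm below 1, \<open>g\<close>
    is 0.\<close>
  define g where "g = q - v * star v"
  have qv: "q * v = v" using q by (simp add: v_def mult.assoc[symmetric])
  have vp: "v * p = v" by (simp add: v_def mult.assoc flip: pr) (simp add: p(3) flip: mult.assoc)
  have vq: "star v * q = star v" using qv star_mult[of q v] q(1) by simp
  have "g * v = 0" by (simp add: g_def left_diff_distrib mult.assoc vv vp qv)
  then have "g * x * (r * (r * (1 - y))) = 0" by (simp add: v_def flip: mult.assoc)
  then have "g * x = 0" using rr by (simp add: mult.assoc)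
  then have "g * (q - x * star x) = g"
    by (simp add: right_diff_distrib flip: mult.assoc) (simp add: g_def left_diff_distrib mult.assoc q(2) vq)
  then have "norm g \<le> norm g * norm (q - x * star x)" by (metis norm_mult_ineq)
  then have "norm g * (1 - norm (q - x * star x)) \<le> 0" by (simp add: algebra_simps)
  then have "norm g = 0" using lt(2) by (auto simp: mult_le_0_iff)
  then show "v * star v = q" by (simp add: g_def)
qed

section \<open>Operators with locally finite matrices\<close>

definition supp :: "'x bop \<Rightarrow> ('x \<times> 'x) set" where
  "supp T = {(x, y). matrix_of T x y \<noteq> 0}"

definition locally_finite_rel :: "nat \<Rightarrow> ('x \<times> 'x) set \<Rightarrow> bool" where
  "locally_finite_rel N E \<longleftrightarrow>
     (\<forall>x. finite (E `` {x}) \<and> card (E `` {x}) \<le> N \<and> finite (E\<inverse> `` {x}) \<and> card (E\<inverse> `` {x}) \<le> N)"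

lemma supp_mult: "supp (S * T) \<subseteq> supp S O supp T"
  by (auto simp: supp_def elim!: matrix_of_mult_nonzero)

lemma supp_star: "supp (star T) = (supp T)\<inverse>"
  by (auto simp: supp_def matrix_of_star)

lemma supp_add: "supp (S + T) \<subseteq> supp S \<union> supp T"
  by (auto simp: supp_def matrix_of_simps)

lemma supp_diff: "supp (S - T) \<subseteq> supp S \<union> supp T"
  by (auto simp: supp_def matrix_of_simps)

lemma supp_scaleR: "supp (r *\<^sub>R T) \<subseteq> supp T"
  by (auto simp: supp_def matrix_of_simps)

lemma bounded_linear_matrix_of: "bounded_linear (\<lambda>T. matrix_of T x y)"
  by (rule bounded_linear_intro[where K = 1])
     (auto simp: matrix_of_simps matrix_of_bound scaleR_conv_of_real[where 'a = complex])

text \<open>Matrix coefficients are continuous, so a support condition survives norm limits, in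
  particular the power series of a polar part.\<close>

lemma closed_supp: "closed {T. supp T \<subseteq> E}"
proof -
  have "{T. supp T \<subseteq> E} = (\<Inter>(x, y)\<in>-E. {T. matrix_of T x y = 0})"
    by (auto simp: supp_def)
  moreover have "closed {T. matrix_of T x y = 0}" for x y
    by (intro closed_Collect_eq continuous_intros
          linear_continuous_on[OF bounded_linear_matrix_of])
  ultimately show ?thesis by (auto intro!: closed_INT)
qed

lemma subspace_supp: "real_vector.subspace {T. supp T \<subseteq> E}"
proof (rule real_vector.subspaceI)
  show "(0 :: 'a bop) \<in> {T. supp T \<subseteq> E}" by (simp add: supp_def matrix_of_simps)
  show "S + T \<in> {T. supp T \<subseteq> E}" if "S \<in> {T. supp T \<subseteq> E}" "T \<in> {T. supp T \<subseteq> E}" for S T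
    using that supp_add[of S T] by auto
  show "c *\<^sub>R T \<in> {T. supp T \<subseteq> E}" if "T \<in> {T. supp T \<subseteq> E}" for c T
    using that supp_scaleR[of c T] by auto
qed

text \<open>Cauchy-Schwarz in each row costs one factor \<open>N\<close>; each coordinate of
  \<open>u\<close> is then counted in at most \<open>N\<close> rows, which costs the other.\<close>

lemma schur_bound:
  fixes m :: "'x \<Rightarrow> 'x \<Rightarrow> complex"
  assumes E: "locally_finite_rel N E" and C: "0 \<le> C" "\<And>x y. cmod (m x y) \<le> C"
    and m: "\<And>x y. m x y \<noteq> 0 \<Longrightarrow> (x, y) \<in> E" and "finite G"
  shows "(\<Sum>x\<in>G. (cmod (\<Sum>y\<in>E `` {x}. m x y * ell2_apply u y))\<^sup>2) \<le> (C * N * norm u)\<^sup>2"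
proof -
  let ?u = "\<lambda>y. (cmod (ell2_apply u y))\<^sup>2"
  have fin: "finite (E `` {x})" "card (E `` {x}) \<le> N" "finite {x. (x, y) \<in> E}" "card {x. (x, y) \<in> E} \<le> N" for x y
    using E[unfolded locally_finite_rel_def, rule_format, of x]
      E[unfolded locally_finite_rel_def, rule_format, of y] by (auto simp: Image_def)
  have row: "(cmod (\<Sum>y\<in>E `` {x}. m x y * ell2_apply u y))\<^sup>2 \<le> N * C\<^sup>2 * (\<Sum>y\<in>E `` {x}. ?u y)" for x
  proof -
    have "cmod (\<Sum>y\<in>E `` {x}. m x y * ell2_apply u y) \<le> (\<Sum>y\<in>E `` {x}. C * cmod (ell2_apply u y))"
      by (rule order_trans[OF norm_sum sum_mono]) (auto simp: norm_mult intro!: mult_right_mono C)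
    then have "(cmod (\<Sum>y\<in>E `` {x}. m x y * ell2_apply u y))\<^sup>2 \<le> (\<Sum>y\<in>E `` {x}. C * cmod (ell2_apply u y))\<^sup>2"
      by (rule power_mono) simp
    also have "\<dots> \<le> (\<Sum>y\<in>E `` {x}. (C * cmod (ell2_apply u y))\<^sup>2) * card (E `` {x})"
      by (rule sum_squared_le_sum_of_squares)
    also have "\<dots> \<le> (\<Sum>y\<in>E `` {x}. (C * cmod (ell2_apply u y))\<^sup>2) * N"
      using fin by (intro mult_left_mono sum_nonneg) auto
    finally show ?thesis by (simp add: power_mult_distrib mult.commute mult.left_commute flip: sum_distrib_left)
  qed
  define H where "H = (\<Union>x\<in>G. E `` {x})"
  have H: "finite H" using fin \<open>finite G\<close> by (auto simp: H_def)
  have "(\<Sum>x\<in>G. \<Sum>y\<in>E `` {x}. ?u y) = (\<Sum>x\<in>G. \<Sum>y | y \<in> H \<and> (x, y) \<in> E. ?u y)"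
    by (intro sum.cong refl) (auto simp: H_def)
  also have "\<dots> = (\<Sum>y\<in>H. \<Sum>x | x \<in> G \<and> (x, y) \<in> E. ?u y)"
    by (rule sum.swap_restrict[OF \<open>finite G\<close> H])
  also have "\<dots> \<le> (\<Sum>y\<in>H. N * ?u y)"
  proof (rule sum_mono)
    fix y
    have "card {x \<in> G. (x, y) \<in> E} \<le> card {x. (x, y) \<in> E}"
      using fin by (intro card_mono) auto
    then have "card {x \<in> G. (x, y) \<in> E} \<le> N" using fin(4)[of y] by linarith
    then show "(\<Sum>x | x \<in> G \<and> (x, y) \<in> E. ?u y) \<le> N * ?u y"
      by (simp add: mult_right_mono)
  qed
  also have "\<dots> \<le> N * (norm u)\<^sup>2"
    unfolding sum_distrib_left[symmetric] norm_ell2_sq using H summable_ell2[of u]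
    by (intro mult_left_mono finite_sum_le_infsum) auto
  finally have "N * C\<^sup>2 * (\<Sum>x\<in>G. \<Sum>y\<in>E `` {x}. ?u y) \<le> N * C\<^sup>2 * (N * (norm u)\<^sup>2)"
    by (intro mult_left_mono) auto
  moreover have "(\<Sum>x\<in>G. (cmod (\<Sum>y\<in>E `` {x}. m x y * ell2_apply u y))\<^sup>2)
      \<le> N * C\<^sup>2 * (\<Sum>x\<in>G. \<Sum>y\<in>E `` {x}. ?u y)"
    unfolding sum_distrib_left[of _ _ G] by (intro sum_mono row)
  moreover have "N * C\<^sup>2 * (N * (norm u)\<^sup>2) = (C * N * norm u)\<^sup>2"
    by (simp add: power2_eq_square)
  ultimately show ?thesis by linarith
qed

text \<open>Finiteness of the rows makes the action of \<open>m\<close> a finite sum in each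
  coordinate, and \<open>schur_bound\<close> makes the result square summable.\<close>

lemma bop_of_matrix:
  fixes m :: "'x \<Rightarrow> 'x \<Rightarrow> complex"
  assumes E: "locally_finite_rel N E" and C: "0 \<le> C" "\<And>x y. cmod (m x y) \<le> C"
    and m: "\<And>x y. m x y \<noteq> 0 \<Longrightarrow> (x, y) \<in> E"
  obtains T where "matrix_of T = m" "norm T \<le> C * N"
proof -
  let ?w = "\<lambda>u x. \<Sum>y\<in>E `` {x}. m x y * ell2_apply u y"
  note bd = schur_bound[OF E C m]
  have fin: "finite (E `` {x})" for x using E by (auto simp: locally_finite_rel_def)
  have summ: "(\<lambda>x. (cmod (?w u x))\<^sup>2) summable_on UNIV" for u
    by (rule nonneg_bdd_above_summable_on) (auto intro!: bdd_aboveI2 bd)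
  define A where "A u = Abs_ell2 (?w u)" for u
  have A: "ell2_apply (A u) x = ?w u x" for u x
    unfolding A_def by (subst Abs_ell2_inverse) (auto simp: summ)
  have nA: "norm (A u) \<le> norm u * (C * N)" for u
  proof -
    have "(norm (A u))\<^sup>2 \<le> (C * N * norm u)\<^sup>2"
      unfolding norm_ell2_sq A by (rule infsum_le_finite_sums[OF summ bd])
    then show ?thesis using C(1) by (simp add: mult.commute power2_le_iff_abs_le)
  qed
  have "bounded_linear A"
  proof (rule bounded_linear_intro[where K = "C * N"])
    show "A (u + v) = A u + A v" for u v
      by (rule ell2_eqI) (simp add: A ell2_simps distrib_left sum.distrib)
    show "A (r *\<^sub>R u) = r *\<^sub>R A u" for r u
      by (rule ell2_eqI) (simp add: A ell2_apply_scaleR sum_distrib_left mult.left_commute)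
  qed (rule nA)
  then have B: "blinfun_apply (Blinfun A) = A" by (rule bounded_linear_Blinfun_apply)
  have D: "blinfun_of_bop (Abs_bop (Blinfun A)) = Blinfun A"
    by (rule Abs_bop_inverse)
       (auto simp: B A ell2_simps sum_distrib_left mult.left_commute intro!: ell2_eqI)
  show thesis
  proof
    show "norm (Abs_bop (Blinfun A)) \<le> C * N"
      using C(1) nA by (intro norm_bop_le) (auto simp: D B mult.commute)
    have "(\<Sum>z\<in>E `` {x}. m x z * (if z = y then 1 else 0)) = m x y" for x y
      using fin m[of x y] by (cases "m x y = 0") (auto simp: if_distrib cong: if_cong)
    then show "matrix_of (Abs_bop (Blinfun A)) = m"
      by (intro ext) (simp add: matrix_of_def D B A ket.rep_eq)
  qed
qed

lemma norm_bop_schur: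
  assumes "locally_finite_rel N E" "0 \<le> C" "\<And>x y. cmod (matrix_of T x y) \<le> C" "supp T \<subseteq> E"
  shows "norm T \<le> C * N"
proof -
  obtain S where "matrix_of S = matrix_of T" "norm S \<le> C * N"
    using bop_of_matrix[where m = "matrix_of T", OF assms(1-3)] assms(4) unfolding supp_def by blast
  then show ?thesis by (metis matrix_of_eqI)
qed

section \<open>Diagonal operators\<close>

lemma ell_infty_closed [intro, simp]:
  "f \<in> ell_infty \<Longrightarrow> g \<in> ell_infty \<Longrightarrow> f + g \<in> ell_infty"
  "f \<in> ell_infty \<Longrightarrow> g \<in> ell_infty \<Longrightarrow> f * g \<in> ell_infty"
  "f \<in> ell_infty \<Longrightarrow> - f \<in> ell_infty"
  "f \<in> ell_infty \<Longrightarrow> star f \<in> ell_infty"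
  "(0 :: 'x \<Rightarrow> complex) \<in> ell_infty" "(1 :: 'x \<Rightarrow> complex) \<in> ell_infty"
proof -
  assume f: "f \<in> ell_infty"
  then obtain B where B: "cmod (f x) \<le> B" for x by (auto simp: ell_infty_def bounded_iff)
  show "- f \<in> ell_infty" "star f \<in> ell_infty"
    using B by (auto simp: ell_infty_def bounded_iff star_fun_def star_complex_def)
  assume "g \<in> ell_infty"
  then obtain C where C: "cmod (g x) \<le> C" for x by (auto simp: ell_infty_def bounded_iff)
  have "cmod (f x * g x) \<le> B * C" for x
    unfolding norm_mult using B[of x] C[of x] norm_ge_zero order_trans by (intro mult_mono) blast+
  then show "f * g \<in> ell_infty" by (auto simp: ell_infty_def bounded_iff)
  have "cmod (f x + g x) \<le> B + C" for x
    using norm_triangle_mono[OF B C] .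
  then show "f + g \<in> ell_infty" by (auto simp: ell_infty_def bounded_iff)
qed (auto simp: ell_infty_def bounded_iff)

lemma ell_inftyI: "(\<And>x. cmod (f x) \<le> C) \<Longrightarrow> f \<in> ell_infty"
  by (auto simp: ell_infty_def bounded_iff)

lemma matrix_of_diag_op: "f \<in> ell_infty \<Longrightarrow> matrix_of (diag_op f) x y = (if x = y then f x else 0)"
  by (simp add: matrix_of_def diag_op_apply ket.rep_eq)

lemma diag_op_add: "f \<in> ell_infty \<Longrightarrow> g \<in> ell_infty \<Longrightarrow> diag_op (f + g) = diag_op f + diag_op g"
  by (rule matrix_of_eqI) (simp add: matrix_of_diag_op matrix_of_simps)

lemma diag_op_mult: "f \<in> ell_infty \<Longrightarrow> g \<in> ell_infty \<Longrightarrow> diag_op (f * g) = diag_op f * diag_op g"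
  by (intro bop_eqI ell2_eqI) (simp add: diag_op_apply bop_apply_simps)

lemma diag_op_star: "f \<in> ell_infty \<Longrightarrow> diag_op (star f) = star (diag_op f)"
  by (rule matrix_of_eqI)
     (simp add: matrix_of_diag_op[OF ell_infty_closed(4)] matrix_of_diag_op matrix_of_star,
      simp add: star_fun_def star_complex_def)

lemma diag_op_zero: "diag_op 0 = 0" and diag_op_one: "diag_op 1 = 1"
  by (rule matrix_of_eqI; simp add: matrix_of_diag_op matrix_of_simps)+

lemma matrix_of_diag_mult:
  assumes "f \<in> ell_infty"
  shows "matrix_of (diag_op f * T) x y = f x * matrix_of T x y"
  by (simp add: matrix_of_def bop_apply_simps diag_op_apply[OF assms])

lemma matrix_of_mult_diag:
  assumes "f \<in> ell_infty"
  shows "matrix_of (T * diag_op f) x y = matrix_of T x y * f y"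
proof -
  have "bop_apply (diag_op f) (ket y) = cscale (f y) (ket y)"
    by (rule ell2_eqI) (auto simp: diag_op_apply[OF assms] ell2_simps)
  then show ?thesis by (simp add: matrix_of_def bop_apply_simps bop_apply_cscale ell2_simps)
qed

lemma norm_diag_op:
  assumes "0 \<le> C" "\<And>x. cmod (f x) \<le> C"
  shows "norm (diag_op f) \<le> C"
proof -
  have "locally_finite_rel 1 (Id :: ('a \<times> 'a) set)"
    by (auto simp: locally_finite_rel_def Image_def)
  moreover have "cmod (matrix_of (diag_op f) x y) \<le> C" for x y
    using assms by (simp add: matrix_of_diag_op[OF ell_inftyI[OF assms(2)]])
  moreover have "supp (diag_op f) \<subseteq> Id"
    by (auto simp: matrix_of_diag_op[OF ell_inftyI[OF assms(2)]] supp_def split: if_splits)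
  ultimately show ?thesis using norm_bop_schur[of 1 Id C "diag_op f"] assms(1) by simp
qed

section \<open>Unitary diagonalisation of self-adjoint block operators\<close>

lemma bop_apply_finite_supp:
  assumes "finite F" "supp T \<subseteq> UNIV \<times> F"
  shows "ell2_apply (bop_apply T u) x = (\<Sum>y\<in>F. matrix_of T x y * ell2_apply u y)"
proof -
  have "ell2_apply (bop_apply T u) x = (\<Sum>\<^sub>\<infinity>y\<in>F. matrix_of T x y * ell2_apply u y)"
    unfolding bop_apply_matrix using assms(2) by (intro infsum_cong_neutral) (auto simp: supp_def)
  then show ?thesis using assms(1) by simp
qed

text \<open>The eigenvector comes from the nonempty spectrum of a complex matrix and is carried to
  the coordinates in \<open>F\<close> by an enumeration \<open>e\<close>.\<close>

lemma eigenvector_finite_supp: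
  fixes T :: "'y bop"
  assumes "finite F" "F \<noteq> {}" "supp T \<subseteq> F \<times> F"
  obtains u c where "norm u = 1" "\<And>x. x \<notin> F \<Longrightarrow> ell2_apply u x = 0" "bop_apply T u = cscale c u"
proof -
  define n where "n = card F"
  have n: "n > 0" using assms(1,2) by (simp add: n_def card_gt_0_iff)
  obtain e where e: "bij_betw e {0..<n} F"
    using ex_bij_betw_nat_finite[OF assms(1)] by (auto simp: n_def)
  define M where "M = mat n n (\<lambda>(i, j). matrix_of T (e i) (e j))"
  have M: "M \<in> carrier_mat n n" by (simp add: M_def)
  obtain c where "c \<in> spectrum M" using spectrum_non_empty[OF M n] by auto
  then obtain v where "eigenvector M v c"
    by (auto simp: spectrum_def eigenvalue_def)
  then have v: "v \<in> carrier_vec n" "v \<noteq> 0\<^sub>v n" "M *\<^sub>v v = c \<cdot>\<^sub>v v"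
    using M by (auto simp: eigenvector_def)
  define e' where "e' = inv_into {0..<n} e"
  have e': "e' x \<in> {0..<n}" "e (e' x) = x" if "x \<in> F" for x
    using that e by (auto simp: e'_def bij_betw_def inv_into_into f_inv_into_f)
  define u where "u = (\<Sum>x\<in>F. cscale (v $ e' x) (ket x))"
  have u: "ell2_apply u x = (if x \<in> F then v $ e' x else 0)" for x
    using assms(1) by (simp add: u_def ell2_apply_sum ell2_simps if_distrib cong: if_cong)
  have ei: "e' (e i) = i" if "i < n" for i
    using that e by (simp add: e'_def bij_betw_def inv_into_f_f)
  have "bop_apply T u = cscale c u"
  proof (rule ell2_eqI)
    fix x
    have eq: "ell2_apply (bop_apply T u) x = (\<Sum>y\<in>F. matrix_of T x y * ell2_apply u y)"
      using assms by (intro bop_apply_finite_supp) auto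
    show "ell2_apply (bop_apply T u) x = ell2_apply (cscale c u) x"
    proof (cases "x \<in> F")
      case True
      have "(\<Sum>y\<in>F. matrix_of T x y * ell2_apply u y) = (\<Sum>j\<in>{0..<n}. matrix_of T x (e j) * ell2_apply u (e j))"
        by (rule sum.reindex_bij_betw[OF e, symmetric])
      also have "\<dots> = (\<Sum>j\<in>{0..<n}. matrix_of T x (e j) * v $ j)"
        using bij_betwE[OF e] by (intro sum.cong) (auto simp: u ei)
      also have "\<dots> = (M *\<^sub>v v) $ e' x"
        using e'[OF True] v(1) by (simp add: M_def scalar_prod_def)
      also have "\<dots> = c * v $ e' x" using v e'[OF True] by simp
      finally show ?thesis using True by (simp add: eq u cscale.rep_eq)
    next
      case False
      then have "matrix_of T x y = 0" for y using assms(3) by (auto simp: supp_def)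
      with False show ?thesis by (simp add: eq u cscale.rep_eq)
    qed
  qed
  moreover have "u \<noteq> 0"
  proof
    assume "u = 0"
    then have "v $ i = 0" if "i < n" for i
      using u[of "e i"] ei[OF that] that bij_betwE[OF e] by (simp add: zero_ell2.rep_eq)
    then show False using v by auto
  qed
  ultimately show thesis
    by (intro that[of "cscale (1 / norm u) u" c])
       (auto simp: norm_cscale u cscale.rep_eq bop_apply_cscale cscale_cscale mult.commute norm_divide)
qed

section \<open>Reflections and diagonalisation on finitely many coordinates\<close>

definition rank_one :: "'y ell2 \<Rightarrow> 'y bop" where
  "rank_one u = bop_of (\<lambda>w. cscale (cinner u w) u)"

lemma rank_one_apply: "bop_apply (rank_one u) w = cscale (cinner u w) u"
  unfolding rank_one_def
proof (rule bop_of)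
  show "norm (cscale (cinner u w) u) \<le> (norm u * norm u) * norm w" for w
    using mult_right_mono[OF cinner_bound[of u w] norm_ge_zero[of u]]
    by (simp add: norm_cscale algebra_simps)
qed (simp_all add: cinner_add_right cscale_add_left cinner_cscale_right cscale_cscale)

lemma star_rank_one: "star (rank_one u) = rank_one u"
  by (rule star_bopI)
     (simp add: rank_one_apply cinner_cscale_left cinner_cscale_right flip: cinner_commute)

lemma rank_one_idem: "norm u = 1 \<Longrightarrow> rank_one u * rank_one u = rank_one u"
  by (rule bop_eqI) (simp add: bop_apply_simps rank_one_apply cinner_cscale_right cinner_self)

lemma supp_rank_one: "(\<And>x. x \<notin> F \<Longrightarrow> ell2_apply u x = 0) \<Longrightarrow> supp (rank_one u) \<subseteq> F \<times> F"
  by (auto simp: supp_def matrix_of_def rank_one_apply cscale.rep_eq)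
     (metis cinner_commute cinner_ket_left complex_cnj_zero mult_eq_0_iff)

text \<open>The reflection in the hyperplane orthogonal to \<open>u - ket a\<close> exchanges the
  two unit vectors because their inner product is real; over the complex numbers this is a genuine
  condition. Since \<open>u - ket a\<close> lives on \<open>G\<close>, the reflection is the
  identity elsewhere.\<close>

lemma householder:
  fixes u :: "'y ell2"
  assumes "norm u = 1" "ell2_apply u a \<in> \<real>" "\<And>x. x \<notin> G \<Longrightarrow> ell2_apply u x = 0" "a \<in> G"
  obtains H where "star H = H" "H * H = 1" "supp (H - 1) \<subseteq> G \<times> G" "bop_apply H (ket a) = u"
proof (cases "u = ket a")
  case True
  then show ?thesis by (intro that[of 1]) (auto simp: bop_apply_simps supp_def matrix_of_simps)
next
  case False
  define w where "w = u - ket a"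
  define w1 where "w1 = cscale (1 / norm w) w"
  define H where "H = 1 - (2::real) *\<^sub>R rank_one w1"
  have w: "w \<noteq> 0" using False by (simp add: w_def)
  have n1: "norm w1 = 1" using w by (simp add: w1_def norm_cscale norm_divide)
  obtain c where c: "ell2_apply u a = complex_of_real c" using assms(2) by (auto elim: Reals_cases)
  have ck: "cinner u (ket a) = of_real c" "cinner (ket a) u = of_real c"
    using cinner_commute[of u "ket a"] by (simp_all add: cinner_ket_left c)
  have wk: "cinner w (ket a) = of_real (c - 1)"
    by (simp add: w_def cinner_diff_left ck cinner_self)
  have "complex_of_real ((norm w)\<^sup>2) = of_real (2 - 2 * c)"
    unfolding cinner_self[symmetric] w_def
    by (simp add: cinner_diff_left cinner_diff_right ck cinner_self[of u] cinner_self[of "ket a"] assms(1))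
  then have nw: "(norm w)\<^sup>2 = 2 - 2 * c" by (simp only: of_real_eq_iff)
  \<comment> \<open>This number is the coefficient with which the reflection subtracts
    \<open>w\<close> from \<open>ket a\<close>; the value -1 makes the image
    \<open>ket a + w\<close>, which is \<open>u\<close>.\<close>
  have "2 * ((1 / norm w) * (c - 1) * (1 / norm w)) = (2 * c - 2) / (norm w)\<^sup>2"
    by (simp add: power2_eq_square)
  also have "\<dots> = -1"
  proof -
    have "2 - 2 * c \<noteq> 0" using w by (simp flip: nw)
    then show ?thesis by (simp add: nw divide_eq_eq)
  qed
  finally have k: "2 * ((1 / norm w) * (c - 1) * (1 / norm w)) = -1" .
  have "cinner w1 (ket a) = of_real ((1 / norm w) * (c - 1))"
    by (simp add: w1_def cinner_cscale_left wk)
  then have "2 *\<^sub>R bop_apply (rank_one w1) (ket a) = cscale (of_real (2 * ((1 / norm w) * (c - 1) * (1 / norm w)))) w"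
    unfolding rank_one_apply by (simp add: w1_def cscale_cscale scaleR_ell2_def)
  also have "\<dots> = - w" unfolding k by (rule ell2_eqI) (simp add: ell2_simps)
  finally have Hk: "bop_apply H (ket a) = u"
    by (simp add: H_def bop_apply_simps w_def)
  have "supp (rank_one w1) \<subseteq> G \<times> G"
    using assms(3,4) by (intro supp_rank_one) (auto simp: w1_def w_def ell2_simps)
  then have "supp (H - 1) \<subseteq> G \<times> G" by (auto simp: H_def supp_def matrix_of_simps)
  moreover have "star H = H" by (simp add: H_def star_diff star_scaleR star_rank_one)
  moreover have "H * H = 1"
    by (simp add: H_def algebra_simps rank_one_idem[OF n1] flip: scaleR_2)
  ultimately show ?thesis using Hk by (intro that[of H])
qed

text \<open>Deflation: a reflection turns an eigenvector into \<open>ket a\<close>, and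
  self-adjointness leaves an operator supported on the smaller set. The unitary differs from 1 only
  inside \<open>F\<close>, which is what lets unitaries of different blocks be glued.\<close>

lemma self_adjoint_finite_diag:
  fixes T :: "'y bop"
  assumes "finite F" "star T = T" "supp T \<subseteq> F \<times> F"
  shows "\<exists>W \<mu>. star W * W = 1 \<and> W * star W = 1 \<and> supp (W - 1) \<subseteq> F \<times> F \<and>
    star W * T * W = diag_op (\<lambda>x. of_real (\<mu> x)) \<and> (\<forall>x. x \<notin> F \<longrightarrow> \<mu> x = 0)"
  using assms
proof (induction F arbitrary: T rule: finite_induct)
  case empty
  then have "T = diag_op 0" unfolding diag_op_zero
    by (intro matrix_of_eqI) (auto simp: supp_def matrix_of_simps)
  moreover have "supp (1 - 1 :: 'y bop) = {}" by (simp add: supp_def matrix_of_simps)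
  ultimately show ?case
    by (intro exI[of _ 1] exI[of _ "\<lambda>_. 0"]) (auto simp: zero_fun_def)
next
  case (insert a F)
  let ?G = "insert a F"
  obtain u' c where u': "norm u' = 1" "\<And>x. x \<notin> ?G \<Longrightarrow> ell2_apply u' x = 0" "bop_apply T u' = cscale c u'"
    using eigenvector_finite_supp[of ?G T] insert by (metis finite.insertI insert_not_empty)
  define z where "z = ell2_apply u' a"
  \<comment> \<open>The phase that makes the coordinate at \<open>a\<close> real, as
    \<open>householder\<close> requires; for \<open>z = 0\<close> any number of modulus 1 would
    do.\<close>
  define b where "b = (if z = 0 then 1 else cnj z / cmod z)"
  have b: "cmod b = 1" by (simp add: b_def norm_divide)
  define u where "u = cscale b u'"
  have u: "norm u = 1" "\<And>x. x \<notin> ?G \<Longrightarrow> ell2_apply u x = 0" "bop_apply T u = cscale c u"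
    using u' b by (auto simp: u_def norm_cscale cscale.rep_eq bop_apply_cscale cscale_cscale mult.commute)
  have "b * z = of_real (cmod z)"
    by (simp add: b_def divide_eq_eq power2_eq_square mult.commute flip: complex_norm_square)
  then have "ell2_apply u a \<in> \<real>" by (simp add: u_def cscale.rep_eq flip: z_def)
  from householder[OF u(1) this u(2)] obtain H where
    H: "star H = H" "H * H = 1" "supp (H - 1) \<subseteq> ?G \<times> ?G" "bop_apply H (ket a) = u" by blast
  have "c = cinner u (bop_apply T u)" by (simp add: u cinner_cscale_right cinner_self)
  moreover have "cinner u (bop_apply T u) = cnj (cinner u (bop_apply T u))"
    using cinner_commute[of u "bop_apply T u"] cinner_star_left[of T u u] insert.prems(1) by simp
  ultimately have "c \<in> \<real>" by (metis Reals_cnj_iff)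
  then obtain l where l: "c = of_real l" by (auto elim: Reals_cases)
  define T' where "T' = H * T * H"
  have Ta: "bop_apply T' (ket a) = cscale c (ket a)"
  proof -
    have "bop_apply H u = ket a" using H(2,4) bop_apply_simps(4)[of H H "ket a"] by (simp add: bop_apply_simps)
    then show ?thesis by (simp add: T'_def bop_apply_simps H(4) u(3) bop_apply_cscale)
  qed
  have T's: "star T' = T'" by (simp add: T'_def star_mult H insert.prems mult.assoc)
  define i where "i = (\<lambda>x. if x = a then 1 else 0 :: complex)"
  have i: "i \<in> ell_infty" by (rule ell_inftyI[of _ 1]) (auto simp: i_def)
  define p where "p = diag_op i"
  have pm: "matrix_of p x y = (if x = a \<and> y = a then 1 else 0)" for x y
    unfolding p_def matrix_of_diag_op[OF i] by (simp add: i_def)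
  have ps: "star p = p" unfolding p_def diag_op_star[OF i, symmetric]
    by (rule arg_cong[where f = diag_op]) (auto simp: i_def star_fun_def star_complex_def)
  have mult_G: "supp (R * S) \<subseteq> A \<times> A" if "supp R \<subseteq> A \<times> A" "supp S \<subseteq> A \<times> A" for R S :: "'y bop" and A
    using that supp_mult[of R S] by auto
  have add_G: "supp (R + S) \<subseteq> A \<times> A" if "supp R \<subseteq> A \<times> A" "supp S \<subseteq> A \<times> A" for R S :: "'y bop" and A
    using that supp_add[of R S] by blast
  have T'd: "T' = T + (H - 1) * T + T * (H - 1) + (H - 1) * T * (H - 1)"
    by (simp add: T'_def algebra_simps)
  have T'G: "supp T' \<subseteq> ?G \<times> ?G" unfolding T'd by (intro add_G mult_G H insert.prems)
  \<comment> \<open>Removing the eigenvalue at \<open>a\<close> empties column \<open>a\<close>,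
    hence by self-adjointness also row \<open>a\<close>.\<close>
  define T2 where "T2 = T' - l *\<^sub>R p"
  have T2s: "star T2 = T2" by (simp add: T2_def star_diff star_scaleR T's ps)
  have "matrix_of T' x a = (if x = a then c else 0)" for x
    by (simp add: matrix_of_def Ta ell2_simps)
  then have col: "matrix_of T2 x a = 0" for x
    by (simp add: T2_def matrix_of_simps pm l)
  then have row: "matrix_of T2 a x = 0" for x
    using matrix_of_star[of T2 a x] by (simp add: T2s)
  have T2F: "supp T2 \<subseteq> F \<times> F"
  proof clarify
    fix x y assume xy: "(x, y) \<in> supp T2"
    then have "x \<noteq> a" "y \<noteq> a" using col row by (auto simp: supp_def)
    then have "(x, y) \<in> supp T'" using xy by (simp add: supp_def T2_def matrix_of_simps pm)
    then show "x \<in> F \<and> y \<in> F" using T'G \<open>x \<noteq> a\<close> \<open>y \<noteq> a\<close> by auto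
  qed
  from insert.IH[OF T2s T2F] obtain W \<mu> where W: "star W * W = 1" "W * star W = 1" "supp (W - 1) \<subseteq> F \<times> F"
    "star W * T2 * W = diag_op (\<lambda>x. of_real (\<mu> x))" "\<And>x. x \<notin> F \<Longrightarrow> \<mu> x = 0" by blast
  have \<mu>: "(\<lambda>x. complex_of_real (\<mu> x)) \<in> ell_infty"
  proof (rule ell_inftyI)
    show "cmod (complex_of_real (\<mu> x)) \<le> (\<Sum>x\<in>F. \<bar>\<mu> x\<bar>)" for x
      using member_le_sum[of x F "\<lambda>x. \<bar>\<mu> x\<bar>"] W(5)[of x] insert.hyps(1)
      by (cases "x \<in> F") (auto simp: sum_nonneg)
  qed
  \<comment> \<open>\<open>W\<close> acts trivially on the coordinate \<open>a\<close>, which is not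
    in \<open>F\<close>, so it leaves the eigenvalue already found in place.\<close>
  have "(W - 1) * p = 0"
  proof (rule matrix_of_eqI)
    fix x y
    have "supp (W - 1) O supp p = {}" using W(3) insert.hyps(2) by (auto simp: supp_def pm)
    then show "matrix_of ((W - 1) * p) x y = matrix_of 0 x y"
      using supp_mult[of "W - 1" p] by (auto simp: supp_def matrix_of_simps)
  qed
  then have Wp: "W * p = p" by (simp add: left_diff_distrib)
  then have "star W * p = p" using W(1) by (metis mult.assoc mult_1)
  then have pW: "p * W = p" using star_mult[of "star W" p] ps by simp
  have "star W * T' * W = star W * T2 * W + l *\<^sub>R (star W * p * W)"
    by (simp add: T2_def algebra_simps)
  also have "star W * p * W = p" by (simp add: \<open>star W * p = p\<close> pW)
  also have "l *\<^sub>R p = diag_op (\<lambda>x. if x = a then complex_of_real l else 0)"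
    by (rule matrix_of_eqI)
       (auto simp: matrix_of_simps pm matrix_of_diag_op[OF ell_inftyI[where C = "\<bar>l\<bar>"]])
  also have "star W * T2 * W + \<dots> = diag_op (\<lambda>x. complex_of_real ((\<mu>(a := l)) x))"
    unfolding W(4)
    by (subst diag_op_add[OF \<mu>, symmetric])
       (auto intro!: ell_inftyI[where C = "\<bar>l\<bar>"] arg_cong[where f = diag_op] simp: fun_eq_iff W(5)[OF insert.hyps(2)])
  finally have "star (H * W) * T * (H * W) = diag_op (\<lambda>x. complex_of_real ((\<mu>(a := l)) x))"
    by (simp add: star_mult H T'_def mult.assoc)
  moreover have "star (H * W) * (H * W) = star W * (H * H) * W" "(H * W) * star (H * W) = H * (W * star W) * H"
    by (simp_all add: star_mult H(1) mult.assoc)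
  moreover have "supp (H * W - 1) \<subseteq> ?G \<times> ?G"
  proof -
    have "H * W - 1 = (H - 1) + (W - 1) + (H - 1) * (W - 1)" by (simp add: algebra_simps)
    moreover have "supp (W - 1) \<subseteq> ?G \<times> ?G" using W(3) by blast
    ultimately show ?thesis by (simp only:) (intro add_G mult_G H)
  qed
  ultimately show ?case
    by (intro exI[of _ "H * W"] exI[of _ "\<mu>(a := l)"]) (auto simp: W H)
qed

text \<open>Both operators split along \<open>B\<close> and its complement and have the same corner
  at \<open>B\<close>. The relation passes to products and adjoints, so identities between
  diagonalised blocks transfer to the operator glued from them.\<close>

definition agree_on :: "'y set \<Rightarrow> 'y bop \<Rightarrow> 'y bop \<Rightarrow> bool" where
  "agree_on B S T \<longleftrightarrow> (\<forall>x y. x \<in> B \<or> y \<in> B \<longrightarrow>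
     matrix_of S x y = matrix_of T x y \<and> (matrix_of S x y \<noteq> 0 \<longrightarrow> x \<in> B \<and> y \<in> B))"

lemma agree_on_star: "agree_on B S T \<Longrightarrow> agree_on B (star S) (star T)"
  unfolding agree_on_def matrix_of_star complex_cnj_cancel_iff complex_cnj_zero_iff by blast

lemma agree_onD:
  assumes "agree_on B S T" "x \<in> B \<or> y \<in> B"
  shows "matrix_of S x y = matrix_of T x y" "matrix_of S x y \<noteq> 0 \<Longrightarrow> x \<in> B \<and> y \<in> B"
  using assms unfolding agree_on_def by blast+

lemma agree_on_mult:
  assumes ST: "agree_on B S T" and ST': "agree_on B S' T'"
  shows "agree_on B (S * S') (T * T')"
  unfolding agree_on_def
proof (intro allI impI conjI)
  fix x y assume xy: "x \<in> B \<or> y \<in> B"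
  have "matrix_of S x z * matrix_of S' z y = matrix_of T x z * matrix_of T' z y" for z
  proof (cases "z \<in> B")
    case True
    then show ?thesis using agree_onD(1)[OF ST, of x z] agree_onD(1)[OF ST', of z y] by metis
  next
    case False
    then show ?thesis
      using xy agree_onD[OF ST, of x z] agree_onD[OF ST', of z y] by (metis mult_eq_0_iff)
  qed
  then show "matrix_of (S * S') x y = matrix_of (T * T') x y"
    unfolding matrix_of_mult by (intro infsum_cong)
  assume "matrix_of (S * S') x y \<noteq> 0"
  then obtain z where z: "matrix_of S x z \<noteq> 0" "matrix_of S' z y \<noteq> 0"
    by (rule matrix_of_mult_nonzero)
  then show "x \<in> B" "y \<in> B"
    using xy agree_onD(2)[OF ST, of x z] agree_onD(2)[OF ST', of z y] by blast+
qed

text \<open>Every block is diagonalised on its own and the unitaries are put side by side. The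
  entries of a unitary have modulus at most 1 and the blocks at most \<open>N\<close> points, so the
  glued matrix is a bounded operator.\<close>

lemma self_adjoint_block_diag:
  fixes T :: "'y bop"
  assumes E: "equiv UNIV E" "locally_finite_rel N E" and T: "star T = T" "supp T \<subseteq> E"
  obtains W \<mu> where "star W * W = 1" "W * star W = 1" "supp W \<subseteq> E"
    "T = W * diag_op (\<lambda>x. of_real (\<mu> x)) * star W" "\<And>x. \<bar>\<mu> x\<bar> \<le> norm T"
proof -
  define blk where "blk x = E `` {x}" for x
  have fin: "finite (blk x)" for x using E(2) by (auto simp: locally_finite_rel_def blk_def)
  have self: "x \<in> blk x" for x using E(1) by (auto simp: blk_def equiv_def refl_on_def)
  have blk_eq: "blk x = blk y" if "(x, y) \<in> E" for x y
    unfolding blk_def using equiv_class_eq[OF E(1) that] .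
  have in_blk: "(x, y) \<in> E \<longleftrightarrow> y \<in> blk x" for x y by (auto simp: blk_def)
  have blkI: "blk x = blk a" if "x \<in> blk a" for x a
    by (rule blk_eq[symmetric]) (use that in \<open>simp add: in_blk\<close>)
  have same: "x \<in> blk a \<and> y \<in> blk a \<and> blk x = blk a" if "(x, y) \<in> E" "x \<in> blk a \<or> y \<in> blk a" for a x y
  proof -
    have "blk x = blk y" by (rule blk_eq[OF that(1)])
    moreover have "blk x = blk a \<or> blk y = blk a" using that(2) blkI by blast
    ultimately have "blk x = blk a" "blk y = blk a" by metis+
    then show ?thesis using self[of x] self[of y] by simp
  qed
  have same': "(x, y) \<in> E" if "x \<in> blk a" "y \<in> blk a" for a x y
    using blkI[OF that(1)] that(2) by (simp add: in_blk)
  define ind where "ind B = (\<lambda>x. if x \<in> B then 1 else 0 :: complex)" for B :: "'y set"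
  have ind: "ind B \<in> ell_infty" for B by (rule ell_inftyI[of _ 1]) (auto simp: ind_def)
  define TB where "TB B = diag_op (ind B) * T * diag_op (ind B)" for B
  have TBm: "matrix_of (TB B) x y = (if x \<in> B \<and> y \<in> B then matrix_of T x y else 0)" for B x y
    by (simp add: TB_def matrix_of_diag_mult[OF ind] matrix_of_mult_diag[OF ind]) (simp add: ind_def)
  have "star (TB B) = TB B" for B
    by (rule matrix_of_eqI) (use T(1) in \<open>auto simp: matrix_of_star TBm simp flip: matrix_of_star[of T]\<close>)
  moreover have "supp (TB B) \<subseteq> B \<times> B" for B by (auto simp: supp_def TBm split: if_splits)
  ultimately have ex: "\<exists>W \<mu>. star W * W = 1 \<and> W * star W = 1 \<and> supp (W - 1) \<subseteq> B \<times> B \<and>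
    star W * TB B * W = diag_op (\<lambda>x. of_real (\<mu> x)) \<and> (\<forall>x. x \<notin> B \<longrightarrow> \<mu> x = 0)" if "finite B" for B
    using self_adjoint_finite_diag[OF that] by blast
  \<comment> \<open>The choice is made for blocks as sets and not for points, so equivalent points
    receive the same unitary.\<close>
  define Q where "Q B p \<longleftrightarrow> star (fst p) * fst p = 1 \<and> fst p * star (fst p) = 1 \<and> supp (fst p - 1) \<subseteq> B \<times> B \<and>
    star (fst p) * TB B * fst p = diag_op (\<lambda>x. of_real (snd p x)) \<and> (\<forall>x. x \<notin> B \<longrightarrow> snd p x = 0)" for B p
  have "\<forall>B. \<exists>p. finite B \<longrightarrow> Q B p"
  proof
    fix B
    show "\<exists>p. finite B \<longrightarrow> Q B p"
    proof (cases "finite B")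
      case True
      from ex[OF this] obtain W \<mu> where "Q B (W, \<mu>)" unfolding Q_def fst_conv snd_conv by blast
      then show ?thesis by blast
    qed simp
  qed
  from choice[OF this] obtain f where f: "\<And>B. finite B \<Longrightarrow> Q B (f B)" by blast
  define WB \<mu>B where "WB B = fst (f B)" and "\<mu>B B = snd (f B)" for B
  have WB: "star (WB B) * WB B = 1" "WB B * star (WB B) = 1" "supp (WB B - 1) \<subseteq> B \<times> B"
    "star (WB B) * TB B * WB B = diag_op (\<lambda>x. of_real (\<mu>B B x))" "\<And>x. x \<notin> B \<Longrightarrow> \<mu>B B x = 0"
    if "finite B" for B
    using f[OF that] unfolding Q_def WB_def \<mu>B_def by blast+
  define m where "m x y = (if (x, y) \<in> E then matrix_of (WB (blk x)) x y else 0)" for x y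
  have "cmod (m x y) \<le> 1" for x y
    using order_trans[OF matrix_of_bound norm_isometry[OF WB(1)[OF fin]]] by (simp add: m_def)
  moreover have "m x y \<noteq> 0 \<Longrightarrow> (x, y) \<in> E" for x y by (auto simp: m_def split: if_splits)
  ultimately obtain W where W: "matrix_of W = m"
    using bop_of_matrix[OF E(2), of 1 m] by (metis zero_le_one)
  have WBm: "matrix_of (WB B) x y = (if x = y then 1 else 0)" if "finite B" "\<not> (x \<in> B \<and> y \<in> B)" for B x y
  proof -
    have "matrix_of (WB B - 1) x y = 0" using WB(3)[OF that(1)] that(2) by (auto simp: supp_def)
    then show ?thesis by (simp add: matrix_of_simps split: if_splits)
  qed
  have agW: "agree_on (blk a) W (WB (blk a))" for a
    unfolding agree_on_def
  proof (intro allI impI)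
    fix x y assume xy: "x \<in> blk a \<or> y \<in> blk a"
    show "matrix_of W x y = matrix_of (WB (blk a)) x y \<and> (matrix_of W x y \<noteq> 0 \<longrightarrow> x \<in> blk a \<and> y \<in> blk a)"
    proof (cases "(x, y) \<in> E")
      case True
      then show ?thesis using same[OF True xy] by (simp add: W m_def)
    next
      case False
      then have "\<not> (x \<in> blk a \<and> y \<in> blk a)"
        using same' by blast
      moreover have "x \<noteq> y" using False self by (auto simp: in_blk)
      ultimately show ?thesis using False WBm[OF fin] by (simp add: W m_def)
    qed
  qed
  have agT: "agree_on (blk a) T (TB (blk a))" for a
    unfolding agree_on_def
  proof (intro allI impI)
    fix x y assume xy: "x \<in> blk a \<or> y \<in> blk a"
    have "x \<in> blk a \<and> y \<in> blk a" if "matrix_of T x y \<noteq> 0"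
    proof -
      have "(x, y) \<in> E" using that T(2) by (auto simp: supp_def)
      then show ?thesis using same xy by blast
    qed
    then show "matrix_of T x y = matrix_of (TB (blk a)) x y \<and> (matrix_of T x y \<noteq> 0 \<longrightarrow> x \<in> blk a \<and> y \<in> blk a)"
      by (auto simp: TBm)
  qed
  have WW: "star W * W = 1"
  proof (rule matrix_of_eqI)
    fix x y
    show "matrix_of (star W * W) x y = matrix_of 1 x y"
      using agree_onD(1)[OF agree_on_mult[OF agree_on_star[OF agW[of x]] agW[of x]], of x y] self[of x]
      by (simp add: WB(1)[OF fin])
  qed
  have WW': "W * star W = 1"
  proof (rule matrix_of_eqI)
    fix x y
    show "matrix_of (W * star W) x y = matrix_of 1 x y"
      using agree_onD(1)[OF agree_on_mult[OF agW[of x] agree_on_star[OF agW[of x]]], of x y] self[of x]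
      by (simp add: WB(2)[OF fin])
  qed
  define \<mu> where "\<mu> x = \<mu>B (blk x) x" for x
  have bd: "(\<lambda>x. complex_of_real (\<mu>B B x)) \<in> ell_infty" if "finite B" for B
  proof (rule ell_inftyI)
    show "cmod (complex_of_real (\<mu>B B x)) \<le> (\<Sum>x\<in>B. \<bar>\<mu>B B x\<bar>)" for x
      using member_le_sum[of x B "\<lambda>x. \<bar>\<mu>B B x\<bar>"] WB(5)[OF that] that
      by (cases "x \<in> B") (auto simp: sum_nonneg)
  qed
  have mm: "matrix_of (star W * T * W) x y = (if x = y then of_real (\<mu> x) else 0)" for x y
    using agree_onD(1)[OF agree_on_mult[OF agree_on_mult[OF agree_on_star[OF agW[of x]] agT[of x]] agW[of x]], of x y]
      self[of x]
    by (simp add: WB(4)[OF fin] matrix_of_diag_op[OF bd[OF fin]] \<mu>_def)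
  have nW: "norm W \<le> 1" by (rule norm_isometry[OF WW])
  have mub: "\<bar>\<mu> x\<bar> \<le> norm T" for x
  proof -
    have "\<bar>\<mu> x\<bar> = cmod (matrix_of (star W * T * W) x x)" by (simp add: mm)
    also have "\<dots> \<le> norm (star W * T * W)" by (rule matrix_of_bound)
    also have "\<dots> \<le> norm (star W) * norm T * norm W"
      by (intro order_trans[OF norm_mult_ineq] mult_right_mono norm_mult_ineq) simp
    also have "\<dots> \<le> 1 * norm T * 1" using nW by (intro mult_mono) auto
    finally show ?thesis by simp
  qed
  have eq: "star W * T * W = diag_op (\<lambda>x. of_real (\<mu> x))"
    by (rule matrix_of_eqI) (use mub in \<open>simp add: mm matrix_of_diag_op[OF ell_inftyI[where C = "norm T"]]\<close>)
  have "W * diag_op (\<lambda>x. of_real (\<mu> x)) * star W = (W * star W) * T * (W * star W)"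
    unfolding eq[symmetric] by (simp only: mult.assoc)
  then show thesis using WW WW' mub
    by (intro that[of W \<mu>]) (auto simp: supp_def W m_def split: if_splits)
qed

section \<open>Cutting a space of asymptotic dimension one\<close>

text \<open>Transitivity is the only issue: a point near two pieces would link them, so the
  thickened pieces have to be disjoint.\<close>

lemma equiv_near_pieces:
  assumes "\<And>x A B. A \<in> \<A> \<Longrightarrow> B \<in> \<A> \<Longrightarrow> near A x \<Longrightarrow> near B x \<Longrightarrow> A = B"
  shows "equiv UNIV {(x, y). x = y \<or> (\<exists>A\<in>\<A>. near A x \<and> near A y)}"
proof (rule equivI)
  have "x = z \<or> (\<exists>A\<in>\<A>. near A x \<and> near A z)"
    if "x = y \<or> (\<exists>A\<in>\<A>. near A x \<and> near A y)" "y = z \<or> (\<exists>A\<in>\<A>. near A y \<and> near A z)" for x y z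
    using that assms[of _ _ y] by metis
  then show "trans {(x, y). x = y \<or> (\<exists>A\<in>\<A>. near A x \<and> near A y)}"
    unfolding trans_def mem_Collect_eq case_prod_conv by presburger
qed (auto simp: refl_on_def sym_def)

lemma dist_near_piece:
  assumes "bounded A" "diameter A \<le> D" "a \<in> A" "b \<in> A" "dist x a \<le> c" "dist y b \<le> c"
  shows "dist x y \<le> D + 2 * c"
proof -
  have "dist a b \<le> D" using diameter_bounded_bound[OF assms(1,3,4)] assms(2) by simp
  moreover have "dist x y \<le> dist x a + dist a b + dist y b"
    using dist_triangle[of x y a] dist_triangle[of a y b] by (simp add: dist_commute)
  ultimately show ?thesis using assms(5,6) by simp
qed

text \<open>The level \<open>h = 1/2\<close> separates thickened pieces of \<open>U\<close> from pieces of \<open>V\<close>: the classes of \<open>EU\<close> and \<open>EV\<close>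
  are these thickened pieces, and both relations control the zone where \<open>h\<close> is not locally constant.\<close>

lemma asdim_le_one_cut:
  fixes R L :: real
  assumes "asdim_le_one TYPE('x::metric_space)" "R > 0" "L > 0"
  obtains h :: "'x::metric_space \<Rightarrow> real" and EU EV D where
    "equiv UNIV EU" "equiv UNIV EV"
    "\<And>x y. (x, y) \<in> EU \<Longrightarrow> dist x y \<le> D" "\<And>x y. (x, y) \<in> EV \<Longrightarrow> dist x y \<le> D"
    "\<And>x. 0 \<le> h x" "\<And>x. h x \<le> 1" "\<And>x y. \<bar>h x - h y\<bar> \<le> L * dist x y"
    "\<And>x y. h x < 1/2 \<Longrightarrow> h y < 1/2 \<Longrightarrow> dist x y \<le> R \<Longrightarrow> (x, y) \<in> EU"
    "\<And>x y. h x > 1/2 \<Longrightarrow> h y > 1/2 \<Longrightarrow> dist x y \<le> R \<Longrightarrow> (x, y) \<in> EV"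
    "\<And>x y w. 0 < h w \<Longrightarrow> h w < 1 \<Longrightarrow> dist x w \<le> R \<Longrightarrow> dist y w \<le> R \<Longrightarrow> (x, y) \<in> EU \<inter> EV"
proof -
  define l where "l = 1 / L"
  have l: "l > 0" using assms by (simp add: l_def)
  \<comment> \<open>Pieces of \<open>U\<close> get thickened by less than \<open>l + R\<close> and
    pieces of \<open>V\<close> by at most \<open>R\<close>; separation by more than
    \<open>2 * (l + R)\<close> keeps the thickenings disjoint.\<close>
  define r where "r = 2 * l + 4 * R"
  have "r > 0" using l assms by (simp add: r_def)
  then obtain U0 V0 :: "'x set" and \<A>0 \<B>0 where 0: "U0 \<union> V0 = UNIV" "U0 \<inter> V0 = {}"
    "partition_on U0 \<A>0" "r_separated r \<A>0" "uniformly_bounded \<A>0"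
    "partition_on V0 \<B>0" "r_separated r \<B>0" "uniformly_bounded \<B>0"
    using assms(1)[unfolded asdim_le_one_def, rule_format, OF \<open>r > 0\<close>]
    by (elim exE conjE) (rule that, assumption+)
  \<comment> \<open>The distance to the empty set is 0 by convention, so an empty \<open>U\<close>
    would make \<open>h\<close> vanish identically; in that case the two families swap
    roles.\<close>
  obtain U V :: "'x set" and \<A> \<B> where ne: "U \<noteq> {}" and UV: "U \<union> V = UNIV" and
    A: "partition_on U \<A>" "r_separated r \<A>" "uniformly_bounded \<A>" and
    B: "partition_on V \<B>" "r_separated r \<B>" "uniformly_bounded \<B>"
  proof (cases "U0 = {}")
    case True
    with 0 show ?thesis by (intro that[of V0 U0 \<B>0 \<A>0]) auto
  next
    case False
    with 0 show ?thesis by (intro that[of U0 V0 \<A>0 \<B>0]) auto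
  qed
  have UA: "\<exists>A\<in>\<A>. x \<in> A" if "x \<in> U" for x using A(1) that by (auto simp: partition_on_def)
  have VB: "\<exists>B\<in>\<B>. x \<in> B" if "x \<in> V" for x using B(1) that by (auto simp: partition_on_def)
  define nA where "nA A x \<longleftrightarrow> (\<exists>a\<in>A. dist x a < l + R)" for A and x :: 'x
  define nB where "nB A x \<longleftrightarrow> (\<exists>a\<in>A. dist x a \<le> R)" for A and x :: 'x
  have uA: "A = B" if AB: "A \<in> \<A>" "B \<in> \<A>" "nA A x" "nA B x" for A B x
  proof (rule ccontr)
    assume "A \<noteq> B"
    then have "setdist A B > r" using A(2) that by (auto simp: r_separated_def)
    moreover obtain a b where "a \<in> A" "b \<in> B" "dist x a < l + R" "dist x b < l + R"
      using AB(3,4) by (auto simp: nA_def)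
    moreover have "setdist A B \<le> dist a b" using \<open>a \<in> A\<close> \<open>b \<in> B\<close> by (rule setdist_le_dist)
    moreover have "dist a b \<le> dist x a + dist x b" by (rule dist_triangle3)
    ultimately show False using assms(2) by (simp add: r_def)
  qed
  have uB: "A = B" if AB: "A \<in> \<B>" "B \<in> \<B>" "nB A x" "nB B x" for A B x
  proof (rule ccontr)
    assume "A \<noteq> B"
    then have "setdist A B > r" using B(2) that by (auto simp: r_separated_def)
    moreover obtain a b where "a \<in> A" "b \<in> B" "dist x a \<le> R" "dist x b \<le> R"
      using AB(3,4) by (auto simp: nB_def)
    moreover have "setdist A B \<le> dist a b" using \<open>a \<in> A\<close> \<open>b \<in> B\<close> by (rule setdist_le_dist)
    moreover have "dist a b \<le> dist x a + dist x b" by (rule dist_triangle3)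
    ultimately show False using assms(2) l by (simp add: r_def)
  qed
  obtain DA where DA: "\<And>A. A \<in> \<A> \<Longrightarrow> bounded A \<and> diameter A \<le> DA"
    using A(3) by (auto simp: uniformly_bounded_def)
  obtain DB where DB: "\<And>A. A \<in> \<B> \<Longrightarrow> bounded A \<and> diameter A \<le> DB"
    using B(3) by (auto simp: uniformly_bounded_def)
  define D where "D = max 0 (max DA DB) + 2 * (l + R)"
  define EU where "EU = {(x, y). x = y \<or> (\<exists>A\<in>\<A>. nA A x \<and> nA A y)}"
  define EV where "EV = {(x, y). x = y \<or> (\<exists>A\<in>\<B>. nB A x \<and> nB A y)}"
  \<comment> \<open>\<open>h\<close> is 0 on \<open>U\<close> and reaches 1 at distance
    \<open>l = 1 / L\<close>. So \<open>h x < 1\<close> puts \<open>x\<close> within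
    \<open>l\<close> of a piece of \<open>U\<close>, and \<open>h x > 0\<close> puts it in
    \<open>V\<close>.\<close>
  define h where "h x = min 1 (L * infdist x U)" for x
  have nearU: "\<exists>A\<in>\<A>. \<exists>a\<in>A. dist x a < l" if "h x < 1" for x
  proof -
    have "infdist x U < l" using that assms(3) by (auto simp: h_def l_def field_simps)
    then have "\<not> (\<forall>a\<in>U. l \<le> dist x a)"
      using ne by (metis infdist_notempty cINF_greatest not_le)
    then obtain a where "a \<in> U" "dist x a < l" by force
    then show ?thesis using UA by blast
  qed
  have inV: "x \<in> V" if "h x > 0" for x
  proof (rule ccontr)
    assume "x \<notin> V"
    then have "x \<in> U" using UV by blast
    then have "h x = 0" using infdist_zero[of x U] by (simp add: h_def)
    with that show False by simp
  qed
  show thesis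
  proof
    show "equiv UNIV EU" unfolding EU_def by (rule equiv_near_pieces) (rule uA)
    show "equiv UNIV EV" unfolding EV_def by (rule equiv_near_pieces) (rule uB)
    show "dist x y \<le> D" if xy: "(x, y) \<in> EU" for x y
    proof (cases "x = y")
      case False
      then obtain A a b where "A \<in> \<A>" "a \<in> A" "b \<in> A" "dist x a < l + R" "dist y b < l + R"
        using xy by (auto simp: EU_def nA_def)
      then have "dist x y \<le> DA + 2 * (l + R)" using DA by (intro dist_near_piece[of A DA a b]) auto
      then show ?thesis by (simp add: D_def)
    qed (use l assms(2) in \<open>simp add: D_def\<close>)
    show "dist x y \<le> D" if xy: "(x, y) \<in> EV" for x y
    proof (cases "x = y")
      case False
      then obtain A a b where "A \<in> \<B>" "a \<in> A" "b \<in> A" "dist x a \<le> R" "dist y b \<le> R"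
        using xy by (auto simp: EV_def nB_def)
      then have "dist x y \<le> DB + 2 * R" using DB by (intro dist_near_piece[of A DB a b]) auto
      then show ?thesis using l by (simp add: D_def)
    qed (use l assms(2) in \<open>simp add: D_def\<close>)
    show "0 \<le> h x" "h x \<le> 1" for x using assms(3) by (auto simp: h_def infdist_nonneg)
    show "\<bar>h x - h y\<bar> \<le> L * dist x y" for x y
    proof -
      have "\<bar>h x - h y\<bar> \<le> \<bar>L * infdist x U - L * infdist y U\<bar>" by (auto simp: h_def)
      also have "\<dots> = L * \<bar>infdist x U - infdist y U\<bar>"
        using assms(3) by (simp add: abs_mult flip: right_diff_distrib)
      also have "\<bar>infdist x U - infdist y U\<bar> \<le> dist x y" by (rule infdist_triangle_abs)
      finally show ?thesis using assms(3) by simp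
    qed
    show "(x, y) \<in> EU" if "h x < 1/2" "h y < 1/2" "dist x y \<le> R" for x y
    proof -
      have "h x < 1" using that by simp
      then obtain A a where "A \<in> \<A>" "a \<in> A" "dist x a < l" using nearU[of x] by blast
      moreover have "dist y a < l + R"
        using \<open>dist x a < l\<close> that(3) dist_triangle[of y a x] by (simp add: dist_commute)
      ultimately show ?thesis using assms(2) unfolding EU_def nA_def
        by (intro CollectI case_prodI disjI2 bexI[of _ A] conjI bexI[of _ a]) auto
    qed
    show "(x, y) \<in> EV" if "h x > 1/2" "h y > 1/2" "dist x y \<le> R" for x y
    proof -
      have "x \<in> V" using inV[of x] that by simp
      then obtain B where "B \<in> \<B>" "x \<in> B" using VB by blast
      then show ?thesis using that(3) assms(2) unfolding EV_def nB_def
        by (intro CollectI case_prodI disjI2 bexI[of _ B] conjI bexI[of _ x]) (auto simp: dist_commute)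
    qed
    show "(x, y) \<in> EU \<inter> EV" if w: "0 < h w" "h w < 1" "dist x w \<le> R" "dist y w \<le> R" for x y w
    proof
      obtain A a where "A \<in> \<A>" "a \<in> A" "dist w a < l" using nearU[OF w(2)] by blast
      moreover have "dist x a < l + R" "dist y a < l + R"
        using \<open>dist w a < l\<close> that dist_triangle[of x a w] dist_triangle[of y a w] by auto
      ultimately show "(x, y) \<in> EU" unfolding EU_def nA_def
        by (intro CollectI case_prodI disjI2 bexI[of _ A] conjI bexI[of _ a]) auto
      obtain B where "B \<in> \<B>" "w \<in> B" using VB inV[OF w(1)] by blast
      then show "(x, y) \<in> EV" using that unfolding EV_def nB_def
        by (intro CollectI case_prodI disjI2 bexI[of _ B] conjI bexI[of _ w]) auto
    qed
  qed
qed

section \<open>Bounded sequences of operators modulo null sequences\<close>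

text \<open>Estimates that hold up to a vanishing error become identities in this quotient.\<close>

definition germ_rel :: "(nat \<Rightarrow> 'y bop) \<Rightarrow> (nat \<Rightarrow> 'y bop) \<Rightarrow> bool" where
  "germ_rel X Y \<longleftrightarrow> Bseq X \<and> Bseq Y \<and> (\<lambda>k. X k - Y k) \<longlonglongrightarrow> 0"

lemma Bseq_plus: "Bseq X \<Longrightarrow> Bseq Y \<Longrightarrow> Bseq (\<lambda>k. X k + Y k :: 'a::real_normed_vector)"
proof -
  assume "Bseq X" "Bseq Y"
  then obtain B C where "\<And>k. norm (X k) \<le> B" "\<And>k. norm (Y k) \<le> C"
    unfolding Bseq_def by auto
  then show ?thesis by (intro BseqI'[where K = "B + C"] norm_triangle_mono)
qed

lemma Bseq_diff: "Bseq X \<Longrightarrow> Bseq Y \<Longrightarrow> Bseq (\<lambda>k. X k - Y k :: 'a::real_normed_vector)"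
  using Bseq_plus[of X "\<lambda>k. - Y k"] by (simp add: Bseq_minus_iff)

lemma germ_rel_refl: "Bseq X \<Longrightarrow> germ_rel X X"
  by (simp add: germ_rel_def)

\<comment> \<open>The relation is partial because only bounded sequences qualify: a null sequence
  times an unbounded one need not be null, so the product would not descend to the quotient.\<close>
quotient_type 'y germ = "nat \<Rightarrow> 'y bop" / partial: germ_rel
proof (rule part_equivpI)
  show "\<exists>X :: nat \<Rightarrow> 'y bop. germ_rel X X"
    by (rule exI[of _ "\<lambda>_. 0"]) (simp add: germ_rel_def)
  show "symp (germ_rel :: (nat \<Rightarrow> 'y bop) \<Rightarrow> _)"
  proof (rule sympI)
    fix X Y :: "nat \<Rightarrow> 'y bop" assume *: "germ_rel X Y"
    then have "(\<lambda>k. - (X k - Y k)) \<longlonglongrightarrow> - 0" unfolding germ_rel_def by (intro tendsto_minus) auto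
    with * show "germ_rel Y X" by (simp add: germ_rel_def)
  qed
  show "transp (germ_rel :: (nat \<Rightarrow> 'y bop) \<Rightarrow> _)"
  proof (rule transpI)
    fix X Y Z :: "nat \<Rightarrow> 'y bop" assume *: "germ_rel X Y" "germ_rel Y Z"
    then have "(\<lambda>k. (X k - Y k) + (Y k - Z k)) \<longlonglongrightarrow> 0 + 0"
      unfolding germ_rel_def by (intro tendsto_add) auto
    with * show "germ_rel X Z" by (simp add: germ_rel_def)
  qed
qed

lemma germ_rel_add:
  assumes "germ_rel X X'" "germ_rel Y Y'"
  shows "germ_rel (\<lambda>k. X k + Y k) (\<lambda>k. X' k + Y' k)"
proof -
  have "(\<lambda>k. (X k - X' k) + (Y k - Y' k)) \<longlonglongrightarrow> 0 + 0"
    using assms unfolding germ_rel_def by (intro tendsto_add) auto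
  then show ?thesis using assms by (auto simp: germ_rel_def Bseq_plus algebra_simps)
qed

lemma Bseq_scaleR: "Bseq X \<Longrightarrow> Bseq (\<lambda>k. c *\<^sub>R X k :: 'a::real_normed_vector)"
proof -
  assume "Bseq X"
  then obtain B where "\<And>k. norm (X k) \<le> B" unfolding Bseq_def by auto
  then show ?thesis by (intro BseqI'[where K = "\<bar>c\<bar> * B"]) (auto intro: mult_left_mono)
qed

lemma germ_rel_scaleR:
  assumes "germ_rel X X'"
  shows "germ_rel (\<lambda>k. c *\<^sub>R X k) (\<lambda>k. c *\<^sub>R X' k)"
proof -
  have "(\<lambda>k. c *\<^sub>R (X k - X' k)) \<longlonglongrightarrow> c *\<^sub>R 0"
    using assms unfolding germ_rel_def by (intro tendsto_scaleR tendsto_const) auto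
  then show ?thesis using assms by (auto simp: germ_rel_def Bseq_scaleR scaleR_diff_right)
qed

lemma germ_rel_minus: "germ_rel X X' \<Longrightarrow> germ_rel (\<lambda>k. - X k) (\<lambda>k. - X' k)"
  using germ_rel_scaleR[of X X' "-1"] by (simp only: scaleR_minus1_left)

lemma Bseq_times: "Bseq X \<Longrightarrow> Bseq Y \<Longrightarrow> Bseq (\<lambda>k. X k * Y k :: 'a::real_normed_algebra)"
proof -
  assume "Bseq X" "Bseq Y"
  then obtain B C where B: "B > 0" "\<And>k. norm (X k) \<le> B" and C: "C > 0" "\<And>k. norm (Y k) \<le> C"
    unfolding Bseq_def by auto
  have "norm (X k * Y k) \<le> B * C" for k
    using norm_mult_ineq[of "X k" "Y k"] mult_mono[OF B(2) C(2)] B C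
    by (meson less_imp_le norm_ge_zero order_trans)
  then show ?thesis by (rule BseqI')
qed

lemma Bseq_star: "Bseq X \<Longrightarrow> Bseq (\<lambda>k. star (X k :: 'y bop))"
  by (simp add: Bseq_def)

lemma tendsto_zero_mult_bounded:
  fixes X Y :: "nat \<Rightarrow> 'a::real_normed_algebra"
  assumes "X \<longlonglongrightarrow> 0" "Bseq Y"
  shows "(\<lambda>k. X k * Y k) \<longlonglongrightarrow> 0" "(\<lambda>k. Y k * X k) \<longlonglongrightarrow> 0"
  using assms bounded_bilinear.Zfun_prod_Bfun[OF bounded_bilinear_mult, of X sequentially Y]
    bounded_bilinear.Bfun_prod_Zfun[OF bounded_bilinear_mult, of Y sequentially X]
  by (simp_all add: tendsto_Zfun_iff)

lemma germ_rel_of_eq: "Bseq X \<Longrightarrow> (\<And>k. X k = Y k) \<Longrightarrow> germ_rel X Y"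
proof -
  assume "Bseq X" "\<And>k. X k = Y k"
  then have "X = Y" by (intro ext)
  with \<open>Bseq X\<close> show ?thesis by (simp add: germ_rel_refl)
qed

lemmas Bseq_intros = Bseq_plus Bseq_diff Bseq_times Bseq_scaleR Bseq_star Bseq_minus_iff[THEN iffD2]

lemma germ_rel_mult:
  assumes "germ_rel X X'" "germ_rel Y Y'"
  shows "germ_rel (\<lambda>k. X k * Y k) (\<lambda>k. X' k * Y' k)"
proof -
  have "(\<lambda>k. (X k - X' k) * Y k + X' k * (Y k - Y' k)) \<longlonglongrightarrow> 0 + 0"
    using assms unfolding germ_rel_def by (intro tendsto_add tendsto_zero_mult_bounded) auto
  then show ?thesis using assms by (auto simp: germ_rel_def Bseq_times algebra_simps)
qed

lemma germ_rel_star: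
  assumes "germ_rel X X'"
  shows "germ_rel (\<lambda>k. star (X k)) (\<lambda>k. star (X' k))"
  using assms bounded_linear.tendsto_zero[OF bounded_linear_star, of "\<lambda>k. X k - X' k" sequentially]
  by (auto simp: germ_rel_def Bseq_star star_diff)

instantiation germ :: (type) real_algebra_1
begin

lift_definition zero_germ :: "'a germ" is "\<lambda>_. 0" by (simp add: germ_rel_def)
lift_definition one_germ :: "'a germ" is "\<lambda>_. 1" by (simp add: germ_rel_def)
lift_definition plus_germ :: "'a germ \<Rightarrow> 'a germ \<Rightarrow> 'a germ" is "\<lambda>X Y k. X k + Y k"
  by (rule germ_rel_add)
lift_definition scaleR_germ :: "real \<Rightarrow> 'a germ \<Rightarrow> 'a germ" is "\<lambda>c X k. c *\<^sub>R X k"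
  by (rule germ_rel_scaleR)
lift_definition uminus_germ :: "'a germ \<Rightarrow> 'a germ" is "\<lambda>X k. - X k"
  by (rule germ_rel_minus)
lift_definition minus_germ :: "'a germ \<Rightarrow> 'a germ \<Rightarrow> 'a germ" is "\<lambda>X Y k. X k - Y k"
  unfolding diff_conv_add_uminus by (rule germ_rel_add[OF _ germ_rel_minus])
lift_definition times_germ :: "'a germ \<Rightarrow> 'a germ \<Rightarrow> 'a germ" is "\<lambda>X Y k. X k * Y k"
  by (rule germ_rel_mult)

instance
proof
  fix a b c :: "'a germ" and r s :: real
  show "a + b + c = a + (b + c)" "a + b = b + a" "0 + a = a" "- a + a = 0" "a - b = a + - b"
    "a * b * c = a * (b * c)" "1 * a = a" "a * 1 = a" "(a + b) * c = a * c + b * c"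
    "a * (b + c) = a * b + a * c" "r *\<^sub>R (a + b) = r *\<^sub>R a + r *\<^sub>R b" "(r + s) *\<^sub>R a = r *\<^sub>R a + s *\<^sub>R a"
    "r *\<^sub>R s *\<^sub>R a = (r * s) *\<^sub>R a" "1 *\<^sub>R a = a" "r *\<^sub>R a * b = r *\<^sub>R (a * b)" "a * r *\<^sub>R b = r *\<^sub>R (a * b)"
    by (transfer, rule germ_rel_of_eq, simp add: germ_rel_def Bseq_intros, simp add: algebra_simps)+
  show "(0 :: 'a germ) \<noteq> 1"
    by transfer (simp add: germ_rel_def LIMSEQ_const_iff)
qed

end

instantiation germ :: (type) star_ring
begin

lift_definition star_germ :: "'a germ \<Rightarrow> 'a germ" is "\<lambda>X k. star (X k)"
  by (rule germ_rel_star)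

instance
  by standard (transfer, rule germ_rel_of_eq, simp add: germ_rel_def Bseq_intros, simp add: star_add star_mult)+

end

definition germ :: "(nat \<Rightarrow> 'y bop) \<Rightarrow> 'y germ" where
  "germ X = abs_germ (if Bseq X then X else (\<lambda>_. 0))"

lemma germ_eq_iff: "Bseq X \<Longrightarrow> Bseq Y \<Longrightarrow> germ X = germ Y \<longleftrightarrow> (\<lambda>k. X k - Y k) \<longlonglongrightarrow> 0"
  using Quotient_rel[OF Quotient_germ, of X Y] by (simp add: germ_def germ_rel_def)

lemma germ_cases:
  obtains X where "Bseq X" "a = germ X"
proof -
  have "germ_rel (rep_germ a) (rep_germ a)" "abs_germ (rep_germ a) = a"
    using Quotient_rep_reflp[OF Quotient_germ] Quotient_abs_rep[OF Quotient_germ] by auto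
  then show thesis by (intro that[of "rep_germ a"]) (auto simp: germ_rel_def germ_def)
qed

lemma germ_simps:
  "Bseq X \<Longrightarrow> Bseq Y \<Longrightarrow> germ X + germ Y = germ (\<lambda>k. X k + Y k)"
  "Bseq X \<Longrightarrow> Bseq Y \<Longrightarrow> germ X - germ Y = germ (\<lambda>k. X k - Y k)"
  "Bseq X \<Longrightarrow> Bseq Y \<Longrightarrow> germ X * germ Y = germ (\<lambda>k. X k * Y k)"
  "Bseq X \<Longrightarrow> - germ X = germ (\<lambda>k. - X k)"
  "Bseq X \<Longrightarrow> c *\<^sub>R germ X = germ (\<lambda>k. c *\<^sub>R X k)"
  "Bseq X \<Longrightarrow> star (germ X) = germ (\<lambda>k. star (X k))"
  "germ (\<lambda>_. 0) = 0" "germ (\<lambda>_. 1) = 1"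
  by (simp_all add: germ_def Bseq_intros germ_rel_refl plus_germ.abs_eq minus_germ.abs_eq times_germ.abs_eq
      uminus_germ.abs_eq scaleR_germ.abs_eq star_germ.abs_eq zero_germ.abs_eq one_germ.abs_eq)

lemma germ_zero_iff: "Bseq X \<Longrightarrow> germ X = 0 \<longleftrightarrow> X \<longlonglongrightarrow> 0"
  using germ_eq_iff[of X "\<lambda>_. 0"] by (simp add: germ_simps)

text \<open>Lifted to sequences, the equation bounds \<open>norm (X k)\<close> by an error tending
  to 0 plus \<open>c\<close> times itself, and \<open>c < 1\<close> absorbs the second term.\<close>

lemma germ_contraction_zero:
  assumes Z: "Z = germ K * Z * germ M" and K: "\<And>k. norm (K k) \<le> 1" and M: "\<And>k. norm (M k) \<le> c" and c: "c < 1"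
  shows "Z = 0"
proof -
  have BK: "Bseq K" and BM: "Bseq M" using K M by (auto intro: BseqI')
  obtain X where X: "Bseq X" "Z = germ X" by (rule germ_cases)
  have "(\<lambda>k. X k - K k * X k * M k) \<longlonglongrightarrow> 0"
    using Z X BK BM by (simp add: germ_simps Bseq_times germ_eq_iff)
  then have "(\<lambda>k. norm (X k - K k * X k * M k) / (1 - c)) \<longlonglongrightarrow> norm (0 :: 'a bop) / (1 - c)"
    using c by (intro tendsto_intros) auto
  then have lim: "(\<lambda>k. norm (X k - K k * X k * M k) / (1 - c)) \<longlonglongrightarrow> 0" by simp
  have "norm (X k) \<le> norm (X k - K k * X k * M k) / (1 - c)" for k
  proof -
    have "norm (K k * X k * M k) \<le> norm (K k) * norm (X k) * norm (M k)"
      by (intro order_trans[OF norm_mult_ineq] mult_right_mono norm_mult_ineq) simp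
    also have "\<dots> \<le> 1 * norm (X k) * c"
      using K M by (intro mult_mono) auto
    finally have "norm (X k) \<le> norm (X k - K k * X k * M k) + norm (X k) * c"
      using norm_triangle_sub[of "X k" "K k * X k * M k"] by simp
    then show ?thesis using c by (simp add: field_simps)
  qed
  then have "X \<longlonglongrightarrow> 0"
    by (intro Lim_null_comparison[OF _ lim] always_eventually) simp
  then show ?thesis using X by (simp add: germ_zero_iff)
qed

text \<open>Two representatives differ by a null sequence, so a bound on one of them eventually
  holds for any other up to an arbitrarily small excess.\<close>

lemma germ_small_zero:
  assumes "\<And>e. e > 0 \<Longrightarrow> \<exists>X. Z = germ X \<and> (\<forall>k. norm (X k) \<le> e)"
  shows "Z = 0"
proof -
  obtain X where X: "Bseq X" "Z = germ X" by (rule germ_cases)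
  have "X \<longlonglongrightarrow> 0"
  proof (rule LIMSEQ_I)
    fix r :: real assume r: "r > 0"
    then obtain Y where Y: "Z = germ Y" "\<And>k. norm (Y k) \<le> r / 2" using assms[of "r / 2"] by auto
    then have "Bseq Y" by (intro BseqI')
    then have "(\<lambda>k. X k - Y k) \<longlonglongrightarrow> 0" using X Y by (simp flip: germ_eq_iff)
    from LIMSEQ_D[OF this, of "r / 2"] r obtain n where n: "\<forall>k\<ge>n. norm (X k - Y k) < r / 2" by auto
    have "norm (X k - 0) < r" if "k \<ge> n" for k
      using n[rule_format, OF that] Y(2)[of k] norm_triangle_sub[of "X k" "Y k"] by simp
    then show "\<exists>no. \<forall>n\<ge>no. norm (X n - 0) < r" by blast
  qed
  then show ?thesis using X by (simp add: germ_zero_iff)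
qed

section \<open>Functional calculus of block operators\<close>

text \<open>The three axioms of an equivalence relation give the unit, adjoints and
  products.\<close>

lemma closed_block_algebra:
  assumes "equiv UNIV E"
  shows "closed {T. supp T \<subseteq> E}" "real_vector.subspace {T. supp T \<subseteq> E}" "supp (1 :: 'y bop) \<subseteq> E"
    "supp S \<subseteq> E \<Longrightarrow> supp T \<subseteq> E \<Longrightarrow> supp (S * T :: 'y bop) \<subseteq> E" "supp T \<subseteq> E \<Longrightarrow> supp (star T) \<subseteq> E"
    "supp S \<subseteq> E \<Longrightarrow> supp T \<subseteq> E \<Longrightarrow> supp (S + T) \<subseteq> E" "supp S \<subseteq> E \<Longrightarrow> supp T \<subseteq> E \<Longrightarrow> supp (S - T) \<subseteq> E"
    "supp T \<subseteq> E \<Longrightarrow> supp (c *\<^sub>R T) \<subseteq> E"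
proof -
  have E: "(x, x) \<in> E" "(x, y) \<in> E \<Longrightarrow> (y, x) \<in> E" "(x, y) \<in> E \<Longrightarrow> (y, z) \<in> E \<Longrightarrow> (x, z) \<in> E" for x y z
    using assms by (meson UNIV_I equivE refl_onD symD transD)+
  show "closed {T. supp T \<subseteq> E}" "real_vector.subspace {T. supp T \<subseteq> E}" by (rule closed_supp subspace_supp)+
  show "supp (1 :: 'y bop) \<subseteq> E" using E(1) by (auto simp: supp_def matrix_of_simps split: if_splits)
  show "supp (S * T) \<subseteq> E" if "supp S \<subseteq> E" "supp T \<subseteq> E" for S T :: "'y bop"
    using supp_mult[of S T] that E(3) by blast
  show "supp (star T) \<subseteq> E" if "supp T \<subseteq> E" using that E(2) by (auto simp: supp_star)
  show "supp (S + T) \<subseteq> E" if "supp S \<subseteq> E" "supp T \<subseteq> E" using that supp_add[of S T] by blast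
  show "supp (S - T) \<subseteq> E" if "supp S \<subseteq> E" "supp T \<subseteq> E" using that supp_diff[of S T] by blast
  show "supp (c *\<^sub>R T) \<subseteq> E" if "supp T \<subseteq> E" using that supp_scaleR[of c T] by blast
qed

lemma supp_diag_op: "f \<in> ell_infty \<Longrightarrow> supp (diag_op f) \<subseteq> Id"
  by (auto simp: supp_def matrix_of_diag_op split: if_splits)

text \<open>For a unitary \<open>W\<close> this is functional calculus in the eigenbasis given by
  \<open>W\<close>, with arbitrary bounded functions, discontinuous ones included.\<close>

definition conj_diag :: "'y bop \<Rightarrow> ('y \<Rightarrow> complex) \<Rightarrow> 'y bop" where
  "conj_diag W f = W * diag_op f * star W"

context
  fixes W :: "'y bop"
  assumes W: "star W * W = 1" "W * star W = 1"
begin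

lemma conj_diag_mult:
  assumes "f \<in> ell_infty" "g \<in> ell_infty"
  shows "conj_diag W f * conj_diag W g = conj_diag W (f * g)"
proof -
  have "conj_diag W f * conj_diag W g = W * diag_op f * (star W * W) * diag_op g * star W"
    by (simp only: conj_diag_def mult.assoc)
  then show ?thesis by (simp add: W conj_diag_def diag_op_mult assms mult.assoc)
qed

lemma conj_diag_add:
  "f \<in> ell_infty \<Longrightarrow> g \<in> ell_infty \<Longrightarrow> conj_diag W f + conj_diag W g = conj_diag W (f + g)"
  by (simp add: conj_diag_def diag_op_add algebra_simps)

lemma conj_diag_one: "conj_diag W 1 = 1"
  by (simp add: conj_diag_def diag_op_one W)

lemma conj_diag_zero: "conj_diag W 0 = 0"
  by (simp add: conj_diag_def diag_op_zero)

lemma star_conj_diag: "f \<in> ell_infty \<Longrightarrow> star (conj_diag W f) = conj_diag W (star f)"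
  by (simp add: conj_diag_def star_mult diag_op_star mult.assoc)

lemma norm_conj_diag:
  assumes "0 \<le> C" "\<And>x. cmod (f x) \<le> C"
  shows "norm (conj_diag W f) \<le> C"
proof -
  have "norm W \<le> 1" using W by (intro norm_isometry)
  have "norm (conj_diag W f) \<le> norm W * norm (diag_op f) * norm (star W)"
    unfolding conj_diag_def by (intro order_trans[OF norm_mult_ineq] mult_right_mono norm_mult_ineq) simp
  also have "\<dots> \<le> 1 * C * 1"
    using \<open>norm W \<le> 1\<close> norm_diag_op[OF assms] assms(1) by (intro mult_mono) auto
  finally show ?thesis by simp
qed

lemma supp_conj_diag:
  assumes "equiv UNIV E" "supp W \<subseteq> E" "f \<in> ell_infty"
  shows "supp (conj_diag W f) \<subseteq> E"
proof -
  have "supp (diag_op f) \<subseteq> E"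
    using supp_diag_op[OF assms(3)] assms(1) by (auto simp: equiv_def refl_on_def)
  then show ?thesis unfolding conj_diag_def by (intro closed_block_algebra[OF assms(1)] assms(2))
qed

text \<open>In the eigenbasis, commuting with the diagonal \<mu> means that nonzero entries link
  only points with equal eigenvalue; such an operator commutes with every function of \<mu>,
  continuous or not.\<close>

lemma conj_diag_commute:
  assumes B: "B * conj_diag W (\<lambda>x. of_real (\<mu> x)) = conj_diag W (\<lambda>x. of_real (\<mu> x)) * B"
    and \<mu>: "(\<lambda>x. of_real (\<mu> x)) \<in> ell_infty" and g: "(\<lambda>x. g (\<mu> x)) \<in> ell_infty"
  shows "B * conj_diag W (\<lambda>x. g (\<mu> x)) = conj_diag W (\<lambda>x. g (\<mu> x)) * B"
proof -
  define B' where "B' = star W * B * W"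
  have WB: "W * B' * star W = B"
  proof -
    have "W * B' * star W = (W * star W) * B * (W * star W)" by (simp only: B'_def mult.assoc)
    then show ?thesis by (simp add: W)
  qed
  have "star W * (B * conj_diag W f) * W = B' * diag_op f" for f
  proof -
    have "star W * (B * conj_diag W f) * W = B' * diag_op f * (star W * W)"
      by (simp only: B'_def conj_diag_def mult.assoc)
    then show ?thesis by (simp add: W)
  qed
  moreover have "star W * (conj_diag W f * B) * W = diag_op f * B'" for f
  proof -
    have "star W * (conj_diag W f * B) * W = (star W * W) * diag_op f * B'"
      by (simp only: B'_def conj_diag_def mult.assoc)
    then show ?thesis by (simp add: W)
  qed
  ultimately have c: "B' * diag_op (\<lambda>x. of_real (\<mu> x)) = diag_op (\<lambda>x. of_real (\<mu> x)) * B'"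
    using B by metis
  have "B' * diag_op (\<lambda>x. g (\<mu> x)) = diag_op (\<lambda>x. g (\<mu> x)) * B'"
  proof (rule matrix_of_eqI)
    fix x y
    have "matrix_of B' x y * of_real (\<mu> y) = of_real (\<mu> x) * matrix_of B' x y"
      using arg_cong[OF c, of "\<lambda>T. matrix_of T x y"]
      by (simp add: matrix_of_diag_mult[OF \<mu>] matrix_of_mult_diag[OF \<mu>])
    then have "matrix_of B' x y = 0 \<or> \<mu> x = \<mu> y" by (auto simp: mult.commute)
    then show "matrix_of (B' * diag_op (\<lambda>x. g (\<mu> x))) x y = matrix_of (diag_op (\<lambda>x. g (\<mu> x)) * B') x y"
      by (auto simp: matrix_of_diag_mult[OF g] matrix_of_mult_diag[OF g])
  qed
  then have "W * (B' * diag_op (\<lambda>x. g (\<mu> x))) * star W = W * (diag_op (\<lambda>x. g (\<mu> x)) * B') * star W"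
    by simp
  moreover have "W * (B' * diag_op f) * star W = W * B' * star W * conj_diag W f" for f
  proof -
    have "W * B' * star W * conj_diag W f = W * B' * (star W * W) * diag_op f * star W"
      by (simp only: conj_diag_def mult.assoc)
    then show ?thesis by (simp add: W mult.assoc)
  qed
  moreover have "W * (diag_op f * B') * star W = conj_diag W f * (W * B' * star W)" for f
  proof -
    have "conj_diag W f * (W * B' * star W) = W * diag_op f * (star W * W) * B' * star W"
      by (simp only: conj_diag_def mult.assoc)
    then show ?thesis by (simp add: W mult.assoc)
  qed
  ultimately show ?thesis by (simp add: WB)
qed

end

section \<open>Lipschitz cut functions\<close>

text \<open>The condition is restricted to the unit interval because these functions are only
  composed with \<open>h\<close>, which takes its values there.\<close>

definition lip :: "(real \<Rightarrow> complex) \<Rightarrow> bool" where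
  "lip G \<longleftrightarrow> (\<exists>C. \<forall>s\<in>{0..1}. \<forall>t\<in>{0..1}. cmod (G s - G t) \<le> C * \<bar>s - t\<bar>)"

definition bdd01 :: "(real \<Rightarrow> complex) \<Rightarrow> bool" where
  "bdd01 G \<longleftrightarrow> (\<exists>C. \<forall>t\<in>{0..1}. cmod (G t) \<le> C)"

lemma lipI: "(\<And>s t. cmod (G s - G t) \<le> C * \<bar>s - t\<bar>) \<Longrightarrow> lip G"
  by (auto simp: lip_def)

lemma lip_imp_bdd01:
  assumes "lip G"
  shows "bdd01 G"
proof -
  obtain C where C: "\<forall>s\<in>{0..1}. \<forall>t\<in>{0..1}. cmod (G s - G t) \<le> C * \<bar>s - t\<bar>"
    using assms by (auto simp: lip_def)
  have "cmod (G t) \<le> cmod (G 0) + \<bar>C\<bar>" if t: "t \<in> {0..1}" for t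
  proof -
    have "cmod (G t - G 0) \<le> C * \<bar>t - 0\<bar>" using C t by (metis atLeastAtMost_iff order_refl zero_le_one)
    also have "\<dots> \<le> \<bar>C\<bar> * 1" using t by (intro mult_mono) auto
    finally show ?thesis using norm_triangle_sub[of "G t" "G 0"] by simp
  qed
  then show ?thesis unfolding bdd01_def by blast
qed

lemma bdd01_mult: "bdd01 F \<Longrightarrow> bdd01 G \<Longrightarrow> bdd01 (\<lambda>t. F t * G t)"
  unfolding bdd01_def
proof (elim exE)
  fix B C assume *: "\<forall>t\<in>{0..1}. cmod (F t) \<le> B" "\<forall>t\<in>{0..1}. cmod (G t) \<le> C"
  have "cmod (F t * G t) \<le> B * C" if "t \<in> {0..1}" for t
    unfolding norm_mult using * that by (intro mult_mono) (auto intro: order_trans[OF norm_ge_zero])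
  then show "\<exists>C. \<forall>t\<in>{0..1}. cmod (F t * G t) \<le> C" by blast
qed

lemma bdd01_add: "bdd01 F \<Longrightarrow> bdd01 G \<Longrightarrow> bdd01 (\<lambda>t. F t + G t)"
  unfolding bdd01_def
proof (elim exE)
  fix B C assume *: "\<forall>t\<in>{0..1}. cmod (F t) \<le> B" "\<forall>t\<in>{0..1}. cmod (G t) \<le> C"
  then have "\<forall>t\<in>{0..1}. cmod (F t + G t) \<le> B + C" by (auto intro: norm_triangle_mono)
  then show "\<exists>C. \<forall>t\<in>{0..1}. cmod (F t + G t) \<le> C" by blast
qed

lemma bdd01_const: "bdd01 (\<lambda>_. c)" by (auto simp: bdd01_def)

lemma bdd01_cnj: "bdd01 F \<Longrightarrow> bdd01 (\<lambda>t. cnj (F t))" by (auto simp: bdd01_def)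

lemma bdd01_diff: "bdd01 F \<Longrightarrow> bdd01 G \<Longrightarrow> bdd01 (\<lambda>t. F t - G t)"
  using bdd01_add[of F "\<lambda>t. (-1) * G t"] bdd01_mult[OF bdd01_const[of "-1"], of G] by simp

lemma sin_lipschitz: "\<bar>sin x - sin y\<bar> \<le> \<bar>x - y\<bar>" for x y :: real
proof -
  have "\<bar>sin ((x - y) / 2)\<bar> * \<bar>cos ((x + y) / 2)\<bar> \<le> \<bar>(x - y) / 2\<bar> * 1"
    by (intro mult_mono abs_sin_x_le_abs_x) auto
  then show ?thesis unfolding sin_diff_sin by (simp add: abs_mult)
qed

lemma cos_lipschitz: "\<bar>cos x - cos y\<bar> \<le> \<bar>x - y\<bar>" for x y :: real
  using sin_lipschitz[of "pi / 2 - x" "pi / 2 - y"] by (simp add: sin_diff)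

lemma sin_scale_lipschitz: "\<bar>sin (c * s) - sin (c * t)\<bar> \<le> \<bar>c\<bar> * \<bar>s - t\<bar>" for s t c :: real
  using sin_lipschitz[of "c * s" "c * t"] by (simp add: abs_mult flip: right_diff_distrib)

lemma cos_scale_lipschitz: "\<bar>cos (c * s) - cos (c * t)\<bar> \<le> \<bar>c\<bar> * \<bar>s - t\<bar>" for s t c :: real
  using cos_lipschitz[of "c * s" "c * t"] by (simp add: abs_mult flip: right_diff_distrib)

lemma max_diff_le: "\<bar>max x c - max y c\<bar> \<le> \<bar>x - y\<bar>" for x y c :: real
  by (simp add: max_def)

lemma lip_of_real_max:
  assumes "\<And>s t. \<bar>f s - f t\<bar> \<le> C * \<bar>s - t\<bar>"
  shows "lip (\<lambda>t. of_real (max (f t) c))"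
  by (rule lipI[where C = C])
     (use order_trans[OF max_diff_le assms] in \<open>simp flip: of_real_diff\<close>)

lemma lip_cis: "lip (\<lambda>t. cis (2 * pi * t))"
proof (rule lipI[where C = "4 * pi"])
  fix s t :: real
  have "cmod (cis (2 * pi * s) - cis (2 * pi * t)) \<le>
      \<bar>cos (2 * pi * s) - cos (2 * pi * t)\<bar> + \<bar>sin (2 * pi * s) - sin (2 * pi * t)\<bar>"
    using cmod_le[of "cis (2 * pi * s) - cis (2 * pi * t)"] by simp
  also have "\<dots> \<le> \<bar>2 * pi\<bar> * \<bar>s - t\<bar> + \<bar>2 * pi\<bar> * \<bar>s - t\<bar>"
    by (intro add_mono cos_scale_lipschitz sin_scale_lipschitz)
  finally show "cmod (cis (2 * pi * s) - cis (2 * pi * t)) \<le> 4 * pi * \<bar>s - t\<bar>" by simp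
qed

section \<open>Cutting a projection in two\<close>

text \<open>The type of operators carries real scalars only; \<open>\<i>\<close> enters as a multiplication operator.\<close>

definition imag_op :: "'y bop" where
  "imag_op = diag_op (\<lambda>_. \<i>)"

lemma imag_op_central: "imag_op * T = T * imag_op"
  by (rule matrix_of_eqI)
     (simp add: imag_op_def matrix_of_diag_mult matrix_of_mult_diag ell_inftyI[where C = 1])

lemma star_imag_op: "star imag_op = - imag_op"
proof -
  have "star (\<lambda>_ :: 'a. \<i>) = - (\<lambda>_. \<i>)" by (simp add: star_fun_def star_complex_def fun_eq_iff)
  moreover have i: "(\<lambda>_ :: 'a. \<i>) \<in> ell_infty" by (rule ell_inftyI[where C = 1]) simp
  moreover have "diag_op (- (\<lambda>_. \<i>)) = - (imag_op :: 'a bop)"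
    by (rule matrix_of_eqI) (simp add: imag_op_def matrix_of_diag_op[OF ell_infty_closed(3)[OF i]] matrix_of_diag_op[OF i] matrix_of_simps)
  ultimately show ?thesis unfolding imag_op_def by (metis diag_op_star)
qed

definition cos_pos :: "real \<Rightarrow> real" where "cos_pos t = max (cos (pi * t)) 0"
definition cos_neg :: "real \<Rightarrow> real" where "cos_neg t = max (- cos (pi * t)) 0"
definition sin_pos :: "real \<Rightarrow> real" where "sin_pos t = max (sin (2 * pi * t)) 0"
definition sin_neg :: "real \<Rightarrow> real" where "sin_neg t = max (- sin (2 * pi * t)) 0"
text \<open>It vanishes at both ends of the unit interval, which confines the difference between the
  unitary and 1 to the zone where \<open>h\<close> lies strictly between 0 and 1.\<close>

definition vf :: "real \<Rightarrow> complex" where "vf t = cis (2 * pi * t) - 1"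
text \<open>Written with the doubled angle because in this form it is a combination of 1,
  \<open>cis (2 * pi * t)\<close> and its conjugate, and so turns into a combination of 1, the
  unitary and its adjoint.\<close>

definition sin_sq :: "real \<Rightarrow> real" where "sin_sq t = (1 - cos (2 * pi * t)) / 2"

lemma sin_sq: "sin_sq t = (sin (pi * t))\<^sup>2"
  using cos_double_sin[of "pi * t"] by (simp add: sin_sq_def mult.assoc)

lemma cos_pos_neg: "cos_pos t * cos_neg t = 0" "cos_pos t * cos_pos t + cos_neg t * cos_neg t + sin_sq t = 1"
  by (auto simp: cos_pos_def cos_neg_def sin_sq max_def sin_squared_eq power2_eq_square)

lemma sin_pi_nonneg: "0 \<le> t \<Longrightarrow> t \<le> 1 \<Longrightarrow> 0 \<le> sin (pi * t)"
  by (rule sin_ge_zero) (auto simp: mult_left_le)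

text \<open>On the unit interval \<open>sin (pi * t)\<close> is nonnegative, so in the double angle
  formula the sine of \<open>2 * pi * t\<close> takes its sign from the cosine, and positive parts
  correspond.\<close>

lemma cos_pos_sin_sq:
  assumes "t \<in> {0..1}"
  shows "4 * (cos_pos t * cos_pos t * sin_sq t) = sin_pos t * sin_pos t"
proof -
  have s: "sin (2 * pi * t) = 2 * sin (pi * t) * cos (pi * t)"
    using sin_double[of "pi * t"] by (simp add: mult.assoc)
  have "max (sin (2 * pi * t)) 0 = 2 * sin (pi * t) * max (cos (pi * t)) 0"
    using sin_pi_nonneg[of t] assms unfolding s
    by (auto simp: max_def mult_le_0_iff zero_le_mult_iff)
  then show ?thesis by (simp add: cos_pos_def sin_pos_def sin_sq power2_eq_square)
qed

lemma cos_neg_sin_sq: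
  assumes "t \<in> {0..1}"
  shows "4 * (cos_neg t * cos_neg t * sin_sq t) = sin_neg t * sin_neg t"
proof -
  have s: "- sin (2 * pi * t) = 2 * sin (pi * t) * (- cos (pi * t))"
    using sin_double[of "pi * t"] by (simp add: mult.assoc)
  have "max (- sin (2 * pi * t)) 0 = 2 * sin (pi * t) * max (- cos (pi * t)) 0"
    using sin_pi_nonneg[of t] assms unfolding s
    by (auto simp: max_def mult_le_0_iff zero_le_mult_iff)
  then show ?thesis by (simp add: cos_neg_def sin_neg_def sin_sq power2_eq_square)
qed

lemma lip_cut_functions:
  "lip (\<lambda>t. of_real (cos_pos t))" "lip (\<lambda>t. of_real (cos_neg t))"
  "lip (\<lambda>t. of_real (sin_pos t))" "lip (\<lambda>t. of_real (sin_neg t))"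
  "lip (\<lambda>t. of_real (sin_sq t))" "lip vf"
proof -
  have m: "\<bar>- f s - - f t\<bar> = \<bar>f s - f t\<bar>" for f :: "real \<Rightarrow> real" and s t by simp
  show "lip (\<lambda>t. of_real (cos_pos t))" "lip (\<lambda>t. of_real (sin_pos t))"
    unfolding cos_pos_def sin_pos_def by (rule lip_of_real_max, rule cos_scale_lipschitz sin_scale_lipschitz)+
  show "lip (\<lambda>t. of_real (cos_neg t))" "lip (\<lambda>t. of_real (sin_neg t))"
    unfolding cos_neg_def sin_neg_def
    by (rule lip_of_real_max, subst m, rule cos_scale_lipschitz sin_scale_lipschitz)+
  show "lip (\<lambda>t. of_real (sin_sq t))"
  proof (rule lipI)
    fix s t
    have "\<bar>sin_sq s - sin_sq t\<bar> = \<bar>cos (2 * pi * s) - cos (2 * pi * t)\<bar> / 2"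
      by (simp add: sin_sq_def abs_minus_commute abs_divide flip: diff_divide_distrib)
    also have "\<dots> \<le> \<bar>2 * pi\<bar> * \<bar>s - t\<bar> / 2" by (intro divide_right_mono cos_scale_lipschitz) simp
    finally show "cmod (of_real (sin_sq s) - of_real (sin_sq t)) \<le> pi * \<bar>s - t\<bar>" by (simp flip: of_real_diff)
  qed
  show "lip vf" using lip_cis by (simp add: lip_def vf_def)
qed

text \<open>Apart from the two limits, everything is asked at each \<open>k\<close> separately: the
  relations and \<open>N k\<close> may vary without control as \<open>k\<close> grows. The condition
  \<open>core\<close> speaks of two steps of \<open>a k\<close> because it serves a product with
  \<open>a k\<close> on both sides.\<close>

locale cut_sequence =
  fixes P :: "'y bop" and a :: "nat \<Rightarrow> 'y bop" and h :: "nat \<Rightarrow> 'y \<Rightarrow> real"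
    and E1 E2 :: "nat \<Rightarrow> ('y \<times> 'y) set" and N :: "nat \<Rightarrow> nat"
  assumes P: "star P = P" "P * P = P"
    and a: "\<And>k. star (a k) = a k" "a \<longlonglongrightarrow> P"
    and h: "\<And>k x. 0 \<le> h k x" "\<And>k x. h k x \<le> 1"
    and comm: "\<And>G. lip G \<Longrightarrow> (\<lambda>k. a k * diag_op (\<lambda>x. G (h k x)) - diag_op (\<lambda>x. G (h k x)) * a k) \<longlonglongrightarrow> 0"
    and E: "\<And>k. equiv UNIV (E1 k)" "\<And>k. equiv UNIV (E2 k)" "\<And>k. locally_finite_rel (N k) (E1 k)"
    and left: "\<And>k x y. (x, y) \<in> supp (a k) \<Longrightarrow> h k x < 1/2 \<Longrightarrow> h k y < 1/2 \<Longrightarrow> (x, y) \<in> E1 k"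
    and right: "\<And>k x y. (x, y) \<in> supp (a k) \<Longrightarrow> h k x > 1/2 \<Longrightarrow> h k y > 1/2 \<Longrightarrow> (x, y) \<in> E2 k"
    and core: "\<And>k x w y. (x, w) \<in> supp (a k) \<Longrightarrow> (w, y) \<in> supp (a k) \<Longrightarrow> 0 < h k w \<Longrightarrow> h k w < 1
        \<Longrightarrow> (x, y) \<in> E1 k \<inter> E2 k"
begin

definition dgs :: "(real \<Rightarrow> complex) \<Rightarrow> nat \<Rightarrow> 'y bop" where
  "dgs G k = diag_op (\<lambda>x. G (h k x))"

definition dg :: "(real \<Rightarrow> complex) \<Rightarrow> 'y germ" where
  "dg G = germ (dgs G)"

abbreviation dgr :: "(real \<Rightarrow> real) \<Rightarrow> 'y germ" where
  "dgr f \<equiv> dg (\<lambda>t. of_real (f t))"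

abbreviation p :: "'y germ" where "p \<equiv> germ (\<lambda>_. P)"

lemma h01: "h k x \<in> {0..1}" using h by simp

lemma dgs_ell_infty: "bdd01 G \<Longrightarrow> (\<lambda>x. G (h k x)) \<in> ell_infty"
  unfolding bdd01_def using h01 ell_inftyI[of "\<lambda>x. G (h k x)"] by blast

lemma norm_dgs: "0 \<le> C \<Longrightarrow> (\<And>t. t \<in> {0..1} \<Longrightarrow> cmod (G t) \<le> C) \<Longrightarrow> norm (dgs G k) \<le> C"
  unfolding dgs_def using h01 by (intro norm_diag_op) blast+

lemma Bseq_dgs: "bdd01 G \<Longrightarrow> Bseq (dgs G)"
  unfolding bdd01_def
  by (elim exE, rule BseqI', rule norm_dgs[of "max 0 _"]) (auto simp: le_max_iff_disj)

lemma dg_mult: "bdd01 F \<Longrightarrow> bdd01 G \<Longrightarrow> dg F * dg G = dg (\<lambda>t. F t * G t)"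
  by (simp add: dg_def germ_simps Bseq_dgs)
     (simp add: dgs_def[abs_def] dgs_ell_infty flip: diag_op_mult, simp add: times_fun_def)

lemma dg_add: "bdd01 F \<Longrightarrow> bdd01 G \<Longrightarrow> dg F + dg G = dg (\<lambda>t. F t + G t)"
  by (simp add: dg_def germ_simps Bseq_dgs)
     (simp add: dgs_def[abs_def] dgs_ell_infty flip: diag_op_add, simp add: plus_fun_def)

lemma dg_one: "dg (\<lambda>_. 1) = 1"
proof -
  have "dgs (\<lambda>_. 1) = (\<lambda>_. 1)" unfolding dgs_def by (simp add: fun_eq_iff flip: one_fun_def) (simp add: diag_op_one)
  then show ?thesis by (simp add: dg_def germ_simps)
qed

lemma dg_zero: "dg (\<lambda>_. 0) = 0"
proof -
  have "dgs (\<lambda>_. 0) = (\<lambda>_. 0)" unfolding dgs_def by (simp add: fun_eq_iff flip: zero_fun_def) (simp add: diag_op_zero)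
  then show ?thesis by (simp add: dg_def germ_simps)
qed

lemma dg_cong: "(\<And>t. t \<in> {0..1} \<Longrightarrow> F t = G t) \<Longrightarrow> dg F = dg G"
  unfolding dg_def dgs_def[abs_def] using h01 by simp

lemma dg_star: "bdd01 F \<Longrightarrow> star (dg F) = dg (\<lambda>t. cnj (F t))"
  by (simp add: dg_def germ_simps Bseq_dgs)
     (simp add: dgs_def[abs_def] dgs_ell_infty flip: diag_op_star, simp add: star_fun_def star_complex_def)

lemma dg_scaleR: "bdd01 F \<Longrightarrow> c *\<^sub>R dg F = dg (\<lambda>t. of_real c * F t)"
proof -
  assume F: "bdd01 F"
  have "bdd01 (\<lambda>t. of_real c * F t)" by (intro bdd01_mult bdd01_const F)
  then have "c *\<^sub>R dgs F k = dgs (\<lambda>t. of_real c * F t) k" for k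
    unfolding dgs_def
    by (intro matrix_of_eqI) (simp add: matrix_of_simps matrix_of_diag_op dgs_ell_infty F dgs_ell_infty[where G = "\<lambda>t. of_real c * F t"])
  then show ?thesis by (simp add: dg_def germ_simps Bseq_dgs F)
qed

lemma dg_diff: "bdd01 F \<Longrightarrow> bdd01 G \<Longrightarrow> dg F - dg G = dg (\<lambda>t. F t - G t)"
  using dg_add[of "\<lambda>t. F t - G t" G] by (simp add: bdd01_diff) (metis add_diff_cancel_right')

lemma Bseq_a: "Bseq a" by (rule convergent_imp_Bseq) (use a in \<open>auto simp: convergent_def\<close>)

lemma germ_a: "germ a = p"
  using a(2) by (simp add: germ_eq_iff Bseq_a LIM_zero)

lemma p_idem: "p * p = p" and p_star: "star p = p"
  by (simp_all add: germ_simps P)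

lemma p_comm: "lip G \<Longrightarrow> p * dg G = dg G * p"
  unfolding germ_a[symmetric] dg_def
  by (simp add: germ_simps germ_eq_iff Bseq_a Bseq_dgs lip_imp_bdd01 Bseq_times)
     (simp add: dgs_def comm)

text \<open>Up to a vanishing error \<open>zs\<close> is \<open>exp(2 \<pi> \<i> P h P)\<close>, since \<open>P\<close> almost commutes with \<open>h\<close>; hence it is almost
  unitary. By \<open>core\<close>, both equivalence relations contain the support of \<open>zs - 1\<close>.\<close>

definition zs :: "nat \<Rightarrow> 'y bop" where
  "zs k = 1 + a k * dgs vf k * a k"

lemma bdd_vf: "bdd01 vf" by (rule lip_imp_bdd01[OF lip_cut_functions(6)])

lemma Bseq_zs: "Bseq zs"
  unfolding zs_def[abs_def] by (intro Bseq_plus Bseq_times Bseq_a Bseq_dgs bdd_vf) simp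

lemma p_comm_star: "lip G \<Longrightarrow> p * star (dg G) = star (dg G) * p"
  using arg_cong[OF p_comm[of G], of star] by (simp add: star_mult p_star)

lemma germ_zs: "germ zs = 1 + p * dg vf"
proof -
  have "germ zs = 1 + germ a * dg vf * germ a"
    unfolding zs_def[abs_def] dg_def
    by (simp add: germ_simps Bseq_a Bseq_dgs bdd_vf Bseq_times Bseq_plus flip: germ_simps(8))
  also have "\<dots> = 1 + p * (p * dg vf)" unfolding germ_a
    by (simp only: p_comm[OF lip_cut_functions(6), symmetric] mult.assoc)
  finally show ?thesis by (simp add: p_idem flip: mult.assoc)
qed

lemma star_vf: "star (dg vf) = dg (\<lambda>t. cnj (vf t))"
  by (rule dg_star[OF bdd_vf])

text \<open>This is the fact that \<open>1 + vf\<close> has modulus 1, expanded.\<close>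

lemma vf_sum: "dg vf + star (dg vf) + star (dg vf) * dg vf = 0"
proof -
  have "vf t + cnj (vf t) + cnj (vf t) * vf t = 0" for t
  proof -
    have "cnj (cis (2 * pi * t)) * cis (2 * pi * t) = 1" by (simp add: cis_cnj flip: cis_mult cis_inverse)
    then show ?thesis by (simp add: vf_def algebra_simps)
  qed
  then have "dg (\<lambda>t. vf t + cnj (vf t) + cnj (vf t) * vf t) = 0" by (simp add: dg_zero)
  then show ?thesis
    unfolding star_vf by (simp add: dg_mult dg_add bdd01_mult bdd01_add bdd01_cnj bdd_vf)
qed

lemma vf_normal: "star (dg vf) * dg vf = dg vf * star (dg vf)"
  unfolding star_vf by (simp add: dg_mult bdd01_cnj bdd_vf mult.commute)

lemma z_unitary: "star (germ zs) * germ zs = 1" "germ zs * star (germ zs) = 1"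
proof -
  let ?v = "dg vf"
  note c = p_comm[OF lip_cut_functions(6)] p_comm_star[OF lip_cut_functions(6)]
  have sz: "star (germ zs) = 1 + p * star ?v"
    unfolding germ_zs by (simp add: star_add star_mult p_star c)
  have pp: "p * x * (p * y) = p * (x * y)" if "p * x = x * p" for x y
  proof -
    have "p * x * (p * y) = p * (x * p) * y" by (simp only: mult.assoc)
    also have "\<dots> = (p * p) * (x * y)" unfolding that[symmetric] by (simp only: mult.assoc)
    finally show ?thesis by (simp add: p_idem)
  qed
  have "star (germ zs) * germ zs = 1 + p * (?v + star ?v + star ?v * ?v)"
    unfolding sz unfolding germ_zs by (simp add: distrib_left distrib_right pp[OF c(2)])
  then show "star (germ zs) * germ zs = 1" by (simp add: vf_sum)
  have "germ zs * star (germ zs) = 1 + p * (?v + star ?v + ?v * star ?v)"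
    unfolding sz unfolding germ_zs by (simp add: distrib_left distrib_right pp[OF c(1)])
  then show "germ zs * star (germ zs) = 1" by (simp add: vf_sum flip: vf_normal)
qed

section \<open>From almost unitaries to unitaries\<close>

definition ys :: "nat \<Rightarrow> 'y bop" where "ys k = 1 - star (zs k) * zs k"

lemma ys_tendsto: "ys \<longlonglongrightarrow> 0" "(\<lambda>k. 1 - zs k * star (zs k)) \<longlonglongrightarrow> 0"
  using z_unitary Bseq_zs
  by (simp_all add: germ_simps Bseq_intros ys_def[abs_def] flip: germ_zero_iff germ_simps(8))
     (simp_all add: germ_simps Bseq_intros flip: germ_simps(2))

definition Ek :: "nat \<Rightarrow> ('y \<times> 'y) set" where "Ek k = E1 k \<inter> E2 k"

lemma equiv_Ek: "equiv UNIV (Ek k)"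
  using E(1,2)[of k] unfolding Ek_def
  by (intro equivI) (auto elim!: equivE simp: refl_on_def intro: sym_Int trans_Int)

lemma Ek_locally_finite: "locally_finite_rel (N k) (Ek k)"
proof -
  have "Ek k `` {x} \<subseteq> E1 k `` {x}" "(Ek k)\<inverse> `` {x} \<subseteq> (E1 k)\<inverse> `` {x}" for x
    by (auto simp: Ek_def)
  then show ?thesis using E(3)[of k] unfolding locally_finite_rel_def
    by (meson card_mono finite_subset order_trans)
qed

lemma supp_zs: "supp (zs k) \<subseteq> Ek k"
proof -
  have v: "matrix_of (dgs vf k) x y = (if x = y then vf (h k x) else 0)" for x y
    by (simp add: dgs_def matrix_of_diag_op[OF dgs_ell_infty[OF bdd_vf]])
  have "supp (a k * dgs vf k * a k) \<subseteq> Ek k"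
  proof clarify
    fix x y assume "(x, y) \<in> supp (a k * dgs vf k * a k)"
    then obtain w where "(x, w) \<in> supp (a k * dgs vf k)" and wy: "(w, y) \<in> supp (a k)"
      using supp_mult by blast
    then obtain w' where xw: "(x, w') \<in> supp (a k)" and "(w', w) \<in> supp (dgs vf k)"
      using supp_mult by blast
    then have "w' = w" and nz: "vf (h k w) \<noteq> 0" by (auto simp: supp_def v split: if_splits)
    have "h k w \<noteq> 0" using nz by (intro notI) (simp add: vf_def)
    moreover have "h k w \<noteq> 1" using nz by (intro notI) (simp add: vf_def)
    ultimately have "0 < h k w" "h k w < 1" using h[of k w] by linarith+
    then show "(x, y) \<in> Ek k" using core xw wy \<open>w' = w\<close> by (auto simp: Ek_def)
  qed
  then show ?thesis
    unfolding zs_def by (rule closed_block_algebra(6)[OF equiv_Ek closed_block_algebra(3)[OF equiv_Ek]])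
qed

definition good :: "nat \<Rightarrow> bool" where
  "good k \<longleftrightarrow> norm (ys k) < 1 \<and> norm (1 - zs k * star (zs k)) < 1"

definition us :: "nat \<Rightarrow> 'y bop" where
  "us k = (if good k then zs k * inv_sqrt (ys k) else 1)"

lemma us: "star (us k) * us k = 1" "us k * star (us k) = 1" "supp (us k) \<subseteq> Ek k"
proof -
  have "star (us k) * us k = 1 \<and> us k * star (us k) = 1 \<and> supp (us k) \<subseteq> Ek k"
  proof (cases "good k")
    case True
    note cb = closed_block_algebra[OF equiv_Ek[of k]]
    have lt: "norm (1 - star (zs k) * zs k) < 1" "norm (1 - zs k * star (zs k)) < 1"
      using True by (auto simp: good_def ys_def)
    obtain v where "v = zs k * inv_sqrt (1 - star (zs k) * zs k)" "v \<in> {T. supp T \<subseteq> Ek k}"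
      "star v * v = 1" "v * star v = 1"
      by (rule polar_partial_isometry[OF cb(1,2), of "zs k" 1 1])
         (use lt supp_zs in \<open>auto intro: cb(3-5)[THEN subsetD]\<close>)
    then show ?thesis using True by (simp add: us_def ys_def)
  next
    case False
    then show ?thesis using closed_block_algebra(3)[OF equiv_Ek] by (simp add: us_def)
  qed
  then show "star (us k) * us k = 1" "us k * star (us k) = 1" "supp (us k) \<subseteq> Ek k" by auto
qed

lemma Bseq_us: "Bseq us"
  by (rule BseqI'[where K = 1]) (rule norm_isometry[OF us(1)])

lemma eventually_good: "eventually good sequentially"
proof -
  have "eventually (\<lambda>k. norm (ys k) < 1) sequentially"
    using tendstoD[OF ys_tendsto(1), of 1] by simp
  moreover have "eventually (\<lambda>k. norm (1 - zs k * star (zs k)) < 1) sequentially"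
    using tendstoD[OF ys_tendsto(2), of 1] by simp
  ultimately show ?thesis by eventually_elim (simp add: good_def)
qed

lemma germ_us: "germ us = germ zs"
proof -
  have lim: "(\<lambda>k. norm (ys k) / (1 - norm (ys k))) \<longlonglongrightarrow> 0"
  proof -
    have "(\<lambda>k. norm (ys k) / (1 - norm (ys k))) \<longlonglongrightarrow> norm (0 :: 'y bop) / (1 - norm (0 :: 'y bop))"
      by (intro tendsto_intros ys_tendsto) simp
    then show ?thesis by simp
  qed
  have "(\<lambda>k. if good k then inv_sqrt (ys k) - 1 else 0) \<longlonglongrightarrow> 0"
    by (rule Lim_null_comparison[OF _ lim], rule eventually_mono[OF eventually_good])
       (auto simp: good_def intro: norm_inv_sqrt_diff_one)
  from tendsto_zero_mult_bounded(2)[OF this Bseq_zs]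
  have "(\<lambda>k. zs k * (if good k then inv_sqrt (ys k) - 1 else 0)) \<longlonglongrightarrow> 0" .
  then have "(\<lambda>k. us k - zs k) \<longlonglongrightarrow> 0"
    by (rule Lim_transform_eventually, intro eventually_mono[OF eventually_good])
       (simp add: us_def right_diff_distrib)
  then show ?thesis by (simp add: germ_eq_iff Bseq_us Bseq_zs)
qed

text \<open>The imaginary part of \<open>us k\<close>: division by 2i is multiplication by
  -i/2.\<close>

definition Ss :: "nat \<Rightarrow> 'y bop" where
  "Ss k = (- 1 / 2) *\<^sub>R (imag_op * (us k - star (us k)))"

text \<open>Half of 1 minus the real part of \<open>us k\<close>, the operator form of
  \<open>sin_sq\<close>; up to a vanishing error it is \<open>P\<close> times sin^2(pi h).\<close>

definition Ds :: "nat \<Rightarrow> 'y bop" where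
  "Ds k = (1 / 4) *\<^sub>R (2 *\<^sub>R 1 - us k - star (us k))"

lemma Ss: "star (Ss k) = Ss k" "supp (Ss k) \<subseteq> Ek k"
proof -
  have "star (Ss k) = (- 1 / 2) *\<^sub>R ((star (us k) - us k) * (- imag_op))"
    by (simp add: Ss_def star_scaleR star_mult star_diff star_imag_op star_minus)
  then show "star (Ss k) = Ss k" by (simp add: Ss_def imag_op_central algebra_simps)
  have "supp imag_op \<subseteq> Ek k"
    using supp_diag_op[OF ell_inftyI[where C = 1 and f = "\<lambda>_. \<i>"]] equiv_Ek[of k]
    by (auto simp: imag_op_def equiv_def refl_on_def)
  then show "supp (Ss k) \<subseteq> Ek k"
    unfolding Ss_def by (intro closed_block_algebra[OF equiv_Ek] us)
qed

lemma Ds: "star (Ds k) = Ds k" "supp (Ds k) \<subseteq> Ek k" "Ds k * Ss k = Ss k * Ds k"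
proof -
  show "star (Ds k) = Ds k"
    by (simp add: Ds_def star_scaleR star_diff star_add algebra_simps)
  show "supp (Ds k) \<subseteq> Ek k"
    unfolding Ds_def by (intro closed_block_algebra[OF equiv_Ek] us)
  have "(2 *\<^sub>R 1 - us k - star (us k)) * (us k - star (us k)) = (us k - star (us k)) * (2 *\<^sub>R 1 - us k - star (us k))"
    by (simp add: algebra_simps us)
  then show "Ds k * Ss k = Ss k * Ds k"
    by (simp add: Ds_def Ss_def mult.assoc) (metis imag_op_central mult.assoc)
qed

lemma Bseq_const: "Bseq (\<lambda>_ :: nat. (T :: 'y bop))" by simp

lemma germ_Ss: "germ Ss = p * dgr (\<lambda>t. sin (2 * pi * t))"
proof -
  note lv = lip_cut_functions(6)
  have i: "dg (\<lambda>_. \<i>) = germ (\<lambda>_. imag_op)" by (simp add: dg_def dgs_def[abs_def] imag_op_def)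
  have "germ Ss = (- 1 / 2) *\<^sub>R (dg (\<lambda>_. \<i>) * (germ us - star (germ us)))"
    unfolding i Ss_def[abs_def] by (simp add: germ_simps Bseq_us Bseq_intros)
  also have "germ us - star (germ us) = p * (dg vf - star (dg vf))"
    unfolding germ_us germ_zs by (simp add: star_add star_mult p_star right_diff_distrib p_comm_star[OF lv])
  also have "dg (\<lambda>_. \<i>) * (p * (dg vf - star (dg vf))) = p * (dg (\<lambda>_. \<i>) * (dg vf - star (dg vf)))"
  proof -
    have "dg (\<lambda>_. \<i>) * p = p * dg (\<lambda>_. \<i>)" by (rule p_comm[symmetric], rule lipI[where C = 0]) simp
    then show ?thesis by (simp flip: mult.assoc)
  qed
  also have "(- 1 / 2) *\<^sub>R \<dots> = p * ((- 1 / 2) *\<^sub>R (dg (\<lambda>_. \<i>) * (dg vf - star (dg vf))))" by simp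
  also have "(- 1 / 2) *\<^sub>R (dg (\<lambda>_. \<i>) * (dg vf - star (dg vf)))
      = dg (\<lambda>t. of_real (- 1 / 2) * (\<i> * (vf t - cnj (vf t))))"
    unfolding star_vf by (simp only: dg_mult dg_diff dg_scaleR bdd01_mult bdd01_diff bdd01_cnj bdd_vf bdd01_const)
  also have "\<dots> = dgr (\<lambda>t. sin (2 * pi * t))"
    by (rule dg_cong) (simp add: complex_eq_iff vf_def)
  finally show ?thesis .
qed

lemma germ_Ds: "germ Ds = p * dgr sin_sq"
proof -
  note lv = lip_cut_functions(6)
  have "germ Ds = (1 / 4) *\<^sub>R (2 *\<^sub>R 1 - germ us - star (germ us))"
    unfolding Ds_def[abs_def] by (simp add: germ_simps Bseq_us Bseq_intros flip: germ_simps(8))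
  also have "2 *\<^sub>R 1 - germ us - star (germ us) = - (p * (dg vf + star (dg vf)))"
    unfolding germ_us germ_zs
    by (simp add: star_add star_mult p_star p_comm_star[OF lv] distrib_left scaleR_2)
  also have "(1 / 4) *\<^sub>R \<dots> = p * ((- 1 / 4) *\<^sub>R (dg vf + star (dg vf)))" by simp
  also have "(- 1 / 4) *\<^sub>R (dg vf + star (dg vf)) = dg (\<lambda>t. of_real (- 1 / 4) * (vf t + cnj (vf t)))"
    unfolding star_vf by (simp only: dg_add dg_scaleR bdd01_add bdd01_cnj bdd_vf)
  also have "\<dots> = dgr sin_sq"
    by (rule dg_cong) (simp add: complex_eq_iff sin_sq_def vf_def diff_divide_distrib)
  finally show ?thesis .
qed

definition diag_S :: "nat \<Rightarrow> 'y bop \<times> ('y \<Rightarrow> real)" where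
  "diag_S k = (SOME d. star (fst d) * fst d = 1 \<and> fst d * star (fst d) = 1 \<and> supp (fst d) \<subseteq> Ek k \<and>
     Ss k = conj_diag (fst d) (\<lambda>x. of_real (snd d x)) \<and> (\<forall>x. \<bar>snd d x\<bar> \<le> norm (Ss k)))"

definition Wk :: "nat \<Rightarrow> 'y bop" where "Wk k = fst (diag_S k)"
definition mu :: "nat \<Rightarrow> 'y \<Rightarrow> real" where "mu k = snd (diag_S k)"

lemma diag_S:
  "star (Wk k) * Wk k = 1" "Wk k * star (Wk k) = 1" "supp (Wk k) \<subseteq> Ek k"
  "Ss k = conj_diag (Wk k) (\<lambda>x. of_real (mu k x))" "\<bar>mu k x\<bar> \<le> norm (Ss k)"
proof -
  obtain W \<mu> where "star W * W = 1" "W * star W = 1" "supp W \<subseteq> Ek k"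
    "Ss k = W * diag_op (\<lambda>x. of_real (\<mu> x)) * star W" "\<And>x. \<bar>\<mu> x\<bar> \<le> norm (Ss k)"
    by (rule self_adjoint_block_diag[OF equiv_Ek Ek_locally_finite Ss]) blast
  then have "\<exists>d. star (fst d) * fst d = 1 \<and> fst d * star (fst d) = 1 \<and> supp (fst d) \<subseteq> Ek k \<and>
     Ss k = conj_diag (fst d) (\<lambda>x. of_real (snd d x)) \<and> (\<forall>x. \<bar>snd d x\<bar> \<le> norm (Ss k))"
    by (intro exI[of _ "(W, \<mu>)"]) (auto simp: conj_diag_def)
  from someI_ex[OF this, folded diag_S_def]
  show "star (Wk k) * Wk k = 1" "Wk k * star (Wk k) = 1" "supp (Wk k) \<subseteq> Ek k"
    "Ss k = conj_diag (Wk k) (\<lambda>x. of_real (mu k x))" "\<bar>mu k x\<bar> \<le> norm (Ss k)"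
    unfolding Wk_def mu_def by blast+
qed

definition fc :: "(real \<Rightarrow> real) \<Rightarrow> nat \<Rightarrow> 'y bop" where
  "fc g k = conj_diag (Wk k) (\<lambda>x. of_real (g (mu k x)))"

definition fpos :: "real \<Rightarrow> real" where "fpos m = (if m > 0 then 1 else 0)"
definition fneg :: "real \<Rightarrow> real" where "fneg m = (if m > 0 then 0 else 1)"
text \<open>\<open>gpos\<close> inverts \<open>1 + m\<close> where \<open>m > 0\<close>, and
  \<open>gneg\<close> inverts \<open>1 - m\<close> elsewhere. The numbers inverted are at least 1,
  so both functions yield contractions.\<close>

definition gpos :: "real \<Rightarrow> real" where "gpos m = (if m > 0 then 1 / (1 + m) else 0)"
definition gneg :: "real \<Rightarrow> real" where "gneg m = (if m > 0 then 0 else 1 / (1 - m))"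

lemma fg_bounds: "\<bar>fpos m\<bar> \<le> 1" "\<bar>fneg m\<bar> \<le> 1" "\<bar>gpos m\<bar> \<le> 1" "\<bar>gneg m\<bar> \<le> 1"
  by (auto simp: fpos_def fneg_def gpos_def gneg_def)

lemma fc_ell_infty: "(\<And>m. \<bar>g m\<bar> \<le> 1) \<Longrightarrow> (\<lambda>x. of_real (g (mu k x))) \<in> ell_infty"
  by (rule ell_inftyI[where C = 1]) simp

lemma mu_ell_infty: "(\<lambda>x. of_real (mu k x)) \<in> ell_infty"
  by (rule ell_inftyI[where C = "norm (Ss k)"]) (simp add: diag_S(5))

lemma norm_fc: "(\<And>m. \<bar>g m\<bar> \<le> 1) \<Longrightarrow> norm (fc g k) \<le> 1"
  unfolding fc_def by (rule norm_conj_diag[OF diag_S(1,2)]) auto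

lemma Bseq_fc: "(\<And>m. \<bar>g m\<bar> \<le> 1) \<Longrightarrow> Bseq (fc g)"
  by (rule BseqI'[where K = 1]) (rule norm_fc)

lemma supp_fc: "(\<And>m. \<bar>g m\<bar> \<le> 1) \<Longrightarrow> supp (fc g k) \<subseteq> Ek k"
  unfolding fc_def by (rule supp_conj_diag[OF diag_S(1,2) equiv_Ek diag_S(3) fc_ell_infty])

lemma star_fc: "(\<And>m. \<bar>g m\<bar> \<le> 1) \<Longrightarrow> star (fc g k) = fc g k"
  unfolding fc_def by (subst star_conj_diag[OF diag_S(1,2) fc_ell_infty])
    (simp_all add: star_fun_def star_complex_def)

lemma fc_mult:
  assumes "\<And>m. \<bar>f m\<bar> \<le> 1" "\<And>m. \<bar>g m\<bar> \<le> 1" "\<And>m. f m * g m = e m"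
  shows "fc f k * fc g k = fc e k"
  unfolding fc_def
  by (subst conj_diag_mult[OF diag_S(1,2) fc_ell_infty[OF assms(1)] fc_ell_infty[OF assms(2)]])
     (simp add: times_fun_def assms(3) flip: of_real_mult)

lemma fc_Ss:
  assumes "\<And>m. \<bar>f m\<bar> \<le> 1" "\<And>m. \<bar>g m\<bar> \<le> 1" "\<And>m. f m * (1 - c * m) = g m"
  shows "fc f k * (1 - c *\<^sub>R Ss k) = fc g k"
proof -
  have "conj_diag (Wk k) (\<lambda>x. of_real (1 - c * mu k x)) = 1 - c *\<^sub>R Ss k"
  proof -
    have i: "(\<lambda>x. of_real (- c * mu k x)) \<in> ell_infty"
      using ell_infty_closed(2)[OF ell_inftyI[of "\<lambda>_. of_real (- c)" "\<bar>c\<bar>"] mu_ell_infty[of k]]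
      by (simp add: times_fun_def)
    have "(\<lambda>x. complex_of_real (1 - c * mu k x)) = 1 + (\<lambda>x. of_real (- c * mu k x))"
      by (simp add: fun_eq_iff)
    then have "conj_diag (Wk k) (\<lambda>x. of_real (1 - c * mu k x)) = 1 + conj_diag (Wk k) (\<lambda>x. of_real (- c * mu k x))"
      using conj_diag_add[OF diag_S(1,2) ell_infty_closed(6) i] by (simp add: conj_diag_one[OF diag_S(1,2)])
    moreover have "diag_op (\<lambda>x. of_real (- c * mu k x)) = (- c) *\<^sub>R diag_op (\<lambda>x. of_real (mu k x))"
      by (rule matrix_of_eqI, unfold matrix_of_diag_op[OF i] matrix_of_simps matrix_of_diag_op[OF mu_ell_infty]) simp
    ultimately show ?thesis by (simp add: conj_diag_def diag_S(4))
  qed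
  note eq = this
  have i2: "(\<lambda>x. complex_of_real (1 - c * mu k x)) \<in> ell_infty"
  proof (rule ell_inftyI)
    show "cmod (complex_of_real (1 - c * mu k x)) \<le> 1 + \<bar>c\<bar> * norm (Ss k)" for x
      using mult_left_mono[OF diag_S(5)[of k x], of "\<bar>c\<bar>"]
      by (simp only: norm_of_real) (rule order_trans[OF abs_triangle_ineq4], simp add: abs_mult)
  qed
  have "fc f k * (1 - c *\<^sub>R Ss k)
      = conj_diag (Wk k) ((\<lambda>x. of_real (f (mu k x))) * (\<lambda>x. of_real (1 - c * mu k x)))"
    unfolding fc_def eq[symmetric]
    by (rule conj_diag_mult[OF diag_S(1,2) fc_ell_infty[of f k, OF assms(1)] i2])
  also have "(\<lambda>x. of_real (f (mu k x))) * (\<lambda>x. of_real (1 - c * mu k x)) = (\<lambda>x. complex_of_real (g (mu k x)))"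
    by (rule ext) (simp only: times_fun_def of_real_mult[symmetric] assms(3))
  finally show ?thesis by (simp only: fc_def)
qed

text \<open>\<open>Ds k\<close> and \<open>Ss k\<close> are both linear in the unitary
  \<open>us k\<close> and its adjoint, so they commute; \<open>conj_diag_commute\<close> passes from
  \<open>Ss k\<close> to its functions.\<close>

lemma fc_Ds: "(\<And>m. \<bar>g m\<bar> \<le> 1) \<Longrightarrow> Ds k * fc g k = fc g k * Ds k"
  unfolding fc_def
  by (rule conj_diag_commute[OF diag_S(1,2), where g = "\<lambda>m. of_real (g m)"])
     (use Ds(3)[of k] in \<open>auto simp: mu_ell_infty fc_ell_infty simp flip: diag_S(4)\<close>)

lemma fc_sum: "fc fpos k + fc fneg k = 1"
proof -
  have "(\<lambda>x. complex_of_real (fpos (mu k x))) + (\<lambda>x. of_real (fneg (mu k x))) = 1"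
    by (simp add: fun_eq_iff fpos_def fneg_def)
  then show ?thesis
    using conj_diag_add[OF diag_S(1,2)[of k] fc_ell_infty[of fpos k, OF fg_bounds(1)] fc_ell_infty[of fneg k, OF fg_bounds(2)]]
    by (simp add: fc_def conj_diag_one[OF diag_S(1,2)])
qed

text \<open>The spectral projection \<open>e\<close> of the sign of \<open>S = p f\<close> kills the part of \<open>p\<close> where \<open>f\<close> has the other sign:
  where \<open>f \<ge> \<tau> > 0\<close> the operator \<open>e f p\<close> is fixed by a contraction.\<close>

lemma wrong_sign_vanishes:
  fixes f :: "real \<Rightarrow> real"
  assumes f: "\<And>s t. \<bar>f s - f t\<bar> \<le> C * \<bar>s - t\<bar>" "\<And>t. \<bar>f t\<bar> \<le> 1"
    and b: "\<And>m. \<bar>e m\<bar> \<le> 1" "\<And>m. \<bar>g m\<bar> \<le> 1"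
    and S: "germ (fc g) * (1 - p * dgr f) = germ (fc e)" "germ (fc g) * germ (fc e) = germ (fc g)"
  shows "germ (fc e) * dgr (\<lambda>t. max (f t) 0) * p = 0"
proof (rule germ_small_zero)
  fix \<epsilon> :: real assume "\<epsilon> > 0"
  define \<tau> where "\<tau> = min \<epsilon> (1/2)"
  have \<tau>: "0 < \<tau>" "\<tau> < 1" "\<tau> \<le> \<epsilon>" using \<open>\<epsilon> > 0\<close> by (auto simp: \<tau>_def)
  \<comment> \<open>\<open>\<phi>\<close> lives where \<open>f > \<tau>\<close>; there
    \<open>1 - f\<close> agrees with \<open>n\<close>, which never exceeds
    \<open>1 - \<tau>\<close>. This is the contraction.\<close>
  define \<phi> where "\<phi> t = max (f t - \<tau>) 0" for t
  define n where "n t = 1 - max (f t) \<tau>" for t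
  have lf: "lip (\<lambda>t. of_real (f t))"
    by (rule lipI[where C = C]) (simp add: f flip: of_real_diff)
  have l\<phi>: "lip (\<lambda>t. of_real (\<phi> t))" unfolding \<phi>_def by (rule lip_of_real_max[where C = C]) (simp add: f)
  have ln: "lip (\<lambda>t. of_real (n t))"
  proof (rule lipI)
    show "cmod (of_real (n s) - of_real (n t)) \<le> C * \<bar>s - t\<bar>" for s t
      using order_trans[OF max_diff_le[of "f t" \<tau> "f s"] f(1)[of t s]]
      by (simp add: n_def abs_minus_commute flip: of_real_diff)
  qed
  have l0: "lip (\<lambda>t. of_real (max (f t) 0))" by (rule lip_of_real_max) (rule f)
  note bd = lip_imp_bdd01[OF lf] lip_imp_bdd01[OF l\<phi>] lip_imp_bdd01[OF ln] lip_imp_bdd01[OF l0]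
  let ?e = "germ (fc e)" and ?g = "germ (fc g)"
  have fn: "dgr \<phi> - dgr f * dgr \<phi> = dgr \<phi> * dgr n"
    unfolding dg_mult[OF bd(1,2)] dg_mult[OF bd(2,3)] dg_diff[OF bd(2) bdd01_mult[OF bd(1,2)]]
  proof (rule dg_cong)
    fix t
    have "\<phi> t - f t * \<phi> t = \<phi> t * n t" by (auto simp: \<phi>_def n_def max_def algebra_simps)
    then show "complex_of_real (\<phi> t) - of_real (f t) * of_real (\<phi> t) = of_real (\<phi> t) * of_real (n t)"
      by (metis of_real_diff of_real_mult)
  qed
  define Z where "Z = ?e * dgr \<phi> * p"
  \<comment> \<open>The spectral projection is replaced by \<open>g (1 - p f)\<close>. As
    \<open>p\<close> commutes with Lipschitz functions of \<open>h\<close>, the factor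
    \<open>1 - f\<close> reaches \<phi>, turns into \<open>n\<close> and moves to the far
    right.\<close>
  have "Z = ?g * (1 - p * dgr f) * dgr \<phi> * p" by (simp add: Z_def S)
  also have "\<dots> = ?g * (dgr \<phi> * p - dgr f * (p * dgr \<phi>) * p)"
    by (simp only: p_comm[OF lf] mult.assoc left_diff_distrib right_diff_distrib mult_1)
  also have "\<dots> = ?g * (dgr \<phi> - dgr f * dgr \<phi>) * p"
    by (simp only: p_comm[OF l\<phi>] mult.assoc left_diff_distrib right_diff_distrib p_idem)
  also have "\<dots> = ?g * ?e * dgr \<phi> * (p * dgr n)"
    unfolding fn S(2) by (simp only: p_comm[OF ln] mult.assoc)
  also have "\<dots> = ?g * Z * dgr n" by (simp only: Z_def mult.assoc)
  finally have Zc: "Z = germ (fc g) * Z * germ (dgs (\<lambda>t. of_real (n t)))" by (simp only: dg_def)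
  have nn: "norm (dgs (\<lambda>t. of_real (n t)) k) \<le> 1 - \<tau>" for k
  proof (rule norm_dgs)
    have "\<bar>n t\<bar> \<le> 1 - \<tau>" for t using f(2)[of t] \<tau> by (auto simp: n_def max_def)
    then show "cmod (of_real (n t)) \<le> 1 - \<tau>" for t by simp
  qed (use \<tau> in simp)
  have Z0: "Z = 0"
    by (rule germ_contraction_zero[OF Zc norm_fc[OF b(2)] nn]) (use \<tau> in simp)
  \<comment> \<open>What \<phi> cuts off from the positive part of \<open>f\<close> is at most
    \<tau>, hence at most \<epsilon>.\<close>
  define \<psi> where "\<psi> t = max (f t) 0 - \<phi> t" for t
  have \<psi>: "\<bar>\<psi> t\<bar> \<le> \<tau>" for t using \<tau> by (auto simp: \<psi>_def \<phi>_def max_def)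
  then have b\<psi>: "bdd01 (\<lambda>t. of_real (\<psi> t))" by (auto simp: bdd01_def)
  have "dgr (\<lambda>t. max (f t) 0) = dgr \<psi> + dgr \<phi>"
    unfolding dg_add[OF b\<psi> bd(2)] by (rule dg_cong) (simp add: \<psi>_def)
  then have "?e * dgr (\<lambda>t. max (f t) 0) * p = ?e * dgr \<psi> * p"
    using Z0 by (simp add: Z_def distrib_left distrib_right)
  also have "\<dots> = germ (\<lambda>k. fc e k * dgs (\<lambda>t. of_real (\<psi> t)) k * P)"
    by (simp add: dg_def germ_simps Bseq_fc b Bseq_dgs b\<psi> Bseq_times)
  finally have eq: "?e * dgr (\<lambda>t. max (f t) 0) * p = germ (\<lambda>k. fc e k * dgs (\<lambda>t. of_real (\<psi> t)) k * P)" .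
  have "norm (fc e k * dgs (\<lambda>t. of_real (\<psi> t)) k * P) \<le> \<epsilon>" for k
  proof -
    have "norm (fc e k * dgs (\<lambda>t. of_real (\<psi> t)) k * P)
        \<le> norm (fc e k) * norm (dgs (\<lambda>t. of_real (\<psi> t)) k) * norm P"
      by (intro order_trans[OF norm_mult_ineq] mult_right_mono norm_mult_ineq) simp
    also have "\<dots> \<le> 1 * \<tau> * 1"
      using \<tau> \<psi> by (intro mult_mono norm_fc b norm_dgs norm_projection P) auto
    finally show ?thesis using \<tau> by simp
  qed
  with eq show "\<exists>X. ?e * dgr (\<lambda>t. max (f t) 0) * p = germ X \<and> (\<forall>k. norm (X k) \<le> \<epsilon>)" by blast
qed

abbreviation ep :: "'y germ" where "ep \<equiv> germ (fc fpos)"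
abbreviation em :: "'y germ" where "em \<equiv> germ (fc fneg)"

lemma Bseq_Ss: "Bseq Ss"
  unfolding Ss_def[abs_def] by (intro Bseq_scaleR Bseq_times Bseq_diff Bseq_us Bseq_star Bseq_const)

lemma Bseq_Ds: "Bseq Ds"
  unfolding Ds_def[abs_def] by (intro Bseq_scaleR Bseq_diff Bseq_us Bseq_star Bseq_const)

text \<open>\<open>em\<close> belongs to the eigenvalues \<open>m \<le> 0\<close>, where
  \<open>1 - m\<close> is invertible with inverse \<open>gneg\<close>.\<close>

lemma em_sin_pos: "em * dgr sin_pos * p = 0"
  unfolding sin_pos_def
proof (rule wrong_sign_vanishes[where g = gneg and C = "\<bar>2 * pi\<bar>"])
  have "germ (fc gneg) * (1 - germ Ss) = germ (\<lambda>k. fc gneg k * (1 - 1 *\<^sub>R Ss k))"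
    by (simp add: germ_simps Bseq_fc fg_bounds Bseq_Ss Bseq_diff flip: germ_simps(8))
  also have "\<dots> = em" by (subst fc_Ss[where g = fneg]) (auto simp: fg_bounds gneg_def fneg_def)
  finally show "germ (fc gneg) * (1 - p * dgr (\<lambda>t. sin (2 * pi * t))) = em" by (simp only: germ_Ss)
  show "germ (fc gneg) * em = germ (fc gneg)"
    by (simp add: germ_simps Bseq_fc fg_bounds) (subst fc_mult[where e = gneg], auto simp: fg_bounds gneg_def fneg_def)
  show "\<bar>sin (2 * pi * s) - sin (2 * pi * t)\<bar> \<le> \<bar>2 * pi\<bar> * \<bar>s - t\<bar>" for s t
    by (rule sin_scale_lipschitz)
qed (auto simp: fg_bounds)

lemma ep_sin_neg: "ep * dgr sin_neg * p = 0"
  unfolding sin_neg_def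
proof (rule wrong_sign_vanishes[where g = gpos and C = "\<bar>2 * pi\<bar>"])
  have b: "bdd01 (\<lambda>t. of_real (sin (2 * pi * t)))"
    unfolding bdd01_def by (rule exI[of _ 1]) simp
  have "p * dgr (\<lambda>t. - sin (2 * pi * t)) = - (p * dgr (\<lambda>t. sin (2 * pi * t)))"
    using dg_scaleR[OF b, of "-1"] by (simp flip: mult_minus_right)
  moreover have "germ (fc gpos) * (1 + germ Ss) = germ (\<lambda>k. fc gpos k * (1 - (-1) *\<^sub>R Ss k))"
    by (simp add: germ_simps Bseq_fc fg_bounds Bseq_Ss Bseq_plus flip: germ_simps(8))
  moreover have "\<dots> = ep" by (subst fc_Ss[where g = fpos]) (auto simp: fg_bounds gpos_def fpos_def)
  ultimately show "germ (fc gpos) * (1 - p * dgr (\<lambda>t. - sin (2 * pi * t))) = ep" by (simp add: germ_Ss)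
  show "germ (fc gpos) * ep = germ (fc gpos)"
    by (simp add: germ_simps Bseq_fc fg_bounds) (subst fc_mult[where e = gpos], auto simp: fg_bounds gpos_def fpos_def)
  show "\<bar>- sin (2 * pi * s) - - sin (2 * pi * t)\<bar> \<le> \<bar>2 * pi\<bar> * \<bar>s - t\<bar>" for s t
    using sin_scale_lipschitz[of "2 * pi" t s] by (simp add: abs_minus_commute)
qed (auto simp: fg_bounds)

text \<open>The two halves of \<open>P\<close>: the defect \<open>sin\<^sup>2\<close> of \<open>cos_pos\<^sup>2 + cos_neg\<^sup>2\<close> from \<open>1\<close> is shared out by the sign of \<open>Ss\<close>.
  Their product vanishes in the limit since \<open>cos_pos\<close> times the root of \<open>sin_sq\<close> is \<open>sin_pos / 2\<close>, which
  \<open>em\<close> annihilates on the range of \<open>P\<close>.\<close>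

definition t1s :: "nat \<Rightarrow> 'y bop" where
  "t1s k = dgs (\<lambda>t. of_real (cos_pos t)) k * a k * dgs (\<lambda>t. of_real (cos_pos t)) k + Ds k * fc fpos k"

definition t2s :: "nat \<Rightarrow> 'y bop" where
  "t2s k = dgs (\<lambda>t. of_real (cos_neg t)) k * a k * dgs (\<lambda>t. of_real (cos_neg t)) k + Ds k * fc fneg k"

lemma star_dgs: "bdd01 (\<lambda>t. of_real (f t)) \<Longrightarrow> star (dgs (\<lambda>t. of_real (f t)) k) = dgs (\<lambda>t. of_real (f t)) k"
  unfolding dgs_def
  by (subst diag_op_star[symmetric], rule dgs_ell_infty[where G = "\<lambda>t. of_real (f t)"])
     (simp_all add: star_fun_def star_complex_def)

lemmas bdd_cut = lip_cut_functions[THEN lip_imp_bdd01]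

lemma t_star: "star (t1s k) = t1s k" "star (t2s k) = t2s k"
  by (simp_all add: t1s_def t2s_def star_add star_mult star_dgs bdd_cut a Ds star_fc fg_bounds fc_Ds mult.assoc)

lemma supp_dgs_sandwich:
  assumes "bdd01 (\<lambda>t. of_real (f t))" "(x, y) \<in> supp (dgs (\<lambda>t. of_real (f t)) k * T * dgs (\<lambda>t. of_real (f t)) k)"
  shows "(x, y) \<in> supp T" "f (h k x) \<noteq> 0" "f (h k y) \<noteq> 0"
  using assms(2) dgs_ell_infty[OF assms(1)]
  by (auto simp: supp_def dgs_def matrix_of_diag_mult matrix_of_mult_diag)

lemma cos_pos_nonzero: "cos_pos (h k x) \<noteq> 0 \<Longrightarrow> h k x < 1/2"
proof (rule ccontr)
  assume "cos_pos (h k x) \<noteq> 0" "\<not> h k x < 1/2"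
  moreover have "cos (pi * h k x) \<le> cos (pi * (1/2))" if "h k x \<ge> 1/2"
    by (rule cos_monotone_0_pi_le) (use that h[of k x] in \<open>auto simp: mult_left_le\<close>)
  ultimately show False by (simp add: cos_pos_def max_def split: if_splits)
qed

lemma cos_neg_nonzero: "cos_neg (h k x) \<noteq> 0 \<Longrightarrow> h k x > 1/2"
proof (rule ccontr)
  assume "cos_neg (h k x) \<noteq> 0" "\<not> h k x > 1/2"
  moreover have "cos (pi * (1/2)) \<le> cos (pi * h k x)" if "h k x \<le> 1/2"
    by (rule cos_monotone_0_pi_le) (use that h[of k x] in auto)
  ultimately show False by (simp add: cos_neg_def max_def split: if_splits)
qed

text \<open>The cosine parts confine the sandwiched terms to one side of the level 1/2, where
  \<open>left\<close> or \<open>right\<close> applies; the remaining terms lie in both relations at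
  once.\<close>

lemma supp_t: "supp (t1s k) \<subseteq> E1 k" "supp (t2s k) \<subseteq> E2 k"
proof -
  have "supp (dgs (\<lambda>t. of_real (cos_pos t)) k * a k * dgs (\<lambda>t. of_real (cos_pos t)) k) \<subseteq> E1 k"
  proof clarify
    fix x y assume "(x, y) \<in> supp (dgs (\<lambda>t. of_real (cos_pos t)) k * a k * dgs (\<lambda>t. of_real (cos_pos t)) k)"
    from supp_dgs_sandwich[OF bdd_cut(1) this] show "(x, y) \<in> E1 k"
      by (intro left cos_pos_nonzero)
  qed
  moreover have "supp (Ds k * fc g k) \<subseteq> E1 k \<inter> E2 k" if "\<And>m. \<bar>g m\<bar> \<le> 1" for g
    using closed_block_algebra(4)[OF equiv_Ek Ds(2) supp_fc[OF that]] by (simp add: Ek_def)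
  moreover have "supp (dgs (\<lambda>t. of_real (cos_neg t)) k * a k * dgs (\<lambda>t. of_real (cos_neg t)) k) \<subseteq> E2 k"
  proof clarify
    fix x y assume "(x, y) \<in> supp (dgs (\<lambda>t. of_real (cos_neg t)) k * a k * dgs (\<lambda>t. of_real (cos_neg t)) k)"
    from supp_dgs_sandwich[OF bdd_cut(2) this] show "(x, y) \<in> E2 k"
      by (intro right cos_neg_nonzero)
  qed
  ultimately show "supp (t1s k) \<subseteq> E1 k" "supp (t2s k) \<subseteq> E2 k"
    unfolding t1s_def t2s_def using fg_bounds
    by (intro closed_block_algebra(6)[OF E(1)] closed_block_algebra(6)[OF E(2)]; blast)+
qed

lemma Bseq_t: "Bseq t1s" "Bseq t2s"
  unfolding t1s_def[abs_def] t2s_def[abs_def]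
  by (intro Bseq_plus Bseq_times Bseq_dgs Bseq_a Bseq_Ds Bseq_fc bdd_cut fg_bounds)+

lemma germ_t:
  "germ t1s = dgr cos_pos * p * dgr cos_pos + p * dgr sin_sq * ep"
  "germ t2s = dgr cos_neg * p * dgr cos_neg + p * dgr sin_sq * em"
proof -
  have "germ t1s = dgr cos_pos * germ a * dgr cos_pos + germ Ds * ep"
    "germ t2s = dgr cos_neg * germ a * dgr cos_neg + germ Ds * em"
    unfolding t1s_def[abs_def] t2s_def[abs_def] dg_def
    by (simp_all add: germ_simps Bseq_intros Bseq_dgs Bseq_a Bseq_Ds Bseq_fc bdd_cut fg_bounds)
  then show "germ t1s = dgr cos_pos * p * dgr cos_pos + p * dgr sin_sq * ep"
    "germ t2s = dgr cos_neg * p * dgr cos_neg + p * dgr sin_sq * em"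
    by (simp_all only: germ_Ds germ_a)
qed

text \<open>The sum is \<open>p\<close> because \<open>cos_pos^2 + cos_neg^2 + sin_sq = 1\<close>
  and \<open>ep + em = 1\<close>. Only the product needs work: once it is 0, each half equals
  \<open>p\<close> times itself and therefore its own square.\<close>

lemma germ_t_props:
  "germ t1s + germ t2s = p" "germ t1s * germ t2s = 0" "germ t2s * germ t1s = 0"
  "germ t1s * germ t1s = germ t1s" "germ t2s * germ t2s = germ t2s"
proof -
  let ?cp = "dgr cos_pos" and ?cm = "dgr cos_neg" and ?d = "dgr sin_sq" and ?sp = "dgr sin_pos" and ?sm = "dgr sin_neg"
  note pc = p_comm[OF lip_cut_functions(1)] p_comm[OF lip_cut_functions(2)] p_comm[OF lip_cut_functions(3)]
    p_comm[OF lip_cut_functions(4)] p_comm[OF lip_cut_functions(5)]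
  have e1: "ep + em = 1"
    by (simp add: germ_simps Bseq_fc fg_bounds fc_sum)
  have z: "fc (\<lambda>_. 0) = (\<lambda>_. 0)"
    by (rule ext) (simp add: fc_def conj_diag_zero[OF diag_S(1,2)] flip: zero_fun_def)
  have e0: "ep * em = 0"
    by (simp add: germ_simps Bseq_fc fg_bounds)
       (subst fc_mult[where e = "\<lambda>_. 0"], auto simp: fg_bounds fpos_def fneg_def z germ_simps)
  have es: "star em = em" by (simp add: germ_simps Bseq_fc fg_bounds star_fc)
  have De: "p * ?d * ep = ep * (p * ?d)"
    unfolding germ_Ds[symmetric] by (simp add: germ_simps Bseq_fc Bseq_Ds fg_bounds fc_Ds)
  have cc: "?cp * ?cm = 0"
    unfolding dg_mult[OF bdd_cut(1,2)] by (simp add: cos_pos_neg dg_zero flip: of_real_mult)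
  have one: "?cp * ?cp + ?cm * ?cm + ?d = 1"
    unfolding dg_mult[OF bdd_cut(1,1)] dg_mult[OF bdd_cut(2,2)]
      dg_add[OF bdd01_mult[OF bdd_cut(1,1)] bdd01_mult[OF bdd_cut(2,2)]]
      dg_add[OF bdd01_add[OF bdd01_mult[OF bdd_cut(1,1)] bdd01_mult[OF bdd_cut(2,2)]] bdd_cut(5)]
      dg_one[symmetric]
    by (rule dg_cong) (simp only: cos_pos_neg of_real_1 flip: of_real_mult of_real_add)
  have ccd: "?cp * ?cp * ?d = (1/4) *\<^sub>R (?sp * ?sp)"
    unfolding dg_mult[OF bdd_cut(1,1)] dg_mult[OF bdd01_mult[OF bdd_cut(1,1)] bdd_cut(5)] dg_mult[OF bdd_cut(3,3)]
      dg_scaleR[OF bdd01_mult[OF bdd_cut(3,3)]]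
  proof (rule dg_cong)
    fix t :: real assume "t \<in> {0..1}"
    then show "complex_of_real (cos_pos t) * of_real (cos_pos t) * of_real (sin_sq t) =
        of_real (1/4) * (of_real (sin_pos t) * of_real (sin_pos t))"
      unfolding of_real_mult[symmetric] of_real_eq_iff using cos_pos_sin_sq[of t] by simp
  qed
  have ccd': "?d * (?cm * ?cm) = (1/4) *\<^sub>R (?sm * ?sm)"
    unfolding dg_mult[OF bdd_cut(2,2)] dg_mult[OF bdd_cut(5) bdd01_mult[OF bdd_cut(2,2)]] dg_mult[OF bdd_cut(4,4)]
      dg_scaleR[OF bdd01_mult[OF bdd_cut(4,4)]]
  proof (rule dg_cong)
    fix t :: real assume "t \<in> {0..1}"
    then show "complex_of_real (sin_sq t) * (of_real (cos_neg t) * of_real (cos_neg t)) =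
        of_real (1/4) * (of_real (sin_neg t) * of_real (sin_neg t))"
      unfolding of_real_mult[symmetric] of_real_eq_iff using cos_neg_sin_sq[of t] by (simp add: algebra_simps)
  qed
  have "star (em * ?sp * p) = 0" by (simp add: em_sin_pos)
  then have spm: "p * ?sp * em = 0"
    by (simp add: star_mult p_star es dg_star bdd_cut mult.assoc)
  have t1: "germ t1s = p * (?cp * ?cp) + p * ?d * ep"
    unfolding germ_t by (subst pc(1)[symmetric]) (simp only: mult.assoc)
  have t2: "germ t2s = p * (?cm * ?cm) + p * ?d * em"
    unfolding germ_t by (subst pc(2)[symmetric]) (simp only: mult.assoc)
  have "germ t1s + germ t2s = p * (?cp * ?cp) + p * (?cm * ?cm) + p * ?d * (ep + em)"
    unfolding t1 t2 by (simp add: distrib_left)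
  also have "\<dots> = p * (?cp * ?cp + ?cm * ?cm + ?d)" by (simp add: e1 distrib_left)
  finally show s: "germ t1s + germ t2s = p" by (simp add: one)
  have A: "?cp * p * ?cp * (?cm * p * ?cm) = 0"
  proof -
    have "?cp * p * ?cp * (?cm * p * ?cm) = ?cp * p * (?cp * ?cm) * p * ?cm" by (simp only: mult.assoc)
    then show ?thesis by (simp add: cc)
  qed
  \<comment> \<open>The weight \<open>cos_pos^2 * sin_sq\<close> is a quarter of
    \<open>sin_pos^2\<close>, and \<open>em\<close> annihilates \<open>sin_pos\<close> next to
    \<open>p\<close>.\<close>
  have B: "?cp * p * ?cp * (p * ?d * em) = 0"
  proof -
    have "?cp * p * ?cp * (p * ?d * em) = (p * ?cp) * (?cp * p) * ?d * em"
      unfolding pc(1) by (simp only: mult.assoc)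
    also have "(p * ?cp) * (?cp * p) = (p * p) * (?cp * ?cp)"
    proof -
      have "?cp * ?cp * p = p * (?cp * ?cp)" by (metis mult.assoc pc(1))
      then show ?thesis by (simp only: mult.assoc)
    qed
    also have "(p * p) * (?cp * ?cp) * ?d * em = (p * p) * (?cp * ?cp * ?d) * em"
      by (simp only: mult.assoc)
    also have "\<dots> = (1/4) *\<^sub>R (?sp * (p * ?sp * em))"
    proof -
      have "p * (?sp * ?sp) * em = (?sp * p) * ?sp * em" unfolding pc(3)[symmetric] by (simp only: mult.assoc)
      then show ?thesis unfolding ccd p_idem by (simp add: mult.assoc)
    qed
    finally show ?thesis by (simp add: spm)
  qed
  have C: "p * ?d * ep * (?cm * p * ?cm) = 0"
  proof -
    have "p * ?d * ep * (?cm * p * ?cm) = ep * (p * ?d * (?cm * p * ?cm))"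
      unfolding De by (simp only: mult.assoc)
    also have "p * ?d * (?cm * p * ?cm) = ?d * (?cm * ?cm) * p"
    proof -
      have "p * ?d * (?cm * p * ?cm) = ?d * ((p * ?cm) * (p * ?cm))" by (simp only: pc(5) mult.assoc)
      also have "(p * ?cm) * (p * ?cm) = ?cm * ?cm * p" by (metis mult.assoc pc(2) p_idem)
      finally show ?thesis by (simp only: mult.assoc)
    qed
    also have "ep * \<dots> = (1/4) *\<^sub>R (ep * ?sm * (?sm * p))" unfolding ccd' by (simp add: mult.assoc)
    also have "?sm * p = p * ?sm" by (simp only: pc(4))
    also have "ep * ?sm * (p * ?sm) = (ep * ?sm * p) * ?sm" by (simp only: mult.assoc)
    finally show ?thesis by (simp add: ep_sin_neg)
  qed
  \<comment> \<open>By \<open>De\<close>, \<open>ep\<close> commutes with \<open>p * ?d\<close> as a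
    whole, and so it meets \<open>em\<close>.\<close>
  have D: "p * ?d * ep * (p * ?d * em) = 0"
  proof -
    have "p * ?d * ep * (p * ?d * em) = p * ?d * (ep * (p * ?d)) * em" by (simp only: mult.assoc)
    also have "\<dots> = p * ?d * (p * ?d) * (ep * em)" unfolding De[symmetric] by (simp only: mult.assoc)
    finally show ?thesis by (simp add: e0)
  qed
  show t12: "germ t1s * germ t2s = 0"
    unfolding germ_t distrib_left distrib_right A B C D by simp
  have ts: "star (germ t1s) = germ t1s" "star (germ t2s) = germ t2s"
    by (simp_all add: germ_simps Bseq_t t_star)
  show t21: "germ t2s * germ t1s = 0"
    using arg_cong[OF t12, of star] by (simp add: star_mult ts)
  have p1: "p * germ t1s = germ t1s" "p * germ t2s = germ t2s"
    unfolding t1 t2 distrib_left by (simp_all add: p_idem flip: mult.assoc)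
  have "p * germ t1s = germ t1s * germ t1s" unfolding s[symmetric] by (simp add: distrib_right t21)
  then show "germ t1s * germ t1s = germ t1s" by (simp add: p1)
  have "p * germ t2s = germ t2s * germ t2s" unfolding s[symmetric] by (simp add: distrib_right t12)
  then show "germ t2s * germ t2s = germ t2s" by (simp add: p1)
qed

lemma cut_approx:
  assumes "\<epsilon> > 0"
  obtains k t1 t2 where "star t1 = t1" "star t2 = t2" "supp t1 \<subseteq> E1 k" "supp t2 \<subseteq> E2 k"
    "norm (P - (t1 + t2)) < \<epsilon>" "norm (t1 * t1 - t1) < \<epsilon>" "norm (t2 * t2 - t2) < \<epsilon>" "norm (t1 * t2) < \<epsilon>"
proof -
  have l: "(\<lambda>k. P - (t1s k + t2s k)) \<longlonglongrightarrow> 0" "(\<lambda>k. t1s k * t1s k - t1s k) \<longlonglongrightarrow> 0"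
    "(\<lambda>k. t2s k * t2s k - t2s k) \<longlonglongrightarrow> 0" "(\<lambda>k. t1s k * t2s k) \<longlonglongrightarrow> 0"
    using germ_t_props(1,2,4,5)
    by (simp_all add: germ_simps germ_eq_iff germ_zero_iff Bseq_intros Bseq_t eq_commute[of _ p])
  have "eventually (\<lambda>k. norm (P - (t1s k + t2s k)) < \<epsilon> \<and> norm (t1s k * t1s k - t1s k) < \<epsilon> \<and>
      norm (t2s k * t2s k - t2s k) < \<epsilon> \<and> norm (t1s k * t2s k) < \<epsilon>) sequentially"
    using tendstoD[OF l(1) assms] tendstoD[OF l(2) assms] tendstoD[OF l(3) assms] tendstoD[OF l(4) assms]
    by eventually_elim simp
  then obtain k where "norm (P - (t1s k + t2s k)) < \<epsilon>" "norm (t1s k * t1s k - t1s k) < \<epsilon>"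
      "norm (t2s k * t2s k - t2s k) < \<epsilon>" "norm (t1s k * t2s k) < \<epsilon>"
    unfolding eventually_sequentially by blast
  then show thesis by (rule that[OF t_star supp_t])
qed

end

section \<open>The uniform Roe algebra as a \<open>*\<close>-algebra\<close>

lemma algebraic_uniform_Roe_iff: "T \<in> algebraic_uniform_Roe \<longleftrightarrow> (\<exists>R. \<forall>(x, y)\<in>supp T. dist x y \<le> R)"
proof -
  have "\<exists>C. \<forall>x y. cmod (matrix_of T x y) \<le> C" using matrix_of_bound[of T] by blast
  then show ?thesis by (auto simp: algebraic_uniform_Roe_def uniform_Roe_matrices_def supp_def)
qed

lemma algebraic_uniform_Roe_closed:
  "S \<in> algebraic_uniform_Roe \<Longrightarrow> T \<in> algebraic_uniform_Roe \<Longrightarrow> S + T \<in> algebraic_uniform_Roe"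
  "S \<in> algebraic_uniform_Roe \<Longrightarrow> T \<in> algebraic_uniform_Roe \<Longrightarrow> S * T \<in> algebraic_uniform_Roe"
  "S \<in> algebraic_uniform_Roe \<Longrightarrow> star S \<in> algebraic_uniform_Roe"
  "S \<in> algebraic_uniform_Roe \<Longrightarrow> c *\<^sub>R S \<in> algebraic_uniform_Roe"
proof -
  assume "S \<in> algebraic_uniform_Roe"
  then obtain R where R: "(x, y) \<in> supp S \<Longrightarrow> dist x y \<le> R" for x y
    unfolding algebraic_uniform_Roe_iff by blast
  have "dist x y \<le> R" if "(x, y) \<in> supp (star S)" for x y
    using that R[of y x] by (simp add: supp_star dist_commute)
  then show "star S \<in> algebraic_uniform_Roe" unfolding algebraic_uniform_Roe_iff by blast
  show "c *\<^sub>R S \<in> algebraic_uniform_Roe"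
    unfolding algebraic_uniform_Roe_iff using R supp_scaleR[of c S] by (intro exI[of _ R]) auto
  assume "T \<in> algebraic_uniform_Roe"
  then obtain R' where R': "(x, y) \<in> supp T \<Longrightarrow> dist x y \<le> R'" for x y
    unfolding algebraic_uniform_Roe_iff by blast
  have "dist x y \<le> max R R'" if "(x, y) \<in> supp (S + T)" for x y
  proof -
    have "(x, y) \<in> supp S \<or> (x, y) \<in> supp T" using that supp_add[of S T] by blast
    then show ?thesis using R[of x y] R'[of x y] by auto
  qed
  then show "S + T \<in> algebraic_uniform_Roe" unfolding algebraic_uniform_Roe_iff by blast
  have "dist x y \<le> R + R'" if xy: "(x, y) \<in> supp (S * T)" for x y
  proof -
    obtain z where "(x, z) \<in> supp S" "(z, y) \<in> supp T" using xy supp_mult[of S T] by blast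
    then show ?thesis using R[of x z] R'[of z y] dist_triangle[of x y z] by linarith
  qed
  then show "S * T \<in> algebraic_uniform_Roe" unfolding algebraic_uniform_Roe_iff by blast
qed

lemma uniform_Roe_limit:
  "T \<in> uniform_Roe \<longleftrightarrow> (\<exists>X. (\<forall>n. X n \<in> algebraic_uniform_Roe) \<and> X \<longlonglongrightarrow> T)"
  by (simp add: uniform_Roe_def closure_sequential)

lemma uniform_Roe_closed:
  "S \<in> uniform_Roe \<Longrightarrow> T \<in> uniform_Roe \<Longrightarrow> S + T \<in> uniform_Roe"
  "S \<in> uniform_Roe \<Longrightarrow> T \<in> uniform_Roe \<Longrightarrow> S * T \<in> uniform_Roe"
  "S \<in> uniform_Roe \<Longrightarrow> star S \<in> uniform_Roe"
  "S \<in> uniform_Roe \<Longrightarrow> c *\<^sub>R S \<in> uniform_Roe"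
  "closed uniform_Roe"
proof -
  assume "S \<in> uniform_Roe"
  then obtain X where X: "\<And>n. X n \<in> algebraic_uniform_Roe" "X \<longlonglongrightarrow> S" by (auto simp: uniform_Roe_limit)
  show "star S \<in> uniform_Roe"
    unfolding uniform_Roe_limit
    by (rule exI[of _ "\<lambda>n. star (X n)"])
       (simp add: X algebraic_uniform_Roe_closed bounded_linear.tendsto[OF bounded_linear_star])
  show "c *\<^sub>R S \<in> uniform_Roe"
    unfolding uniform_Roe_limit
    by (rule exI[of _ "\<lambda>n. c *\<^sub>R X n"]) (simp add: X algebraic_uniform_Roe_closed tendsto_scaleR)
  assume "T \<in> uniform_Roe"
  then obtain Y where Y: "\<And>n. Y n \<in> algebraic_uniform_Roe" "Y \<longlonglongrightarrow> T" by (auto simp: uniform_Roe_limit)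
  show "S + T \<in> uniform_Roe"
    unfolding uniform_Roe_limit
    by (rule exI[of _ "\<lambda>n. X n + Y n"]) (simp add: X Y algebraic_uniform_Roe_closed tendsto_add)
  show "S * T \<in> uniform_Roe"
    unfolding uniform_Roe_limit
    by (rule exI[of _ "\<lambda>n. X n * Y n"]) (simp add: X Y algebraic_uniform_Roe_closed tendsto_mult)
qed (simp add: uniform_Roe_def)

lemma uniform_Roe_zero_one: "0 \<in> uniform_Roe" "1 \<in> uniform_Roe"
  using diag_op_in_uniform_Roe[of 0] diag_op_in_uniform_Roe[of 1]
  by (simp_all add: diag_op_zero diag_op_one)

lemma uniform_Roe_sum: "(\<And>i. i \<in> I \<Longrightarrow> f i \<in> uniform_Roe) \<Longrightarrow> sum f I \<in> uniform_Roe"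
  by (induction I rule: infinite_finite_induct) (auto simp: uniform_Roe_zero_one uniform_Roe_closed)

section \<open>Matrices of operators as operators\<close>

text \<open>Functions of a point and a level carry matrices of all sizes within one type: the entry
  (i, j) acts from level j to level i, and size n means that only levels below n are used.
  \<open>inc i\<close> and \<open>slice i\<close> are adjoint to each other.\<close>

lift_definition inc :: "nat \<Rightarrow> 'x ell2 \<Rightarrow> ('x \<times> nat) ell2" is "\<lambda>i u p. if snd p = i then u (fst p) else 0"
proof -
  fix i and u :: "'x \<Rightarrow> complex"
  assume "(\<lambda>x. (cmod (u x))\<^sup>2) summable_on UNIV"
  then have "((\<lambda>p. (cmod (u (fst p)))\<^sup>2) \<circ> (\<lambda>x. (x, i))) summable_on UNIV" by (simp add: o_def)
  then have "(\<lambda>p. (cmod (u (fst p)))\<^sup>2) summable_on range (\<lambda>x. (x, i))"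
    by (subst summable_on_reindex) (auto simp: inj_on_def)
  then show "(\<lambda>p. (cmod (if snd p = i then u (fst p) else 0))\<^sup>2) summable_on UNIV"
    by (rule summable_on_cong_neutral[THEN iffD1, rotated -1]) (auto split: if_splits)
qed

lift_definition slice :: "nat \<Rightarrow> ('x \<times> nat) ell2 \<Rightarrow> 'x ell2" is "\<lambda>i u x. u (x, i)"
proof -
  fix i and u :: "'x \<times> nat \<Rightarrow> complex"
  assume "(\<lambda>p. (cmod (u p))\<^sup>2) summable_on UNIV"
  then have "(\<lambda>p. (cmod (u p))\<^sup>2) summable_on range (\<lambda>x. (x, i))"
    by (rule summable_on_subset_banach) simp
  then have "((\<lambda>p. (cmod (u p))\<^sup>2) \<circ> (\<lambda>x. (x, i))) summable_on UNIV"
    by (subst (asm) summable_on_reindex) (auto simp: inj_on_def)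
  then show "(\<lambda>x. (cmod (u (x, i)))\<^sup>2) summable_on UNIV" by (simp add: o_def)
qed

lemmas level_apply = inc.rep_eq slice.rep_eq

lemma inc_linear: "inc i (u + v) = inc i u + inc i v" "inc i (cscale c u) = cscale c (inc i u)"
  "inc i (u - v) = inc i u - inc i v"
  by (rule ell2_eqI; simp add: level_apply ell2_simps)+

lemma slice_linear: "slice i (u + v) = slice i u + slice i v" "slice i (cscale c u) = cscale c (slice i u)"
  "slice i (sum f A) = (\<Sum>a\<in>A. slice i (f a))"
  by (rule ell2_eqI; simp add: level_apply ell2_simps ell2_apply_sum)+

lemma norm_inc: "norm (inc i u) = norm u"
proof -
  have "(norm (inc i u))\<^sup>2 = (\<Sum>\<^sub>\<infinity>p\<in>range (\<lambda>x. (x, i)). (cmod (ell2_apply u (fst p)))\<^sup>2)"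
    unfolding norm_ell2_sq level_apply by (rule infsum_cong_neutral) (auto split: if_splits)
  also have "\<dots> = (norm u)\<^sup>2"
    unfolding norm_ell2_sq by (subst infsum_reindex) (auto simp: inj_on_def o_def)
  finally show ?thesis by (simp add: power2_eq_iff_nonneg)
qed

lemma cinner_inc: "cinner (inc i u) v = cinner u (slice i v)"
proof -
  have "cinner (inc i u) v = (\<Sum>\<^sub>\<infinity>p\<in>range (\<lambda>x. (x, i)). cnj (ell2_apply u (fst p)) * ell2_apply v p)"
    unfolding cinner_def level_apply by (rule infsum_cong_neutral) (auto split: if_splits)
  also have "\<dots> = cinner u (slice i v)"
    unfolding cinner_def level_apply by (subst infsum_reindex) (auto simp: inj_on_def o_def)
  finally show ?thesis .
qed

lemma norm_slice: "norm (slice i v) \<le> norm v"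
proof -
  have "(norm (slice i v))\<^sup>2 = cmod (cinner (inc i (slice i v)) v)"
    by (simp add: cinner_inc cinner_self norm_power)
  also have "\<dots> \<le> norm (slice i v) * norm v"
    using cinner_bound[of "inc i (slice i v)" v] by (simp add: norm_inc)
  finally show ?thesis
    by (cases "norm (slice i v) = 0") (auto simp: power2_eq_square)
qed

definition amp :: "nat \<Rightarrow> nat \<Rightarrow> 'x bop \<Rightarrow> ('x \<times> nat) bop" where
  "amp i j S = bop_of (\<lambda>u. inc i (bop_apply S (slice j u)))"

definition entry :: "nat \<Rightarrow> nat \<Rightarrow> ('x \<times> nat) bop \<Rightarrow> 'x bop" where
  "entry i j T = bop_of (\<lambda>u. slice i (bop_apply T (inc j u)))"

lemma amp_apply: "bop_apply (amp i j S) u = inc i (bop_apply S (slice j u))"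
  unfolding amp_def
proof (rule bop_of)
  show "norm (inc i (bop_apply S (slice j u))) \<le> norm S * norm u" for u
    unfolding norm_inc by (rule order_trans[OF norm_bop_apply mult_left_mono[OF norm_slice]]) simp
qed (simp_all add: inc_linear slice_linear blinfun.add_right bop_apply_cscale)

lemma entry_apply: "bop_apply (entry i j T) u = slice i (bop_apply T (inc j u))"
  unfolding entry_def
proof (rule bop_of)
  show "norm (slice i (bop_apply T (inc j u))) \<le> norm T * norm u" for u
    by (rule order_trans[OF norm_slice]) (use norm_bop_apply[of T "inc j u"] in \<open>simp add: norm_inc\<close>)
qed (simp_all add: inc_linear slice_linear blinfun.add_right bop_apply_cscale)

lemma norm_amp: "norm (amp i j S) \<le> norm S"
  by (rule norm_bop_le)
     (auto simp: amp_apply norm_inc intro!: order_trans[OF norm_bop_apply mult_left_mono[OF norm_slice]])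

lemma entry_linear: "entry i j (S + T) = entry i j S + entry i j T" "entry i j (r *\<^sub>R S) = r *\<^sub>R entry i j S"
  "entry i j (S - T) = entry i j S - entry i j T"
  using entry_apply
  by (auto intro!: bop_eqI ell2_eqI simp: bop_apply_simps entry_apply level_apply ell2_simps ell2_apply_scaleR)

lemma bounded_linear_entry: "bounded_linear (entry i j)"
proof (rule bounded_linear_intro[where K = 1])
  show "norm (entry i j T) \<le> norm T * 1" for T :: "('a \<times> nat) bop"
  proof (rule norm_bop_le)
    show "norm (bop_apply (entry i j T) u) \<le> norm T * 1 * norm u" for u
      unfolding entry_apply using order_trans[OF norm_slice norm_bop_apply[of T "inc j u"]] by (simp add: norm_inc)
  qed simp
qed (simp_all add: entry_linear)

lemma matrix_of_entry: "matrix_of (entry i j T) x y = matrix_of T (x, i) (y, j)"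
proof -
  have "inc j (ket y) = ket (y, j)" by (rule ell2_eqI) (auto simp: level_apply ell2_simps)
  then show ?thesis by (simp add: matrix_of_def entry_apply level_apply)
qed

lemma matrix_of_amp: "matrix_of (amp i j S) (x, k) (y, l) = (if k = i \<and> l = j then matrix_of S x y else 0)"
proof -
  have "slice j (ket (y, l)) = (if l = j then ket y else 0)"
    by (rule ell2_eqI) (auto simp: level_apply ell2_simps)
  then show ?thesis by (simp add: matrix_of_def amp_apply level_apply ell2_simps)
qed

lemma entry_star: "entry i j (star T) = star (entry j i T)"
  by (rule matrix_of_eqI) (simp add: matrix_of_entry matrix_of_star)

lemma entry_amp: "entry i j (amp k l S) = (if i = k \<and> j = l then S else 0)"
  by (rule matrix_of_eqI) (simp add: matrix_of_entry matrix_of_amp matrix_of_simps)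

lemma entry_sum: "entry i j (sum f A) = (\<Sum>a\<in>A. entry i j (f a))"
  by (rule bounded_linear.linear[OF bounded_linear_entry, THEN linear_sum])

section \<open>Matrices of a given size as a corner\<close>

definition level_proj :: "nat \<Rightarrow> ('x \<times> nat) bop" where
  "level_proj n = diag_op (\<lambda>p. if snd p < n then 1 else 0)"

lemma level_ell_infty: "(\<lambda>p :: 'x \<times> nat. if snd p < n then 1 else 0) \<in> ell_infty"
  by (rule ell_inftyI[where C = 1]) simp

lemma matrix_of_level:
  "matrix_of (level_proj n * T) p q = (if snd p < n then matrix_of T p q else 0)"
  "matrix_of (T * level_proj n) p q = (if snd q < n then matrix_of T p q else 0)"
  by (simp_all add: level_proj_def matrix_of_diag_mult[OF level_ell_infty] matrix_of_mult_diag[OF level_ell_infty])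

lemma star_level_proj: "star (level_proj n) = level_proj n"
  unfolding level_proj_def diag_op_star[OF level_ell_infty, symmetric]
  by (rule arg_cong[where f = diag_op]) (auto simp: star_fun_def star_complex_def)

lemma level_proj_mult: "level_proj m * level_proj n = level_proj (min m n)"
  unfolding level_proj_def diag_op_mult[OF level_ell_infty level_ell_infty, symmetric]
  by (rule arg_cong[where f = diag_op]) (auto simp: times_fun_def)

lemma level_left_iff: "level_proj n * T = T \<longleftrightarrow> (\<forall>p q. matrix_of T p q \<noteq> 0 \<longrightarrow> snd p < n)"
proof
  assume "level_proj n * T = T"
  then show "\<forall>p q. matrix_of T p q \<noteq> 0 \<longrightarrow> snd p < n" by (metis matrix_of_level(1))
next
  assume *: "\<forall>p q. matrix_of T p q \<noteq> 0 \<longrightarrow> snd p < n"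
  show "level_proj n * T = T"
  proof (rule matrix_of_eqI)
    show "matrix_of (level_proj n * T) p q = matrix_of T p q" for p q
      unfolding matrix_of_level using *[rule_format, of p q] by (cases "matrix_of T p q = 0") simp_all
  qed
qed

lemma level_right_iff: "T * level_proj n = T \<longleftrightarrow> (\<forall>p q. matrix_of T p q \<noteq> 0 \<longrightarrow> snd q < n)"
proof
  assume "T * level_proj n = T"
  then show "\<forall>p q. matrix_of T p q \<noteq> 0 \<longrightarrow> snd q < n" by (metis matrix_of_level(2))
next
  assume *: "\<forall>p q. matrix_of T p q \<noteq> 0 \<longrightarrow> snd q < n"
  show "T * level_proj n = T"
  proof (rule matrix_of_eqI)
    show "matrix_of (T * level_proj n) p q = matrix_of T p q" for p q
      unfolding matrix_of_level using *[rule_format, of p q] by (cases "matrix_of T p q = 0") simp_all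
  qed
qed

lemma level_proj_apply: "bop_apply (level_proj n) v = (\<Sum>k<n. inc k (slice k v))"
  by (rule ell2_eqI)
     (auto simp: level_proj_def diag_op_apply[OF level_ell_infty] ell2_apply_sum level_apply)

text \<open>The rule for matrix products; the hypothesis on \<open>T\<close> cuts the sum over all
  levels down to the first \<open>n\<close>.\<close>

lemma entry_mult:
  assumes "level_proj n * T = T"
  shows "entry i j (S * T) = (\<Sum>k<n. entry i k S * entry k j T)"
proof (rule bop_eqI)
  fix u
  have "bop_apply (S * T) (inc j u) = bop_apply S (bop_apply (level_proj n) (bop_apply T (inc j u)))"
    by (metis assms bop_apply_simps(4))
  also have "\<dots> = (\<Sum>k<n. bop_apply S (inc k (slice k (bop_apply T (inc j u)))))"
    unfolding level_proj_apply by (rule blinfun.sum_right)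
  finally have "bop_apply (entry i j (S * T)) u = (\<Sum>k<n. bop_apply (entry i k S * entry k j T) u)"
    by (simp add: entry_apply slice_linear bop_apply_simps)
  also have "\<dots> = bop_apply (\<Sum>k<n. entry i k S * entry k j T) u"
    by (induction n) (simp_all add: bop_apply_simps)
  finally show "bop_apply (entry i j (S * T)) u = bop_apply (\<Sum>k<n. entry i k S * entry k j T) u" .
qed

lemma level_eqI:
  assumes "level_proj n * S = S" "S * level_proj m = S" "level_proj n * T = T" "T * level_proj m = T"
    and "\<And>i j. i < n \<Longrightarrow> j < m \<Longrightarrow> entry i j S = entry i j T"
  shows "S = T"
proof (rule matrix_of_eqI)
  fix p q :: "'a \<times> nat"
  show "matrix_of S p q = matrix_of T p q"
  proof (cases "snd p < n \<and> snd q < m")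
    case True
    then have "matrix_of (entry (snd p) (snd q) S) (fst p) (fst q) = matrix_of (entry (snd p) (snd q) T) (fst p) (fst q)"
      using assms(5) by simp
    then show ?thesis by (simp add: matrix_of_entry)
  next
    case False
    then show ?thesis using assms(1-4) unfolding level_left_iff level_right_iff by metis
  qed
qed

text \<open>The n by n matrices over the uniform Roe algebra. The unit of this corner is
  \<open>level_proj n\<close> and not 1, whence the care about units in
  \<open>mult_inv_sqrt_closed\<close>.\<close>

definition Roe_levels :: "nat \<Rightarrow> ('x::metric_space \<times> nat) bop set" where
  "Roe_levels n = {T. level_proj n * T = T \<and> T * level_proj n = T \<and> (\<forall>i<n. \<forall>j<n. entry i j T \<in> uniform_Roe)}"

lemma Roe_levels_mono: "m \<le> n \<Longrightarrow> T \<in> Roe_levels m \<Longrightarrow> T \<in> Roe_levels n"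
proof -
  assume mn: "m \<le> n" and T: "T \<in> Roe_levels m"
  then have l: "snd p < m \<and> snd q < m" if "matrix_of T p q \<noteq> 0" for p q
    using that unfolding Roe_levels_def level_left_iff level_right_iff by blast
  have "entry i j T \<in> uniform_Roe" for i j
  proof (cases "i < m \<and> j < m")
    case False
    have "entry i j T = 0"
    proof (rule matrix_of_eqI)
      show "matrix_of (entry i j T) x y = matrix_of 0 x y" for x y
        using l[of "(x, i)" "(y, j)"] False by (auto simp: matrix_of_entry matrix_of_simps)
    qed
    then show ?thesis by (simp add: uniform_Roe_zero_one)
  qed (use T in \<open>auto simp: Roe_levels_def\<close>)
  moreover have "snd p < n \<and> snd q < n" if "matrix_of T p q \<noteq> 0" for p q
    using l[OF that] mn by linarith
  ultimately show ?thesis unfolding Roe_levels_def level_left_iff level_right_iff by blast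
qed

lemma Roe_levels_algebra:
  fixes S T :: "('x::metric_space \<times> nat) bop"
  shows "closed (Roe_levels n :: ('x \<times> nat) bop set)" "real_vector.subspace (Roe_levels n :: ('x \<times> nat) bop set)"
  "S \<in> Roe_levels n \<Longrightarrow> T \<in> Roe_levels n \<Longrightarrow> S * T \<in> Roe_levels n"
  "S \<in> Roe_levels n \<Longrightarrow> star S \<in> Roe_levels n"
proof -
  have eq: "(Roe_levels n :: ('x \<times> nat) bop set) = {T. level_proj n * T = T} \<inter> {T. T * level_proj n = T} \<inter>
      (\<Inter>i\<in>{..<n}. \<Inter>j\<in>{..<n}. entry i j -` uniform_Roe)"
    by (auto simp: Roe_levels_def)
  have "closed {T :: ('x \<times> nat) bop. level_proj n * T = T}" "closed {T :: ('x \<times> nat) bop. T * level_proj n = T}"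
    by (intro closed_Collect_eq continuous_intros)+
  moreover have "closed (entry i j -` (uniform_Roe :: 'x bop set))" for i j
    using closed_vimage[OF uniform_Roe_closed(5), of "entry i j"]
      linear_continuous_on[OF bounded_linear_entry, of UNIV i j] by blast
  ultimately show "closed (Roe_levels n :: ('x \<times> nat) bop set)"
    unfolding eq by (intro closed_Int closed_INT) auto
  show "real_vector.subspace (Roe_levels n :: ('x \<times> nat) bop set)"
  proof (rule real_vector.subspaceI)
    have "entry i j 0 = (0 :: 'x bop)" for i j by (rule matrix_of_eqI) (simp add: matrix_of_entry matrix_of_simps)
    then show "(0 :: ('x \<times> nat) bop) \<in> Roe_levels n" by (simp add: Roe_levels_def uniform_Roe_zero_one)
  qed (auto simp: Roe_levels_def distrib_left distrib_right entry_linear uniform_Roe_closed)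
  show "S * T \<in> Roe_levels n" if "S \<in> Roe_levels n" "T \<in> Roe_levels n"
  proof -
    have "level_proj n * S * T = S * T" "S * (T * level_proj n) = S * T"
      using that by (auto simp: Roe_levels_def)
    moreover have "level_proj n * T = T" using that by (auto simp: Roe_levels_def)
    ultimately show ?thesis using that
      by (auto simp: Roe_levels_def mult.assoc entry_mult[of n T] intro!: uniform_Roe_sum uniform_Roe_closed)
  qed
  show "star S \<in> Roe_levels n" if "S \<in> Roe_levels n"
  proof -
    have "star (S * level_proj n) = star S" "star (level_proj n * S) = star S"
      using that by (auto simp: Roe_levels_def)
    then show ?thesis using that
      by (auto simp: Roe_levels_def star_mult star_level_proj entry_star uniform_Roe_closed)
  qed
qed

definition to_op :: "'x bop mat \<Rightarrow> ('x \<times> nat) bop" where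
  "to_op V = (\<Sum>i<dim_row V. \<Sum>j<dim_col V. amp i j (V $$ (i, j)))"

definition to_mat :: "nat \<Rightarrow> nat \<Rightarrow> ('x \<times> nat) bop \<Rightarrow> 'x bop mat" where
  "to_mat n m T = mat n m (\<lambda>(i, j). entry i j T)"

lemma level_to_op: "level_proj (dim_row V) * to_op V = to_op V" "to_op V * level_proj (dim_col V) = to_op V"
  unfolding to_op_def sum_distrib_left sum_distrib_right
  by (intro sum.cong refl matrix_of_eqI; auto simp: matrix_of_level matrix_of_amp)+

lemma entry_to_op: "i < dim_row V \<Longrightarrow> j < dim_col V \<Longrightarrow> entry i j (to_op V) = V $$ (i, j)"
proof -
  assume ij: "i < dim_row V" "j < dim_col V"
  have "entry i j (to_op V)
      = (\<Sum>k<dim_row V. \<Sum>l<dim_col V. if i = k \<and> j = l then V $$ (k, l) else 0)"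
    unfolding to_op_def entry_sum entry_amp ..
  also have "\<dots> = (\<Sum>k<dim_row V. if i = k then V $$ (k, j) else 0)"
    using ij by (intro sum.cong refl) (auto intro: sum.delta')
  also have "\<dots> = V $$ (i, j)" using ij by simp
  finally show ?thesis .
qed

lemma to_mat_to_op: "V \<in> carrier_mat n m \<Longrightarrow> to_mat n m (to_op V) = V"
  by (rule eq_matI) (auto simp: to_mat_def entry_to_op)

lemma to_mat_mult:
  assumes "level_proj m * T = T"
  shows "to_mat n k (S * T) = to_mat n m S * to_mat m k T"
  by (rule eq_matI) (auto simp: to_mat_def entry_mult[OF assms] scalar_prod_def lessThan_atLeast0)

lemma to_mat_star: "mat_star (to_mat n m T) = to_mat m n (star T)"
  by (rule eq_matI) (auto simp: to_mat_def mat_star_def entry_star)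

lemma elements_to_mat: "T \<in> Roe_levels N \<Longrightarrow> n \<le> N \<Longrightarrow> m \<le> N \<Longrightarrow> elements_mat (to_mat n m T) \<subseteq> uniform_Roe"
  by (auto simp: to_mat_def Roe_levels_def elements_mat_def)

text \<open>The eigenvalues of an almost idempotent \<open>t\<close> are close to 0 or 1, and
  rounding them at 1/2 moves each by at most twice its defect from idempotence. The last two
  conclusions confine the projection to the levels where \<open>t\<close> lives.\<close>

lemma quasi_projection_diag:
  fixes t :: "'y bop"
  assumes E: "equiv UNIV E" "locally_finite_rel N E" and t: "star t = t" "supp t \<subseteq> E" and q: "norm (t * t - t) \<le> \<epsilon>"
  obtains W X where "star W * W = 1" "W * star W = 1" "supp W \<subseteq> E"
    "norm (conj_diag W (\<lambda>x. if x \<in> X then 1 else 0) - t) \<le> 2 * \<epsilon>"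
    "\<And>Q. Q * t = t \<Longrightarrow> Q * conj_diag W (\<lambda>x. if x \<in> X then 1 else 0) = conj_diag W (\<lambda>x. if x \<in> X then 1 else 0)"
    "\<And>Q. t * Q = t \<Longrightarrow> conj_diag W (\<lambda>x. if x \<in> X then 1 else 0) * Q = conj_diag W (\<lambda>x. if x \<in> X then 1 else 0)"
proof -
  obtain W \<mu> where W: "star W * W = 1" "W * star W = 1" "supp W \<subseteq> E"
    and T: "t = W * diag_op (\<lambda>x. of_real (\<mu> x)) * star W" and \<mu>: "\<And>x. \<bar>\<mu> x\<bar> \<le> norm t"
    by (rule self_adjoint_block_diag[OF E t]) blast
  have t_eq: "t = conj_diag W (\<lambda>x. of_real (\<mu> x))" unfolding conj_diag_def by (rule T)
  have m: "(\<lambda>x. complex_of_real (\<mu> x)) \<in> ell_infty" by (rule ell_inftyI[where C = "norm t"]) (simp add: \<mu>)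
  have m2: "(\<lambda>x. complex_of_real (\<mu> x)) * (\<lambda>x. of_real (\<mu> x)) + - (\<lambda>x. of_real (\<mu> x)) \<in> ell_infty"
    by (intro ell_infty_closed m)
  have mm: "(\<lambda>x. complex_of_real (\<mu> x)) * (\<lambda>x. of_real (\<mu> x)) + - (\<lambda>x. of_real (\<mu> x))
      = (\<lambda>x. of_real (\<mu> x * \<mu> x - \<mu> x))" by (simp add: fun_eq_iff)
  have neg: "- conj_diag W f = conj_diag W (- f)" if "f \<in> ell_infty" for f
  proof -
    have "conj_diag W f + conj_diag W (- f) = 0"
      using conj_diag_add[OF W(1,2) that ell_infty_closed(3)[OF that]] by (simp add: conj_diag_zero[OF W(1,2)])
    then show ?thesis by (rule minus_unique)
  qed
  have "t * t - t = conj_diag W ((\<lambda>x. of_real (\<mu> x)) * (\<lambda>x. of_real (\<mu> x))) + conj_diag W (- (\<lambda>x. of_real (\<mu> x)))"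
    by (simp only: t_eq conj_diag_mult[OF W(1,2) m m] diff_conv_add_uminus neg[OF m])
  also have "\<dots> = conj_diag W (\<lambda>x. of_real (\<mu> x * \<mu> x - \<mu> x))"
    unfolding mm[symmetric] by (rule conj_diag_add[OF W(1,2)]) (intro ell_infty_closed m)+
  finally have "t * t - t = conj_diag W (\<lambda>x. of_real (\<mu> x * \<mu> x - \<mu> x))" .
  then have "star W * (t * t - t) * W = (star W * W) * diag_op (\<lambda>x. of_real (\<mu> x * \<mu> x - \<mu> x)) * (star W * W)"
    by (simp only: conj_diag_def mult.assoc)
  then have d: "star W * (t * t - t) * W = diag_op (\<lambda>x. of_real (\<mu> x * \<mu> x - \<mu> x))" by (simp add: W)
  have nW: "norm W \<le> 1" by (rule norm_isometry[OF W(1)])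
  have bd: "\<bar>\<mu> x * \<mu> x - \<mu> x\<bar> \<le> \<epsilon>" for x
  proof -
    have "\<bar>\<mu> x * \<mu> x - \<mu> x\<bar> = cmod (matrix_of (star W * (t * t - t) * W) x x)"
      unfolding d matrix_of_diag_op[OF m2[unfolded mm]] by (simp flip: of_real_mult of_real_diff)
    also have "\<dots> \<le> norm (star W) * norm (t * t - t) * norm W"
      by (intro order_trans[OF matrix_of_bound] order_trans[OF norm_mult_ineq] mult_right_mono norm_mult_ineq) simp
    also have "\<dots> \<le> 1 * \<epsilon> * 1" using nW q order_trans[OF norm_ge_zero q] by (intro mult_mono) auto
    finally show ?thesis by simp
  qed
  define X where "X = {x. \<mu> x \<ge> 1/2}"
  define i where "i = (\<lambda>x. if x \<in> X then 1 else 0 :: complex)"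
  have i: "i \<in> ell_infty" by (rule ell_inftyI[where C = 1]) (simp add: i_def)
  \<comment> \<open>\<open>1 / \<mu>\<close> is bounded by 2 on \<open>X\<close> and writes the
    projection as \<open>t\<close> times a bounded operator, on either side; so whatever fixes
    \<open>t\<close> fixes the projection.\<close>
  define g where "g = (\<lambda>x. complex_of_real (if x \<in> X then 1 / \<mu> x else 0))"
  have g: "g \<in> ell_infty"
    by (rule ell_inftyI[where C = 2]) (auto simp: g_def X_def divide_simps simp flip: of_real_divide)
  have "(\<lambda>x. of_real (\<mu> x)) * g = i" "g * (\<lambda>x. of_real (\<mu> x)) = i"
    by (auto simp: fun_eq_iff g_def i_def X_def)
  then have e: "t * conj_diag W g = conj_diag W i" "conj_diag W g * t = conj_diag W i"
    unfolding t_eq using conj_diag_mult[OF W(1,2) m g] conj_diag_mult[OF W(1,2) g m] by simp_all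
  have "conj_diag W i - t = conj_diag W (\<lambda>x. of_real ((if x \<in> X then 1 else 0) - \<mu> x))"
  proof -
    have "conj_diag W i - t = conj_diag W (i + - (\<lambda>x. of_real (\<mu> x)))"
      unfolding t_eq diff_conv_add_uminus neg[OF m] by (rule conj_diag_add[OF W(1,2) i ell_infty_closed(3)[OF m]])
    also have "i + - (\<lambda>x. of_real (\<mu> x)) = (\<lambda>x. of_real ((if x \<in> X then 1 else 0) - \<mu> x))"
      by (auto simp: fun_eq_iff i_def)
    finally show ?thesis .
  qed
  also have "norm \<dots> \<le> 2 * \<epsilon>"
  proof (rule norm_conj_diag[OF W(1,2)])
    have "\<bar>(if x \<in> X then 1 else 0) - \<mu> x\<bar> \<le> 2 * \<bar>\<mu> x * \<mu> x - \<mu> x\<bar>" for x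
    proof -
      have f: "\<mu> x * \<mu> x - \<mu> x = \<mu> x * (\<mu> x - 1)" by (simp add: algebra_simps)
      show ?thesis
      proof (cases "x \<in> X")
        case True
        then have "1 * \<bar>\<mu> x - 1\<bar> \<le> (2 * \<bar>\<mu> x\<bar>) * \<bar>\<mu> x - 1\<bar>" by (intro mult_right_mono) (auto simp: X_def)
        then show ?thesis using True by (simp add: f abs_mult abs_minus_commute)
      next
        case False
        then have "\<bar>\<mu> x\<bar> * 1 \<le> \<bar>\<mu> x\<bar> * (2 * \<bar>\<mu> x - 1\<bar>)" by (intro mult_left_mono) (auto simp: X_def)
        then show ?thesis using False by (simp add: f abs_mult)
      qed
    qed
    then show "cmod (of_real ((if x \<in> X then 1 else 0) - \<mu> x)) \<le> 2 * \<epsilon>" for x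
      unfolding norm_of_real real_norm_def using bd[of x] order_trans[OF _ mult_left_mono[of _ _ "2::real"]] by (meson zero_le_numeral)
    show "0 \<le> 2 * \<epsilon>" using order_trans[OF norm_ge_zero q] by simp
  qed
  finally have n: "norm (conj_diag W i - t) \<le> 2 * \<epsilon>" .
  show thesis
  proof (rule that[OF W, of X, folded i_def])
    show "Q * conj_diag W i = conj_diag W i" if "Q * t = t" for Q
      using that by (metis e(1) mult.assoc)
    show "conj_diag W i * Q = conj_diag W i" if "t * Q = t" for Q
      using that by (metis e(2) mult.assoc)
  qed (rule n)
qed

section \<open>Controlled relations on levels\<close>

text \<open>Points on levels \<open>n\<close> and above are related to themselves only, so that an
  equivalence on the whole space describes blocks of n by n matrices.\<close>

definition ctrl_rel :: "nat \<Rightarrow> (('x::metric_space \<times> nat) \<times> ('x \<times> nat)) set \<Rightarrow> bool" where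
  "ctrl_rel n E \<longleftrightarrow> equiv UNIV E \<and> (\<exists>N. locally_finite_rel N E) \<and>
     (\<exists>D. \<forall>p q. (p, q) \<in> E \<longrightarrow> dist (fst p) (fst q) \<le> D \<and> (p = q \<or> snd p < n \<and> snd q < n))"

lemma locally_finite_bounded:
  fixes E :: "(('x::metric_space \<times> nat) \<times> ('x \<times> nat)) set"
  assumes "bounded_geometry TYPE('x)"
    and E: "\<And>p q. (p, q) \<in> E \<Longrightarrow> p = q \<or> dist (fst p) (fst q) \<le> D \<and> snd p < n \<and> snd q < n"
  shows "\<exists>N. locally_finite_rel N E"
proof -
  \<comment> \<open>Bounded geometry counts points of open balls of positive radius, whereas
    \<open>D\<close> is a weak bound and may be negative.\<close>
  have "max D 0 + 1 > 0" by simp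
  then obtain M where M: "\<And>x :: 'x. finite (ball x (max D 0 + 1)) \<and> card (ball x (max D 0 + 1)) \<le> M"
    using assms(1) unfolding bounded_geometry_def by blast
  define B where "B p = insert p (ball (fst p) (max D 0 + 1) \<times> {..<n})" for p :: "'x \<times> nat"
  have B: "finite (B p)" "card (B p) \<le> Suc (M * n)" for p
  proof -
    show "finite (B p)" using M by (simp add: B_def)
    have "card (B p) \<le> Suc (card (ball (fst p) (max D 0 + 1) \<times> {..<n}))"
      unfolding B_def by (rule card_insert_le_m1) auto
    also have "\<dots> \<le> Suc (M * n)" using M[of "fst p"] by (simp add: card_cartesian_product)
    finally show "card (B p) \<le> Suc (M * n)" .
  qed
  have "E `` {p} \<subseteq> B p" "E\<inverse> `` {p} \<subseteq> B p" for p
    using E by (force simp: B_def dist_commute)+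
  then have "locally_finite_rel (Suc (M * n)) E"
    unfolding locally_finite_rel_def using B by (meson card_mono finite_subset order_trans)
  then show ?thesis by blast
qed

definition level_rel :: "nat \<Rightarrow> ('x \<times> 'x) set \<Rightarrow> (('x \<times> nat) \<times> ('x \<times> nat)) set" where
  "level_rel n E = {(p, q). p = q \<or> (fst p, fst q) \<in> E \<and> snd p < n \<and> snd q < n}"

lemma ctrl_level_rel:
  fixes E :: "('x::metric_space \<times> 'x) set"
  assumes "bounded_geometry TYPE('x)" "equiv UNIV E" "\<And>x y. (x, y) \<in> E \<Longrightarrow> dist x y \<le> D"
  shows "ctrl_rel n (level_rel n E)"
proof -
  have e: "(x, x) \<in> E" "(x, y) \<in> E \<Longrightarrow> (y, x) \<in> E" "(x, y) \<in> E \<Longrightarrow> (y, z) \<in> E \<Longrightarrow> (x, z) \<in> E" for x y z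
    using assms(2) by (meson UNIV_I equivE refl_onD symD transD)+
  have "equiv UNIV (level_rel n E)"
  proof (rule equivI)
    show "refl (level_rel n E)" by (simp add: refl_on_def level_rel_def)
    show "sym (level_rel n E)" using e(2) unfolding sym_def level_rel_def by blast
    have "p = r \<or> (fst p, fst r) \<in> E \<and> snd p < n \<and> snd r < n"
      if "p = q \<or> (fst p, fst q) \<in> E \<and> snd p < n \<and> snd q < n" "q = r \<or> (fst q, fst r) \<in> E \<and> snd q < n \<and> snd r < n"
      for p q r :: "'x \<times> nat" using that e(3) by metis
    then show "trans (level_rel n E)" unfolding trans_def level_rel_def mem_Collect_eq case_prod_conv by presburger
  qed auto
  moreover have "\<exists>N. locally_finite_rel N (level_rel n E)"
    by (rule locally_finite_bounded[OF assms(1), of _ D n]) (use assms(3) in \<open>auto simp: level_rel_def\<close>)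
  moreover have "dist (fst p) (fst q) \<le> max D 0 \<and> (p = q \<or> snd p < n \<and> snd q < n)"
    if "(p, q) \<in> level_rel n E" for p q :: "'x \<times> nat"
    using that assms(3)[of "fst p" "fst q"] by (auto simp: level_rel_def)
  ultimately show ?thesis unfolding ctrl_rel_def by blast
qed

lemma ctrl_rel_level_commute:
  assumes "ctrl_rel n E" "supp T \<subseteq> E"
  shows "level_proj n * T = T * level_proj n"
proof (rule matrix_of_eqI)
  fix p q
  have "snd p < n \<longleftrightarrow> snd q < n" if "matrix_of T p q \<noteq> 0"
  proof -
    have "(p, q) \<in> E" using that assms(2) by (auto simp: supp_def)
    then show ?thesis using assms(1) unfolding ctrl_rel_def by blast
  qed
  then show "matrix_of (level_proj n * T) p q = matrix_of (T * level_proj n) p q"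
    unfolding matrix_of_level by (cases "matrix_of T p q = 0") auto
qed

text \<open>Control by \<open>E\<close> bounds the propagation of every entry, so the entries lie in
  the algebraic part already.\<close>

lemma ctrl_rel_Roe_levels:
  assumes "ctrl_rel n E" "supp T \<subseteq> E" "level_proj n * T = T"
  shows "T \<in> Roe_levels n"
proof -
  obtain D where D: "\<And>p q. (p, q) \<in> E \<Longrightarrow> dist (fst p) (fst q) \<le> D" using assms(1) unfolding ctrl_rel_def by blast
  have "entry i j T \<in> uniform_Roe" for i j
  proof -
    have "dist x y \<le> D" if "(x, y) \<in> supp (entry i j T)" for x y
    proof -
      have "((x, i), (y, j)) \<in> E" using that assms(2) by (auto simp: supp_def matrix_of_entry)
      from D[OF this] show ?thesis by simp
    qed
    then have "entry i j T \<in> algebraic_uniform_Roe" unfolding algebraic_uniform_Roe_iff by blast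
    then show ?thesis unfolding uniform_Roe_def by (rule subsetD[OF closure_subset])
  qed
  then show ?thesis
    using assms(3) ctrl_rel_level_commute[OF assms(1,2)] by (simp add: Roe_levels_def)
qed

section \<open>Cutting projections over the uniform Roe algebra\<close>

lemma matrix_of_amp': "matrix_of (amp i j S) p q = (if snd p = i \<and> snd q = j then matrix_of S (fst p) (fst q) else 0)"
  using matrix_of_amp[of i j S "fst p" "snd p" "fst q" "snd q"] by simp

lemma amp_diff: "amp i j S - amp i j T = amp i j (S - T)"
  by (rule matrix_of_eqI) (simp add: matrix_of_amp' matrix_of_simps)

lemma level_decompose:
  assumes "level_proj n * T = T" "T * level_proj n = T"
  shows "T = (\<Sum>i<n. \<Sum>j<n. amp i j (entry i j T))"
proof -
  let ?V = "to_mat n n T"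
  have V: "dim_row ?V = n" "dim_col ?V = n" by (auto simp: to_mat_def)
  have "T = to_op ?V"
    by (rule level_eqI[of n _ n])
       (use assms level_to_op[of ?V] in \<open>auto simp: V entry_to_op to_mat_def\<close>)
  also have "\<dots> = (\<Sum>i<n. \<Sum>j<n. amp i j (entry i j T))"
    unfolding to_op_def V by (intro sum.cong refl) (simp add: to_mat_def)
  finally show ?thesis .
qed

text \<open>The entries are approximated one at a time. Averaging with the adjoint restores
  self-adjointness and does not increase the error, because \<open>T\<close> is
  self-adjoint.\<close>

lemma controlled_approximant:
  assumes T: "T \<in> Roe_levels n" "star T = T" and "\<epsilon> > 0"
  obtains a R where "star a = a" "norm (a - T) < \<epsilon>" "R > 0"
    "\<And>p q. (p, q) \<in> supp a \<Longrightarrow> dist (fst p) (fst q) \<le> R \<and> snd p < n \<and> snd q < n"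
proof -
  \<comment> \<open>There are n^2 entries to approximate; the summand 1 makes the final inequality
    strict and covers n = 0.\<close>
  define \<delta> where "\<delta> = \<epsilon> / (real n * real n + 1)"
  have pos: "real n * real n + 1 > 0" by (rule add_nonneg_pos) auto
  have \<delta>: "\<delta> > 0" using pos assms(3) by (simp add: \<delta>_def)
  have "\<exists>S R. fst p < n \<and> snd p < n \<longrightarrow> norm (S - entry (fst p) (snd p) T) < \<delta> \<and> (\<forall>(x, y)\<in>supp S. dist x y \<le> R)" for p
  proof (cases "fst p < n \<and> snd p < n")
    case True
    then have "entry (fst p) (snd p) T \<in> closure algebraic_uniform_Roe"
      using T by (auto simp: Roe_levels_def uniform_Roe_def)
    then obtain S where S: "S \<in> algebraic_uniform_Roe" "dist S (entry (fst p) (snd p) T) < \<delta>"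
      using \<delta> unfolding closure_approachable by blast
    then obtain R where "\<forall>(x, y)\<in>supp S. dist x y \<le> R" unfolding algebraic_uniform_Roe_iff by blast
    with S(2) show ?thesis by (intro exI[of _ S] exI[of _ R]) (simp add: dist_norm)
  next
    case False
    then show ?thesis by blast
  qed
  then have "\<forall>p. \<exists>S. \<exists>R. fst p < n \<and> snd p < n \<longrightarrow> norm (S - entry (fst p) (snd p) T) < \<delta> \<and> (\<forall>(x, y)\<in>supp S. dist x y \<le> R)"
    by blast
  from choice[OF this] obtain S where "\<forall>p. \<exists>R. fst p < n \<and> snd p < n \<longrightarrow> norm (S p - entry (fst p) (snd p) T) < \<delta> \<and> (\<forall>(x, y)\<in>supp (S p). dist x y \<le> R)" ..
  from choice[OF this] obtain R where SR: "\<And>p. fst p < n \<Longrightarrow> snd p < n \<Longrightarrow> norm (S p - entry (fst p) (snd p) T) < \<delta>"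
    "\<And>p x y. fst p < n \<Longrightarrow> snd p < n \<Longrightarrow> (x, y) \<in> supp (S p) \<Longrightarrow> dist x y \<le> R p" by blast
  define a0 where "a0 = (\<Sum>i<n. \<Sum>j<n. amp i j (S (i, j)))"
  define a where "a = (1/2) *\<^sub>R (a0 + star a0)"
  have "a0 - T = (\<Sum>i<n. \<Sum>j<n. amp i j (S (i, j)) - amp i j (entry i j T))"
    unfolding a0_def sum_subtractf using level_decompose[of n T] T(1) by (simp add: Roe_levels_def)
  also have "norm \<dots> \<le> (\<Sum>i<n. \<Sum>j<n. \<delta>)"
  proof (intro order_trans[OF norm_sum sum_mono] sum_mono)
    fix i j assume "i \<in> {..<n}" "j \<in> {..<n}"
    then show "norm (amp i j (S (i, j)) - amp i j (entry i j T)) \<le> \<delta>"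
      unfolding amp_diff using SR(1)[of "(i, j)"] norm_amp[of i j "S (i, j) - entry i j T"] by simp
  qed
  also have "\<dots> = real n * real n * \<delta>" by simp
  also have "\<dots> < \<epsilon>" using pos assms(3) by (simp add: \<delta>_def field_simps)
  finally have n0: "norm (a0 - T) < \<epsilon>" .
  have "a - T = (1/2) *\<^sub>R ((a0 - T) + star (a0 - T))"
    using T(2) by (simp add: a_def star_diff algebra_simps flip: scaleR_2)
  then have "norm (a - T) \<le> (1/2) * (norm (a0 - T) + norm (star (a0 - T)))"
    by (simp del: norm_star add: norm_triangle_ineq)
  then have na: "norm (a - T) < \<epsilon>" using n0 by simp
  define RR where "RR = 1 + (\<Sum>p\<in>{..<n} \<times> {..<n}. \<bar>R p\<bar>)"
  have RR: "RR > 0" "\<And>i j. i < n \<Longrightarrow> j < n \<Longrightarrow> R (i, j) \<le> RR"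
  proof -
    show "RR > 0" unfolding RR_def by (intro add_pos_nonneg sum_nonneg) auto
    fix i j assume "i < n" "j < n"
    then show "R (i, j) \<le> RR"
      using member_le_sum[of "(i, j)" "{..<n} \<times> {..<n}" "\<lambda>p. \<bar>R p\<bar>"] by (simp add: RR_def)
  qed
  have a0: "dist (fst p) (fst q) \<le> RR \<and> snd p < n \<and> snd q < n" if nz: "matrix_of a0 p q \<noteq> 0" for p q
  proof -
    have "(\<Sum>i<n. \<Sum>j<n. matrix_of (amp i j (S (i, j))) p q) \<noteq> 0"
      using nz by (simp add: a0_def matrix_of_sum)
    then obtain i where i: "i < n" "(\<Sum>j<n. matrix_of (amp i j (S (i, j))) p q) \<noteq> 0"
      by (meson lessThan_iff sum.neutral)
    then obtain j where j: "j < n" "matrix_of (amp i j (S (i, j))) p q \<noteq> 0"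
      by (meson lessThan_iff sum.neutral)
    then have "snd p = i" "snd q = j" "(fst p, fst q) \<in> supp (S (i, j))"
      by (auto simp: matrix_of_amp' supp_def split: if_splits)
    then show ?thesis using SR(2)[of "(i, j)" "fst p" "fst q"] RR(2)[OF i(1) j(1)] i(1) j(1) by auto
  qed
  show thesis
  proof (rule that[of a RR])
    show "star a = a" by (simp add: a_def star_scaleR star_add add.commute)
    show "dist (fst p) (fst q) \<le> RR \<and> snd p < n \<and> snd q < n" if "(p, q) \<in> supp a" for p q
    proof -
      have "matrix_of a0 p q \<noteq> 0 \<or> matrix_of a0 q p \<noteq> 0"
        using that by (auto simp: supp_def a_def matrix_of_simps matrix_of_star)
      then show ?thesis using a0[of p q] a0[of q p] by (auto simp: dist_commute)
    qed
  qed (use na RR in auto)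
qed

text \<open>One index of \<open>cut_sequence\<close> as a predicate on a tuple, so that whole
  sequences are obtained by choice. The commutator bound is linear in the Lipschitz constant, so it
  tends to 0 with \<epsilon> for every fixed Lipschitz \<open>G\<close>.\<close>

definition cut_data :: "nat \<Rightarrow> ('x::metric_space \<times> nat) bop \<Rightarrow> real \<Rightarrow> ('x \<times> nat \<Rightarrow> real) \<times>
    (('x \<times> nat) \<times> ('x \<times> nat)) set \<times> (('x \<times> nat) \<times> ('x \<times> nat)) set \<Rightarrow> bool" where
  "cut_data n a \<epsilon> = (\<lambda>(h, E1, E2). ctrl_rel n E1 \<and> ctrl_rel n E2 \<and> (\<forall>p. 0 \<le> h p \<and> h p \<le> 1) \<and>
     (\<forall>G C. 0 \<le> C \<longrightarrow> (\<forall>s\<in>{0..1}. \<forall>t\<in>{0..1}. cmod (G s - G t) \<le> C * \<bar>s - t\<bar>) \<longrightarrow>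
        norm (a * diag_op (\<lambda>p. G (h p)) - diag_op (\<lambda>p. G (h p)) * a) \<le> C * \<epsilon>) \<and>
     (\<forall>p q. (p, q) \<in> supp a \<longrightarrow> h p < 1/2 \<longrightarrow> h q < 1/2 \<longrightarrow> (p, q) \<in> E1) \<and>
     (\<forall>p q. (p, q) \<in> supp a \<longrightarrow> h p > 1/2 \<longrightarrow> h q > 1/2 \<longrightarrow> (p, q) \<in> E2) \<and>
     (\<forall>p w q. (p, w) \<in> supp a \<longrightarrow> (w, q) \<in> supp a \<longrightarrow> 0 < h w \<longrightarrow> h w < 1 \<longrightarrow> (p, q) \<in> E1 \<inter> E2))"

text \<open>The commutator with a function of \<open>h\<close> has the entries of \<open>a\<close>
  times differences of values of \<open>G\<close> along \<open>h\<close>. A flat \<open>h\<close>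
  makes them small, and \<open>norm_bop_schur\<close> turns this into a norm bound.\<close>

lemma cut_data_exists:
  fixes a :: "('x::metric_space \<times> nat) bop"
  assumes geom: "bounded_geometry TYPE('x)" "asdim_le_one TYPE('x)" and "R > 0" "\<epsilon> > 0"
    and a: "\<And>p q. (p, q) \<in> supp a \<Longrightarrow> dist (fst p) (fst q) \<le> R \<and> snd p < n \<and> snd q < n"
  shows "\<exists>d. cut_data n a \<epsilon> d"
proof -
  define F where "F = {(p, q :: 'x \<times> nat). dist (fst p) (fst q) \<le> R \<and> snd p < n \<and> snd q < n}"
  obtain M where M: "locally_finite_rel M F"
    using locally_finite_bounded[OF geom(1), of F R n] by (auto simp: F_def)
  \<comment> \<open>The slope is chosen after \<open>a\<close>, its propagation \<open>R\<close> and
    the row bound \<open>M\<close>, so that \<open>norm a * L * R * M \<le> \<epsilon>\<close>. A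
    smaller slope only asks for pieces that are further apart.\<close>
  define L where "L = \<epsilon> / (1 + norm a * R * M)"
  have dpos: "1 + norm a * R * M > 0" using \<open>R > 0\<close> by (intro add_pos_nonneg mult_nonneg_nonneg) auto
  have "L > 0" using dpos \<open>\<epsilon> > 0\<close> by (simp add: L_def)
  obtain h :: "'x \<Rightarrow> real" and EU EV D where
    E: "equiv UNIV EU" "equiv UNIV EV"
    and D: "\<And>x y. (x, y) \<in> EU \<Longrightarrow> dist x y \<le> D" "\<And>x y. (x, y) \<in> EV \<Longrightarrow> dist x y \<le> D"
    and h: "\<And>x. 0 \<le> h x" "\<And>x. h x \<le> 1" "\<And>x y. \<bar>h x - h y\<bar> \<le> L * dist x y"
    and l: "\<And>x y. h x < 1/2 \<Longrightarrow> h y < 1/2 \<Longrightarrow> dist x y \<le> R \<Longrightarrow> (x, y) \<in> EU"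
    and r: "\<And>x y. h x > 1/2 \<Longrightarrow> h y > 1/2 \<Longrightarrow> dist x y \<le> R \<Longrightarrow> (x, y) \<in> EV"
    and c: "\<And>x y w. 0 < h w \<Longrightarrow> h w < 1 \<Longrightarrow> dist x w \<le> R \<Longrightarrow> dist y w \<le> R \<Longrightarrow> (x, y) \<in> EU \<inter> EV"
    by (rule asdim_le_one_cut[OF geom(2) \<open>R > 0\<close> \<open>L > 0\<close>]) blast
  define h' where "h' p = h (fst p)" for p :: "'x \<times> nat"
  have comm: "norm (a * diag_op (\<lambda>p. G (h' p)) - diag_op (\<lambda>p. G (h' p)) * a) \<le> C * \<epsilon>"
    if C: "0 \<le> C" and G: "\<forall>s\<in>{0..1}. \<forall>t\<in>{0..1}. cmod (G s - G t) \<le> C * \<bar>s - t\<bar>" for G C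
  proof -
    have "bdd01 G" by (rule lip_imp_bdd01) (use G in \<open>auto simp: lip_def\<close>)
    then obtain B where "\<forall>t\<in>{0..1}. cmod (G t) \<le> B" by (auto simp: bdd01_def)
    then have g: "(\<lambda>p. G (h' p)) \<in> ell_infty"
      using h by (intro ell_inftyI[of _ B]) (simp add: h'_def)
    let ?K = "a * diag_op (\<lambda>p. G (h' p)) - diag_op (\<lambda>p. G (h' p)) * a"
    have K: "matrix_of ?K p q = matrix_of a p q * (G (h' q) - G (h' p))" for p q
      by (simp add: matrix_of_simps matrix_of_diag_mult[OF g] matrix_of_mult_diag[OF g] algebra_simps)
    have "norm ?K \<le> (norm a * (C * (L * R))) * M"
    proof (rule norm_bop_schur[OF M])
      show "0 \<le> norm a * (C * (L * R))" using C \<open>L > 0\<close> \<open>R > 0\<close> by simp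
      show "supp ?K \<subseteq> F" using a by (auto simp: supp_def K F_def)
      fix p q
      show "cmod (matrix_of ?K p q) \<le> norm a * (C * (L * R))"
      proof (cases "(p, q) \<in> supp a")
        case True
        have "cmod (G (h' q) - G (h' p)) \<le> C * \<bar>h' q - h' p\<bar>" using G h by (simp add: h'_def)
        also have "\<dots> \<le> C * (L * R)"
        proof (rule mult_left_mono[OF _ C])
          have "\<bar>h' q - h' p\<bar> \<le> L * dist (fst p) (fst q)"
            using h(3)[of "fst q" "fst p"] by (simp add: h'_def dist_commute)
          also have "\<dots> \<le> L * R" using a[OF True] \<open>L > 0\<close> by (intro mult_left_mono) auto
          finally show "\<bar>h' q - h' p\<bar> \<le> L * R" .
        qed
        finally show ?thesis unfolding K norm_mult by (intro mult_mono matrix_of_bound) auto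
      next
        case False
        then show ?thesis using C \<open>L > 0\<close> \<open>R > 0\<close> by (simp add: K supp_def)
      qed
    qed
    also have "\<dots> = C * (\<epsilon> * (norm a * R * M / (1 + norm a * R * M)))" by (simp add: L_def)
    also have "\<dots> \<le> C * (\<epsilon> * 1)"
      using C \<open>\<epsilon> > 0\<close> dpos by (intro mult_left_mono) (auto simp: divide_le_eq_1)
    finally show ?thesis by simp
  qed
  have "cut_data n a \<epsilon> (h', level_rel n EU, level_rel n EV)"
    unfolding cut_data_def prod.case
  proof (intro conjI allI impI)
    show "ctrl_rel n (level_rel n EU)" by (rule ctrl_level_rel[OF geom(1) E(1) D(1)])
    show "ctrl_rel n (level_rel n EV)" by (rule ctrl_level_rel[OF geom(1) E(2) D(2)])
    show "0 \<le> h' p" "h' p \<le> 1" for p using h by (auto simp: h'_def)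
    show "(p, q) \<in> level_rel n EU" if "(p, q) \<in> supp a" "h' p < 1/2" "h' q < 1/2" for p q
      using l[of "fst p" "fst q"] a[OF that(1)] that(2,3) by (auto simp: h'_def level_rel_def)
    show "(p, q) \<in> level_rel n EV" if "(p, q) \<in> supp a" "h' p > 1/2" "h' q > 1/2" for p q
      using r[of "fst p" "fst q"] a[OF that(1)] that(2,3) by (auto simp: h'_def level_rel_def)
    show "(p, q) \<in> level_rel n EU \<inter> level_rel n EV" if "(p, w) \<in> supp a" "(w, q) \<in> supp a" "0 < h' w" "h' w < 1" for p w q
      using c[of "fst w" "fst p" "fst q"] a[OF that(1)] a[OF that(2)] that(3,4)
      by (auto simp: h'_def level_rel_def dist_commute)
  qed (rule comm)
  then show ?thesis by blast
qed

text \<open>Approximants of \<open>P\<close> with errors and commutator tolerances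
  \<open>1 / (k + 1)\<close> form an instance of \<open>cut_sequence\<close>; a single index far
  enough out is then kept.\<close>

lemma projection_cut:
  fixes P :: "('x::metric_space \<times> nat) bop"
  assumes geom: "bounded_geometry TYPE('x)" "asdim_le_one TYPE('x)"
    and P: "P \<in> Roe_levels n" "star P = P" "P * P = P" and "\<epsilon> > 0"
  obtains t1 t2 E1 E2 where "ctrl_rel n E1" "ctrl_rel n E2"
    "star t1 = t1" "star t2 = t2" "supp t1 \<subseteq> E1" "supp t2 \<subseteq> E2"
    "norm (P - (t1 + t2)) < \<epsilon>" "norm (t1 * t1 - t1) < \<epsilon>" "norm (t2 * t2 - t2) < \<epsilon>" "norm (t1 * t2) < \<epsilon>"
proof -
  have "\<exists>z. star (fst z) = fst z \<and> norm (fst z - P) < 1 / real (Suc k) \<and> cut_data n (fst z) (1 / real (Suc k)) (snd z)" for k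
  proof -
    have pos: "1 / real (Suc k) > 0" by simp
    obtain a R where a: "star a = a" "norm (a - P) < 1 / real (Suc k)" "R > 0"
      "\<And>p q. (p, q) \<in> supp a \<Longrightarrow> dist (fst p) (fst q) \<le> R \<and> snd p < n \<and> snd q < n"
      by (rule controlled_approximant[OF P(1,2) pos]) blast
    obtain d where "cut_data n a (1 / real (Suc k)) d"
      using cut_data_exists[OF geom a(3) pos a(4)] by blast
    with a show ?thesis by (intro exI[of _ "(a, d)"]) simp
  qed
  then have "\<forall>k. \<exists>z. star (fst z) = fst z \<and> norm (fst z - P) < 1 / real (Suc k) \<and> cut_data n (fst z) (1 / real (Suc k)) (snd z)"
    by blast
  from choice[OF this] obtain z where z: "\<And>k. star (fst (z k)) = fst (z k)" "\<And>k. norm (fst (z k) - P) < 1 / real (Suc k)"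
    "\<And>k. cut_data n (fst (z k)) (1 / real (Suc k)) (snd (z k))" by blast
  define a where "a k = fst (z k)" for k
  define h where "h k = fst (snd (z k))" for k
  define E1 where "E1 k = fst (snd (snd (z k)))" for k
  define E2 where "E2 k = snd (snd (snd (z k)))" for k
  define N where "N k = (SOME N. locally_finite_rel N (E1 k))" for k
  have cd: "cut_data n (a k) (1 / real (Suc k)) (h k, E1 k, E2 k)" for k
    using z(3)[of k] by (simp add: a_def h_def E1_def E2_def)
  note cd' = cd[unfolded cut_data_def prod.case]
  have inv: "(\<lambda>k. C * (1 / real (Suc k))) \<longlonglongrightarrow> 0" for C
    using tendsto_mult_right_zero[OF LIMSEQ_inverse_real_of_nat, of C] by (simp add: inverse_eq_divide)
  interpret cut_sequence P a h E1 E2 N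
  proof
    show "star P = P" "P * P = P" by (rule P)+
    show "star (a k) = a k" for k using z(1) by (simp add: a_def)
    have "(\<lambda>k. a k - P) \<longlonglongrightarrow> 0"
      by (rule Lim_null_comparison[OF _ inv[of 1]], rule always_eventually)
         (use less_imp_le[OF z(2)] in \<open>simp add: a_def\<close>)
    then show "a \<longlonglongrightarrow> P" by (simp add: LIM_zero_iff)
    show "0 \<le> h k x" "h k x \<le> 1" for k x using cd'[of k] by blast+
    show "equiv UNIV (E1 k)" "equiv UNIV (E2 k)" for k using cd'[of k] unfolding ctrl_rel_def by blast+
    show "locally_finite_rel (N k) (E1 k)" for k
      unfolding N_def by (rule someI_ex) (use cd'[of k] in \<open>unfold ctrl_rel_def, blast\<close>)
    show "(\<lambda>k. a k * diag_op (\<lambda>x. G (h k x)) - diag_op (\<lambda>x. G (h k x)) * a k) \<longlonglongrightarrow> 0" if lG: "lip G" for G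
    proof -
      obtain C where C: "\<forall>s\<in>{0..1}. \<forall>t\<in>{0..1}. cmod (G s - G t) \<le> C * \<bar>s - t\<bar>" using lG by (auto simp: lip_def)
      have "\<forall>s\<in>{0..1}. \<forall>t\<in>{0..1}. cmod (G s - G t) \<le> \<bar>C\<bar> * \<bar>s - t\<bar>"
        using C by (meson abs_ge_self abs_ge_zero mult_right_mono order_trans)
      then have "norm (a k * diag_op (\<lambda>x. G (h k x)) - diag_op (\<lambda>x. G (h k x)) * a k) \<le> \<bar>C\<bar> * (1 / real (Suc k))" for k
        using cd'[of k] abs_ge_zero[of C] by blast
      then show ?thesis by (intro Lim_null_comparison[OF _ inv] always_eventually) auto
    qed
    show "(x, y) \<in> E1 k" if "(x, y) \<in> supp (a k)" "h k x < 1/2" "h k y < 1/2" for k x y using cd'[of k] that by blast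
    show "(x, y) \<in> E2 k" if "(x, y) \<in> supp (a k)" "h k x > 1/2" "h k y > 1/2" for k x y using cd'[of k] that by blast
    show "(x, y) \<in> E1 k \<inter> E2 k" if "(x, w) \<in> supp (a k)" "(w, y) \<in> supp (a k)" "0 < h k w" "h k w < 1" for k x w y
      using cd'[of k] that by blast
  qed
  show thesis
  proof (rule cut_approx[OF \<open>\<epsilon> > 0\<close>])
    fix k t1 t2
    assume "star t1 = t1" "star t2 = t2" "supp t1 \<subseteq> E1 k" "supp t2 \<subseteq> E2 k"
      "norm (P - (t1 + t2)) < \<epsilon>" "norm (t1 * t1 - t1) < \<epsilon>" "norm (t2 * t2 - t2) < \<epsilon>" "norm (t1 * t2) < \<epsilon>"
    then show thesis using cd'[of k] by (intro that[of "E1 k" "E2 k" t1 t2]) auto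
  qed
qed

section \<open>Projections over the uniform Roe algebra are equivalent to diagonal ones\<close>

lemma star_amp: "star (amp i j S) = amp j i (star S)"
  by (rule matrix_of_eqI) (auto simp: matrix_of_star matrix_of_amp')

text \<open>Conjugation by this partial isometry puts an n by n matrix into the lower right corner
  of a matrix of size 2n, orthogonally to the upper left one.\<close>

definition shift :: "nat \<Rightarrow> ('x \<times> nat) bop" where
  "shift n = (\<Sum>l<n. amp (l + n) l 1)"

lemma bop_apply_sum: "bop_apply (sum f A) u = (\<Sum>a\<in>A. bop_apply (f a) u)"
  by (induction A rule: infinite_finite_induct) (auto simp: bop_apply_simps)

lemma shift_apply:
  "ell2_apply (bop_apply (shift n) u) (x, k) = (if n \<le> k \<and> k < 2 * n then ell2_apply u (x, k - n) else 0)"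
proof -
  have "ell2_apply (bop_apply (shift n) u) (x, k) = (\<Sum>l<n. if k = l + n then ell2_apply u (x, l) else 0)"
    by (simp add: shift_def bop_apply_sum ell2_apply_sum amp_apply level_apply bop_apply_simps cong: if_cong)
  also have "\<dots> = (\<Sum>l<n. if l = k - n \<and> n \<le> k then ell2_apply u (x, k - n) else 0)"
    by (intro sum.cong) auto
  also have "\<dots> = (if n \<le> k \<and> k < 2 * n then ell2_apply u (x, k - n) else 0)"
    by (cases "n \<le> k") (auto simp: sum.delta)
  finally show ?thesis .
qed

lemma star_shift_apply:
  "ell2_apply (bop_apply (star (shift n)) u) (x, k) = (if k < n then ell2_apply u (x, k + n) else 0)"
proof -
  have "ell2_apply (bop_apply (star (shift n)) u) (x, k) = (\<Sum>l<n. if k = l then ell2_apply u (x, l + n) else 0)"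
    by (simp add: shift_def star_sum star_amp bop_apply_sum ell2_apply_sum amp_apply level_apply bop_apply_simps
        cong: if_cong)
  then show ?thesis by simp
qed

lemma level_proj_apply': "ell2_apply (bop_apply (level_proj n) u) (x, k) = (if k < n then ell2_apply u (x, k) else 0)"
  by (simp add: level_proj_def diag_op_apply[OF level_ell_infty])

lemma shift_facts:
  "star (shift n) * shift n = (level_proj n :: ('x \<times> nat) bop)" "shift n * level_proj n = (shift n :: ('x \<times> nat) bop)"
  "level_proj (2 * n) * shift n = (shift n :: ('x \<times> nat) bop)" "level_proj n * shift n = (0 :: ('x \<times> nat) bop)"
  by (intro bop_eqI ell2_eqI;
      clarsimp simp: bop_apply_simps shift_apply star_shift_apply level_proj_apply' ell2_simps; arith?)+

lemma norm_shift: "norm (shift n :: ('x \<times> nat) bop) \<le> 1"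
proof -
  have "norm (level_proj n :: ('x \<times> nat) bop) \<le> 1" unfolding level_proj_def by (rule norm_diag_op) auto
  then have "(norm (shift n :: ('x \<times> nat) bop))\<^sup>2 \<le> 1"
    using norm_star_mult[of "shift n :: ('x \<times> nat) bop"] by (simp add: shift_facts)
  then show ?thesis by (simp add: abs_square_le_1)
qed

lemma shift_Roe_levels: "(shift n :: ('x::metric_space \<times> nat) bop) \<in> Roe_levels (2 * n)"
proof -
  have "shift n * level_proj (2 * n) = (shift n :: ('x \<times> nat) bop)"
    using shift_facts(2)[of n] level_proj_mult[of n "2 * n"] by (metis min.commute min.absorb2 mult.assoc mult_2 le_add1)
  moreover have "entry i j (shift n) \<in> (uniform_Roe :: 'x bop set)" for i j
    unfolding shift_def entry_sum entry_amp by (intro uniform_Roe_sum) (auto simp: uniform_Roe_zero_one)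
  ultimately show ?thesis by (simp add: Roe_levels_def shift_facts)
qed

text \<open>The difference \<open>d = v * p - v\<close> satisfies \<open>star d * d = 0\<close>,
  which forces \<open>d = 0\<close> by \<open>norm_star_mult\<close>.\<close>

lemma partial_isometry_right:
  assumes "star v * v = p" "p * p = p" "star p = p"
  shows "v * p = (v :: 'y bop)"
proof -
  have "star (v * p - v) * (v * p - v) = p * (star v * v) * p - p * (star v * v) - (star v * v) * p + star v * v"
    by (simp add: star_diff star_mult assms(3) algebra_simps)
  also have "\<dots> = 0" by (simp add: assms)
  finally have "(norm (v * p - v))\<^sup>2 \<le> 0" using norm_star_mult[of "v * p - v"] by simp
  then show ?thesis by simp
qed

lemma norm_mult3: "norm a \<le> 1 \<Longrightarrow> norm c \<le> 1 \<Longrightarrow> norm (a * b * c) \<le> norm (b :: 'y bop)"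
proof -
  assume *: "norm a \<le> 1" "norm c \<le> 1"
  have "norm (a * b * c) \<le> norm a * norm b * norm c"
    by (intro order_trans[OF norm_mult_ineq] mult_right_mono norm_mult_ineq) simp
  also have "\<dots> \<le> 1 * norm b * 1" using * by (intro mult_mono) auto
  finally show ?thesis by simp
qed

text \<open>If a projection is close to a sum of two almost orthogonal projections, the column
  \<open>x = (e1 p, e2 p)\<close> is almost a partial isometry onto their direct sum.\<close>

lemma split_projection:
  fixes P e1 e2 :: "('x::metric_space \<times> nat) bop"
  assumes P: "P \<in> Roe_levels n" "star P = P" "P * P = P"
    and e1: "e1 \<in> Roe_levels n" "star e1 = e1" "e1 * e1 = e1"
    and e2: "e2 \<in> Roe_levels n" "star e2 = e2" "e2 * e2 = e2"
    and close: "norm (P - (e1 + e2)) \<le> 1/100" "norm (e1 * e2) \<le> 1/100"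
  obtains v where "v \<in> Roe_levels (2 * n)" "star v * v = P" "v * star v = e1 + shift n * e2 * star (shift n)"
proof -
  let ?\<sigma> = "shift n :: ('x \<times> nat) bop" and ?Q = "level_proj n :: ('x \<times> nat) bop"
  define x where "x = e1 * P + ?\<sigma> * e2 * P"
  define q where "q = e1 + ?\<sigma> * e2 * star ?\<sigma>"
  define d where "d = P - (e1 + e2)"
  have lev: "?Q * e1 = e1" "e1 * ?Q = e1" "?Q * e2 = e2" "e2 * ?Q = e2"
    using e1(1) e2(1) by (auto simp: Roe_levels_def)
  have e1\<sigma>: "e1 * ?\<sigma> = 0" by (metis lev(2) mult.assoc mult_zero_right shift_facts(4))
  have \<sigma>e1: "star ?\<sigma> * e1 = 0" using arg_cong[OF e1\<sigma>, of star] by (simp add: star_mult e1)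
  have \<sigma>\<sigma>: "star ?\<sigma> * (?\<sigma> * e2) = e2" by (simp add: shift_facts lev flip: mult.assoc)
  have nn: "norm e1 \<le> 1" "norm e2 \<le> 1" "norm P \<le> 1" "norm ?\<sigma> \<le> 1" "norm (star ?\<sigma>) \<le> 1"
    using norm_projection[OF e1(2,3)] norm_projection[OF e2(2,3)] norm_projection[OF P(2,3)] norm_shift[of n] by auto
  have xs: "star x = P * e1 + P * e2 * star ?\<sigma>" by (simp add: x_def star_add star_mult P e1 e2 mult.assoc)
  have "star x * x = P * (e1 * e1) * P + P * (e1 * ?\<sigma>) * e2 * P + P * e2 * (star ?\<sigma> * e1) * P
      + P * e2 * (star ?\<sigma> * (?\<sigma> * e2)) * P"
    unfolding xs unfolding x_def by (simp add: distrib_left distrib_right mult.assoc)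
  also have "\<dots> = P * e1 * P + P * (e2 * e2) * P"
    unfolding e1\<sigma> \<sigma>e1 \<sigma>\<sigma> e1(3) by (simp add: mult.assoc)
  also have "\<dots> = P * e1 * P + P * e2 * P" unfolding e2(3) ..
  finally have "P - star x * x = P * d * P"
    by (simp add: d_def left_diff_distrib right_diff_distrib distrib_left distrib_right P)
  then have lt1: "norm (P - star x * x) < 1"
    using norm_mult3[OF nn(3) nn(3), of d] close(1) by (simp add: d_def)
  have xx: "x * star x = e1 * P * e1 + e1 * P * e2 * star ?\<sigma> + ?\<sigma> * (e2 * P * e1) + ?\<sigma> * (e2 * P * e2) * star ?\<sigma>"
  proof -
    have "x * star x = e1 * (P * P) * e1 + e1 * (P * P) * e2 * star ?\<sigma> + ?\<sigma> * (e2 * (P * P) * e1)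
        + ?\<sigma> * (e2 * (P * P) * e2) * star ?\<sigma>"
      unfolding xs unfolding x_def by (simp add: distrib_left distrib_right mult.assoc)
    then show ?thesis by (simp add: P)
  qed
  \<comment> \<open>After this substitution, the four matrix entries of
    \<open>q - x * star x\<close> consist of terms containing \<open>d\<close> or a product of
    \<open>e1\<close> and \<open>e2\<close>. Their bounds add up to 1/10, well below the 1 that the
    polar part asks for.\<close>
  have Pd: "P = d + e1 + e2" by (simp add: d_def)
  have e21: "norm (e2 * e1) \<le> 1/100"
    using close(2) norm_star[of "e1 * e2"] by (simp add: star_mult e1 e2)
  have b11: "norm (e1 - e1 * P * e1) \<le> 2/100"
  proof -
    have "e1 - e1 * P * e1 = - (e1 * d * e1) - (e1 * e2) * e1"
      by (simp add: Pd distrib_left distrib_right e1 mult.assoc)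
    also have "norm \<dots> \<le> norm (e1 * d * e1) + norm ((e1 * e2) * e1)"
      by (rule order_trans[OF norm_triangle_ineq4]) simp
    also have "\<dots> \<le> norm d + norm (e1 * e2)"
      using norm_mult3[OF nn(1) nn(1), of d] norm_mult3[of 1 e1 "e1 * e2"] nn by (intro add_mono) auto
    finally show ?thesis using close by (simp add: d_def)
  qed
  have b22: "norm (e2 - e2 * P * e2) \<le> 2/100"
  proof -
    have "e2 - e2 * P * e2 = - (e2 * d * e2) - (e2 * e1) * e2"
      by (simp add: Pd distrib_left distrib_right e2 mult.assoc)
    also have "norm \<dots> \<le> norm (e2 * d * e2) + norm ((e2 * e1) * e2)"
      by (rule order_trans[OF norm_triangle_ineq4]) simp
    also have "\<dots> \<le> norm d + norm (e2 * e1)"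
      using norm_mult3[OF nn(2) nn(2), of d] norm_mult3[of 1 e2 "e2 * e1"] nn by (intro add_mono) auto
    finally show ?thesis using close e21 by (simp add: d_def)
  qed
  have b12: "norm (e1 * P * e2) \<le> 3/100"
  proof -
    have "e1 * P * e2 = e1 * d * e2 + e1 * e1 * e2 + e1 * (e2 * e2)"
      by (simp add: Pd distrib_left distrib_right mult.assoc)
    also have "\<dots> = e1 * d * e2 + (e1 * e2 + e1 * e2)" by (simp only: e1(3) e2(3) add.assoc)
    also have "norm \<dots> \<le> norm (e1 * d * e2) + (norm (e1 * e2) + norm (e1 * e2))"
      by (intro norm_triangle_mono norm_triangle_ineq order_refl)
    finally show ?thesis using close norm_mult3[OF nn(1) nn(2), of d] by (simp add: d_def)
  qed
  have b21: "norm (e2 * P * e1) \<le> 3/100"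
    using b12 norm_star[of "e1 * P * e2"] by (simp add: star_mult e1 e2 P mult.assoc)
  have "q - x * star x = (e1 - e1 * P * e1) - e1 * P * e2 * star ?\<sigma> - ?\<sigma> * (e2 * P * e1)
      + ?\<sigma> * (e2 - e2 * P * e2) * star ?\<sigma>"
    unfolding xx q_def by (simp add: algebra_simps)
  also have "norm \<dots> \<le> norm (e1 - e1 * P * e1) + norm (e1 * P * e2 * star ?\<sigma>) + norm (?\<sigma> * (e2 * P * e1))
      + norm (?\<sigma> * (e2 - e2 * P * e2) * star ?\<sigma>)"
    by (intro norm_triangle_mono order_trans[OF norm_triangle_ineq4] add_mono order_refl)
  also have "\<dots> \<le> 2/100 + 3/100 + 3/100 + 2/100"
  proof (intro add_mono b11)
    show "norm (e1 * P * e2 * star ?\<sigma>) \<le> 3/100"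
      using norm_mult3[of 1 "star ?\<sigma>" "e1 * P * e2"] b12 nn by simp
    show "norm (?\<sigma> * (e2 * P * e1)) \<le> 3/100"
      using norm_mult3[of ?\<sigma> 1 "e2 * P * e1"] b21 nn by simp
    show "norm (?\<sigma> * (e2 - e2 * P * e2) * star ?\<sigma>) \<le> 2/100"
      using norm_mult3[OF nn(4,5), of "e2 - e2 * P * e2"] b22 by simp
  qed
  finally have lt2: "norm (q - x * star x) < 1" by simp
  note alg = Roe_levels_algebra[where n = "2 * n" and ?'x = 'x]
  have n2: "n \<le> 2 * n" by simp
  note R = Roe_levels_mono[OF n2 P(1)] Roe_levels_mono[OF n2 e1(1)] Roe_levels_mono[OF n2 e2(1)] shift_Roe_levels[of n]
  have xA: "x \<in> Roe_levels (2 * n)"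
    unfolding x_def by (intro real_vector.subspace_add[OF alg(2)] alg(3) R)
  have xP: "x * P = x" by (simp add: x_def distrib_right mult.assoc P)
  have sq: "star q = q" by (simp add: q_def star_add star_mult e1 e2 mult.assoc)
  have qq: "q * q = q"
  proof -
    have "q * q = e1 * e1 + (e1 * ?\<sigma>) * e2 * star ?\<sigma> + ?\<sigma> * e2 * (star ?\<sigma> * e1)
        + ?\<sigma> * e2 * (star ?\<sigma> * (?\<sigma> * e2)) * star ?\<sigma>"
      unfolding q_def by (simp add: distrib_left distrib_right mult.assoc)
    also have "\<dots> = e1 + ?\<sigma> * (e2 * e2) * star ?\<sigma>" unfolding e1\<sigma> \<sigma>e1 \<sigma>\<sigma> e1(3) by (simp add: mult.assoc)
    finally show ?thesis by (simp add: e2 q_def)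
  qed
  have qx: "q * x = x"
  proof -
    have "q * x = e1 * e1 * P + (e1 * ?\<sigma>) * e2 * P + ?\<sigma> * e2 * (star ?\<sigma> * e1) * P
        + ?\<sigma> * e2 * (star ?\<sigma> * (?\<sigma> * e2)) * P"
      unfolding q_def x_def by (simp add: distrib_left distrib_right mult.assoc)
    also have "\<dots> = e1 * P + ?\<sigma> * (e2 * e2) * P" unfolding e1\<sigma> \<sigma>e1 \<sigma>\<sigma> e1(3) by (simp add: mult.assoc)
    finally show ?thesis by (simp add: e2 x_def)
  qed
  show thesis
    by (rule polar_partial_isometry[OF alg xA R(1) P(2,3) xP sq qq qx lt1 lt2])
       (auto intro: that simp: q_def)
qed

text \<open>\<open>quasi_projection_diag\<close> with membership in the matrix algebra added.
  \<open>W\<close> is unitary on all levels, so its compression by \<open>level_proj n\<close> is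
  what belongs to \<open>Roe_levels n\<close>.\<close>

lemma block_projection_close:
  fixes t :: "('x::metric_space \<times> nat) bop"
  assumes E: "ctrl_rel n E" and t: "star t = t" "supp t \<subseteq> E" "level_proj n * t = t" "norm (t * t - t) \<le> \<epsilon>"
  obtains e W X where "e \<in> Roe_levels n" "star e = e" "e * e = e" "norm (e - t) \<le> 2 * \<epsilon>"
    "W * level_proj n \<in> Roe_levels n" "star W * W = 1" "level_proj n * W = W * level_proj n"
    "e = W * diag_op (\<lambda>p. if p \<in> X then 1 else 0) * star W"
    "level_proj n * diag_op (\<lambda>p. if p \<in> X then 1 else 0) = diag_op (\<lambda>p. if p \<in> X then 1 else 0)"
proof -
  let ?Q = "level_proj n :: ('x \<times> nat) bop"
  have eq: "equiv UNIV E" using E by (simp add: ctrl_rel_def)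
  obtain N where N: "locally_finite_rel N E" using E by (auto simp: ctrl_rel_def)
  obtain W X where W: "star W * W = 1" "W * star W = 1" "supp W \<subseteq> E"
    and close: "norm (conj_diag W (\<lambda>x. if x \<in> X then 1 else 0) - t) \<le> 2 * \<epsilon>"
    and Qe: "\<And>Q. Q * t = t \<Longrightarrow> Q * conj_diag W (\<lambda>x. if x \<in> X then 1 else 0) = conj_diag W (\<lambda>x. if x \<in> X then 1 else 0)"
    by (rule quasi_projection_diag[OF eq N t(1,2,4)]) blast
  define i where "i = (\<lambda>p. if p \<in> X then 1 else 0 :: complex)"
  have i: "i \<in> ell_infty" by (rule ell_inftyI[where C = 1]) (simp add: i_def)
  define e where "e = conj_diag W i"
  have WQ: "?Q * W = W * ?Q" by (rule ctrl_rel_level_commute[OF E W(3)])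
  have se: "star e = e"
    unfolding e_def star_conj_diag[OF W(1,2) i]
    by (rule arg_cong[where f = "conj_diag W"]) (auto simp: i_def star_fun_def star_complex_def)
  have ee: "e * e = e"
    unfolding e_def conj_diag_mult[OF W(1,2) i i]
    by (rule arg_cong[where f = "conj_diag W"]) (auto simp: i_def times_fun_def)
  have "?Q * e = e" unfolding e_def i_def by (rule Qe[OF t(3)])
  moreover have "supp e \<subseteq> E" unfolding e_def by (rule supp_conj_diag[OF W(1,2) eq W(3) i])
  ultimately have eR: "e \<in> Roe_levels n" by (intro ctrl_rel_Roe_levels[OF E])
  have "?Q * (W * ?Q) = W * ?Q"
    by (simp add: level_proj_mult flip: mult.assoc) (simp add: WQ level_proj_mult mult.assoc)
  moreover have "supp (W * ?Q) \<subseteq> E"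
    using W(3) by (auto simp: supp_def matrix_of_level split: if_splits)
  ultimately have WR: "W * ?Q \<in> Roe_levels n" by (intro ctrl_rel_Roe_levels[OF E])
  have D: "diag_op i = star W * e * W"
  proof -
    have "star W * e * W = (star W * W) * diag_op i * (star W * W)" by (simp only: e_def conj_diag_def mult.assoc)
    then show ?thesis by (simp add: W)
  qed
  have "star (?Q * W) = star (W * ?Q)" by (simp only: WQ)
  then have WQ': "star W * ?Q = ?Q * star W" by (simp add: star_mult star_level_proj)
  have "?Q * diag_op i = star W * (?Q * e) * W" unfolding D by (simp only: WQ'[symmetric] mult.assoc[symmetric])
  then have "?Q * diag_op i = diag_op i" by (simp only: \<open>?Q * e = e\<close> D)
  then show thesis
    using close by (intro that[OF eR se ee _ WR W(1) WQ]) (auto simp: e_def conj_diag_def i_def)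
qed

lemma shift_conj_diag:
  assumes "f \<in> ell_infty"
  shows "shift n * diag_op f * star (shift n) = diag_op (\<lambda>p. if n \<le> snd p \<and> snd p < 2 * n then f (fst p, snd p - n) else 0)"
proof -
  obtain C where C: "\<And>p. cmod (f p) \<le> C" using assms by (auto simp: ell_infty_def bounded_iff)
  have "0 \<le> C" using C[of undefined] norm_ge_zero order_trans by blast
  then have i: "(\<lambda>p. if n \<le> snd p \<and> snd p < 2 * n then f (fst p, snd p - n) else 0) \<in> ell_infty"
    using C by (intro ell_inftyI[of _ C]) auto
  show ?thesis
    by (intro bop_eqI ell2_eqI)
       (auto simp: bop_apply_simps shift_apply star_shift_apply diag_op_apply[OF assms] diag_op_apply[OF i])
qed

text \<open>\<open>v\<close> makes \<open>P\<close> equivalent to the direct sum of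
  \<open>e1\<close> and \<open>e2\<close>, and \<open>y\<close> makes this equivalent to a direct
  sum of indicator functions; their composition is \<open>z\<close>. The direct sum doubles the
  matrix size.\<close>

lemma projection_equivalent_diagonal:
  assumes geom: "bounded_geometry TYPE('x::metric_space)" "asdim_le_one TYPE('x)"
    and P: "P \<in> projections (uniform_Roe :: 'x bop set)"
  obtains D where "D \<in> projections (ell_infty :: ('x \<Rightarrow> complex) set)" "(P, map_mat diag_op D) \<in> mvn_rel uniform_Roe"
proof -
  define n where "n = dim_row P"
  have Pn: "P \<in> carrier_mat n n" "elements_mat P \<subseteq> uniform_Roe" "P * P = P" "mat_star P = P"
    using P by (auto simp: projections_def n_def)
  have Pin: "P $$ (i, j) \<in> uniform_Roe" if "i < n" "j < n" for i j
  proof -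
    have "P $$ (i, j) \<in> elements_mat P" by (rule elements_matI[OF Pn(1) that refl])
    then show ?thesis using Pn(2) by blast
  qed
  let ?Q = "level_proj n :: ('x \<times> nat) bop" and ?\<sigma> = "shift n :: ('x \<times> nat) bop"
  define p where "p = to_op P"
  have ent: "entry i j p = P $$ (i, j)" if "i < n" "j < n" for i j
    using Pn(1) that by (simp add: p_def entry_to_op)
  have lev: "?Q * p = p" "p * ?Q = p" using level_to_op[of P] Pn(1) by (auto simp: p_def)
  have lev': "?Q * star p = star p" "star p * ?Q = star p"
    using arg_cong[OF lev(2), of star] arg_cong[OF lev(1), of star] by (simp_all add: star_mult star_level_proj)
  have lev2: "?Q * (p * p) = p * p" "p * p * ?Q = p * p" using lev by (simp_all add: mult.assoc flip: mult.assoc[of ?Q])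
  have pR: "p \<in> Roe_levels n" using lev Pin by (simp add: Roe_levels_def ent)
  have ps: "star p = p"
  proof (rule level_eqI[OF lev' lev])
    fix i j assume ij: "i < n" "j < n"
    have "star (P $$ (j, i)) = mat_star P $$ (i, j)" using Pn(1) ij by (simp add: mat_star_def)
    then show "entry i j (star p) = entry i j p" using ij by (simp add: entry_star ent Pn)
  qed
  have pp: "p * p = p"
  proof (rule level_eqI[OF lev2 lev])
    fix i j assume ij: "i < n" "j < n"
    have "entry i j (p * p) = (\<Sum>k<n. P $$ (i, k) * P $$ (k, j))"
      unfolding entry_mult[OF lev(1)] using ij by (intro sum.cong) (auto simp: ent)
    also have "\<dots> = (P * P) $$ (i, j)" using Pn(1) ij by (simp add: scalar_prod_def lessThan_atLeast0)
    finally show "entry i j (p * p) = entry i j p" using ij by (simp add: Pn ent)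
  qed
  \<comment> \<open>The projections come within 2/1000 of \<open>s1\<close> and \<open>s2\<close>.
    This leaves errors of at most 5/1000 for the sum and 7/1000 for the product, inside the 1/100
    that \<open>split_projection\<close> allows.\<close>
  have eps: "(1/1000 :: real) > 0" by simp
  obtain t1 t2 E1 E2 where E: "ctrl_rel n E1" "ctrl_rel n E2"
    and t: "star t1 = t1" "star t2 = t2" "supp t1 \<subseteq> E1" "supp t2 \<subseteq> E2"
    and tc: "norm (p - (t1 + t2)) < 1/1000" "norm (t1 * t1 - t1) < 1/1000" "norm (t2 * t2 - t2) < 1/1000"
      "norm (t1 * t2) < 1/1000" by (rule projection_cut[OF geom pR ps pp eps that])
  have QQ: "?Q * ?Q = ?Q" by (simp add: level_proj_mult)
  have nQ: "norm ?Q \<le> 1" unfolding level_proj_def by (rule norm_diag_op) auto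
  have nQm: "norm (?Q * T) \<le> norm T" for T using norm_mult3[of ?Q 1 T] nQ by simp
  \<comment> \<open>The relations contain the whole diagonal, so \<open>t1\<close> and
    \<open>t2\<close> may be nonzero on levels \<open>n\<close> and above. Compression removes this
    part and, commuting with both, keeps the estimates.\<close>
  define s1 s2 where "s1 = ?Q * t1" and "s2 = ?Q * t2"
  have c: "?Q * t1 = t1 * ?Q" "?Q * t2 = t2 * ?Q"
    by (rule ctrl_rel_level_commute[OF E(1) t(3)] ctrl_rel_level_commute[OF E(2) t(4)])+
  have ss: "star s1 = s1" "star s2 = s2" by (simp_all add: s1_def s2_def star_mult star_level_proj t c)
  have Qs: "?Q * s1 = s1" "?Q * s2 = s2" by (simp_all add: s1_def s2_def QQ flip: mult.assoc)
  have sp: "supp s1 \<subseteq> E1" "supp s2 \<subseteq> E2"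
    using t(3,4) by (auto simp: supp_def s1_def s2_def matrix_of_level split: if_splits)
  have prod: "?Q * a * (?Q * b) = ?Q * (a * b)" if "?Q * a = a * ?Q" for a b
  proof -
    have "?Q * a * (?Q * b) = ?Q * (a * ?Q) * b" by (simp only: mult.assoc)
    also have "\<dots> = (?Q * ?Q) * (a * b)" unfolding that[symmetric] by (simp only: mult.assoc)
    finally show ?thesis by (simp add: QQ)
  qed
  have sq: "norm (s1 * s1 - s1) \<le> 1/1000" "norm (s2 * s2 - s2) \<le> 1/1000" "norm (s1 * s2) \<le> 1/1000"
  proof -
    have "s1 * s1 - s1 = ?Q * (t1 * t1 - t1)" "s2 * s2 - s2 = ?Q * (t2 * t2 - t2)" "s1 * s2 = ?Q * (t1 * t2)"
      by (simp_all only: s1_def s2_def prod[OF c(1)] prod[OF c(2)] right_diff_distrib)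
    then show "norm (s1 * s1 - s1) \<le> 1/1000" "norm (s2 * s2 - s2) \<le> 1/1000" "norm (s1 * s2) \<le> 1/1000"
      using nQm[of "t1 * t1 - t1"] nQm[of "t2 * t2 - t2"] nQm[of "t1 * t2"] tc by simp_all
  qed
  have sP: "norm (p - (s1 + s2)) \<le> 1/1000"
    using nQm[of "p - (t1 + t2)"] tc(1) by (simp add: s1_def s2_def right_diff_distrib distrib_left lev)
  obtain e1 W1 X1 where e1: "e1 \<in> Roe_levels n" "star e1 = e1" "e1 * e1 = e1" "norm (e1 - s1) \<le> 2 * (1/1000)"
    and W1: "W1 * ?Q \<in> Roe_levels n" "star W1 * W1 = 1" "?Q * W1 = W1 * ?Q"
    and d1: "e1 = W1 * diag_op (\<lambda>p. if p \<in> X1 then 1 else 0) * star W1"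
      "?Q * diag_op (\<lambda>p. if p \<in> X1 then 1 else 0) = diag_op (\<lambda>p. if p \<in> X1 then 1 else 0)"
    by (rule block_projection_close[OF E(1) ss(1) sp(1) Qs(1) sq(1) that])
  obtain e2 W2 X2 where e2: "e2 \<in> Roe_levels n" "star e2 = e2" "e2 * e2 = e2" "norm (e2 - s2) \<le> 2 * (1/1000)"
    and W2: "W2 * ?Q \<in> Roe_levels n" "star W2 * W2 = 1" "?Q * W2 = W2 * ?Q"
    and d2: "e2 = W2 * diag_op (\<lambda>p. if p \<in> X2 then 1 else 0) * star W2"
      "?Q * diag_op (\<lambda>p. if p \<in> X2 then 1 else 0) = diag_op (\<lambda>p. if p \<in> X2 then 1 else 0)"
    by (rule block_projection_close[OF E(2) ss(2) sp(2) Qs(2) sq(2) that])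
  define i1 i2 where "i1 = (\<lambda>p. if p \<in> X1 then 1 else 0 :: complex)" and "i2 = (\<lambda>p. if p \<in> X2 then 1 else 0 :: complex)"
  have i: "i1 \<in> ell_infty" "i2 \<in> ell_infty" by (rule ell_inftyI[where C = 1], simp add: i1_def i2_def)+
  define D1 D2 where "D1 = diag_op i1" and "D2 = diag_op i2"
  have eW: "e1 = W1 * D1 * star W1" "e2 = W2 * D2 * star W2"
    using d1(1) d2(1) by (simp_all add: D1_def D2_def i1_def i2_def)
  have QD: "?Q * D1 = D1" "?Q * D2 = D2" using d1(2) d2(2) by (simp_all add: D1_def D2_def i1_def i2_def)
  have Ds: "star D1 = D1" "star D2 = D2"
    unfolding D1_def D2_def i[THEN diag_op_star, symmetric]
    by (rule arg_cong[where f = diag_op]; auto simp: i1_def i2_def star_fun_def star_complex_def)+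
  have DD: "D1 * D1 = D1" "D2 * D2 = D2"
    unfolding D1_def D2_def diag_op_mult[OF i(1,1), symmetric] diag_op_mult[OF i(2,2), symmetric]
    by (rule arg_cong[where f = diag_op]; auto simp: i1_def i2_def times_fun_def)+
  have DQ: "D1 * ?Q = D1" "D2 * ?Q = D2"
    using arg_cong[OF QD(1), of star] arg_cong[OF QD(2), of star] by (simp_all add: star_mult star_level_proj Ds)
  have c1: "norm (p - (e1 + e2)) \<le> 1/100"
  proof -
    have "p - (e1 + e2) = (p - (s1 + s2)) - (e1 - s1) - (e2 - s2)" by simp
    also have "norm \<dots> \<le> norm (p - (s1 + s2)) + norm (e1 - s1) + norm (e2 - s2)"
      by (intro order_trans[OF norm_triangle_ineq4] add_mono order_refl)
    finally show ?thesis using sP e1(4) e2(4) by simp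
  qed
  have c2: "norm (e1 * e2) \<le> 1/100"
  proof -
    have n1: "norm e1 \<le> 1" "norm e2 \<le> 1" using norm_projection e1(2,3) e2(2,3) by auto
    have "norm s1 \<le> norm e1 + norm (e1 - s1)" using norm_triangle_sub[of s1 e1] by (simp add: norm_minus_commute)
    then have n2: "norm s1 \<le> 2" using n1 e1(4) by simp
    have "e1 * e2 = (e1 - s1) * e2 + s1 * (e2 - s2) + s1 * s2" by (simp add: algebra_simps)
    also have "norm \<dots> \<le> norm (e1 - s1) * norm e2 + norm s1 * norm (e2 - s2) + norm (s1 * s2)"
      by (intro norm_triangle_mono norm_mult_ineq order_refl)
    also have "\<dots> \<le> (2 * (1/1000)) * 1 + 2 * (2 * (1/1000)) + 1/1000"
      using n1 n2 e1(4) e2(4) sq(3) by (intro add_mono mult_mono) auto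
    finally show ?thesis by simp
  qed
  obtain v where v: "v \<in> Roe_levels (2 * n)" "star v * v = p" "v * star v = e1 + ?\<sigma> * e2 * star ?\<sigma>"
    by (rule split_projection[OF pR ps pp e1(1-3) e2(1-3) c1 c2])
  note \<sigma> = shift_facts[where n = n and ?'x = 'x]
  \<comment> \<open>The unitaries \<open>W1\<close> and \<open>W2\<close>, restricted to the ranges
    of \<open>D1\<close> and \<open>D2\<close> and put side by side, form a partial isometry from
    \<open>\<Delta>\<close> onto the direct sum of \<open>e1\<close> and \<open>e2\<close>.\<close>
  define y where "y = W1 * D1 + ?\<sigma> * W2 * D2 * star ?\<sigma>"
  define \<Delta> where "\<Delta> = D1 + ?\<sigma> * D2 * star ?\<sigma>"
  have D\<sigma>: "D1 * ?\<sigma> = 0" by (metis DQ(1) \<sigma>(4) mult.assoc mult_zero_right)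
  have \<sigma>D: "star ?\<sigma> * D1 = 0" using arg_cong[OF D\<sigma>, of star] by (simp add: star_mult Ds)
  have "star (?Q * W1) = star (W1 * ?Q)" by (simp only: W1(3))
  then have WQ1: "star W1 * ?Q = ?Q * star W1" by (simp add: star_mult star_level_proj)
  have DW\<sigma>: "D1 * star W1 * ?\<sigma> = 0"
  proof -
    have "D1 * star W1 * ?\<sigma> = D1 * (?Q * star W1) * ?\<sigma>" by (simp add: DQ flip: mult.assoc)
    also have "\<dots> = D1 * star W1 * (?Q * ?\<sigma>)" unfolding WQ1[symmetric] by (simp only: mult.assoc)
    finally show ?thesis by (simp add: \<sigma>)
  qed
  have \<sigma>WD: "star ?\<sigma> * (W1 * D1) = 0" using arg_cong[OF DW\<sigma>, of star] by (simp add: star_mult Ds mult.assoc)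
  have ys: "star y = D1 * star W1 + ?\<sigma> * D2 * star W2 * star ?\<sigma>"
    by (simp add: y_def star_add star_mult Ds mult.assoc)
  have yy: "y * star y = e1 + ?\<sigma> * e2 * star ?\<sigma>"
  proof -
    have "y * star y = W1 * (D1 * D1) * star W1 + W1 * (D1 * ?\<sigma>) * D2 * star W2 * star ?\<sigma>
        + ?\<sigma> * W2 * D2 * (star ?\<sigma> * D1) * star W1 + ?\<sigma> * W2 * (D2 * (star ?\<sigma> * ?\<sigma>)) * D2 * star W2 * star ?\<sigma>"
      unfolding ys unfolding y_def by (simp add: distrib_left distrib_right mult.assoc)
    also have "\<dots> = W1 * D1 * star W1 + ?\<sigma> * W2 * (D2 * D2) * star W2 * star ?\<sigma>"
      unfolding D\<sigma> \<sigma>D \<sigma>(1) DQ DD(1) by (simp add: mult.assoc)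
    finally show ?thesis by (simp add: eW DD mult.assoc)
  qed
  have yy': "star y * y = \<Delta>"
  proof -
    have "star y * y = D1 * (star W1 * W1) * D1 + (D1 * star W1 * ?\<sigma>) * W2 * D2 * star ?\<sigma>
        + ?\<sigma> * D2 * star W2 * (star ?\<sigma> * (W1 * D1)) + ?\<sigma> * D2 * star W2 * (star ?\<sigma> * ?\<sigma>) * W2 * D2 * star ?\<sigma>"
      unfolding ys unfolding y_def by (simp add: distrib_left distrib_right mult.assoc)
    also have "\<dots> = D1 * D1 + ?\<sigma> * D2 * star W2 * (?Q * W2) * D2 * star ?\<sigma>"
      unfolding DW\<sigma> \<sigma>WD \<sigma>(1) W1(2) by (simp add: mult.assoc)
    also have "\<dots> = D1 * D1 + ?\<sigma> * D2 * (star W2 * W2) * (?Q * D2) * star ?\<sigma>"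
      unfolding W2(3) by (simp only: mult.assoc)
    finally show ?thesis by (simp add: W2(2) QD DD \<Delta>_def mult.assoc)
  qed
  have \<Delta>\<Delta>: "\<Delta> * \<Delta> = \<Delta>"
  proof -
    have "\<Delta> * \<Delta> = D1 * D1 + (D1 * ?\<sigma>) * D2 * star ?\<sigma> + ?\<sigma> * D2 * (star ?\<sigma> * D1)
        + ?\<sigma> * (D2 * (star ?\<sigma> * ?\<sigma>)) * D2 * star ?\<sigma>"
      unfolding \<Delta>_def by (simp add: distrib_left distrib_right mult.assoc)
    also have "\<dots> = D1 + ?\<sigma> * (D2 * D2) * star ?\<sigma>"
      unfolding D\<sigma> \<sigma>D \<sigma>(1) DQ DD(1) by (simp add: mult.assoc)
    finally show ?thesis by (simp add: DD \<Delta>_def)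
  qed
  define z where "z = star y * v"
  have vp: "v * p = v" by (rule partial_isometry_right[OF v(2) pp ps])
  have zz: "star z * z = p"
  proof -
    have "star z * z = star v * (y * star y) * v" by (simp add: z_def star_mult mult.assoc)
    also have "\<dots> = (star v * v) * (star v * v)" unfolding yy v(3)[symmetric] by (simp only: mult.assoc)
    finally show ?thesis by (simp add: v pp)
  qed
  have zz': "z * star z = \<Delta>"
  proof -
    have "z * star z = star y * (v * star v) * y" by (simp add: z_def star_mult mult.assoc)
    also have "\<dots> = (star y * y) * (star y * y)" unfolding v(3) yy[symmetric] by (simp only: mult.assoc)
    finally show ?thesis by (simp add: yy' \<Delta>\<Delta>)
  qed
  have zQ: "z * ?Q = z" by (simp add: z_def mult.assoc) (metis vp lev(2) mult.assoc)
  note alg = Roe_levels_algebra[where n = "2 * n" and ?'x = 'x]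
  have n2: "n \<le> 2 * n" by simp
  have "D1 \<in> Roe_levels n" "D2 \<in> Roe_levels n"
  proof -
    have sub: "supp D1 \<subseteq> E1" "supp D2 \<subseteq> E2"
      using supp_diag_op[OF i(1)] supp_diag_op[OF i(2)] E by (auto simp: D1_def D2_def ctrl_rel_def equiv_def refl_on_def)
    show "D1 \<in> Roe_levels n" "D2 \<in> Roe_levels n"
      by (rule ctrl_rel_Roe_levels[OF E(1) sub(1) QD(1)] ctrl_rel_Roe_levels[OF E(2) sub(2) QD(2)])+
  qed
  note R = this[THEN Roe_levels_mono[OF n2]] W1(1)[THEN Roe_levels_mono[OF n2]] W2(1)[THEN Roe_levels_mono[OF n2]]
    shift_Roe_levels[where n = n and ?'x = 'x]
  have y': "y = (W1 * ?Q) * D1 + ?\<sigma> * (W2 * ?Q) * D2 * star ?\<sigma>"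
    by (simp add: y_def mult.assoc QD flip: mult.assoc[of ?Q])
  have yR: "y \<in> Roe_levels (2 * n)"
    unfolding y' by (intro real_vector.subspace_add[OF alg(2)] alg(3,4) R)
  have zR: "z \<in> Roe_levels (2 * n)" unfolding z_def by (intro alg(3,4) yR v)
  have z2: "level_proj (2 * n) * z = z" using zR by (simp add: Roe_levels_def)
  have zs: "?Q * star z = star z" using arg_cong[OF zQ, of star] by (simp add: star_mult star_level_proj)
  \<comment> \<open>Both indicator functions read as one function of point and level: levels below
    \<open>n\<close> carry \<open>i1\<close>, which vanishes on the others by \<open>QD\<close>, and
    the next \<open>n\<close> levels carry \<open>i2\<close>.\<close>
  define j where "j = i1 + (\<lambda>p. if n \<le> snd p \<and> snd p < 2 * n then i2 (fst p, snd p - n) else 0)"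
  have jb: "(\<lambda>p. if n \<le> snd p \<and> snd p < 2 * n then i2 (fst p, snd p - n) else 0) \<in> ell_infty"
    by (rule ell_inftyI[where C = 1]) (auto simp: i2_def)
  then have ji: "j \<in> ell_infty" unfolding j_def by (intro ell_infty_closed i)
  have \<Delta>j: "\<Delta> = diag_op j"
    unfolding \<Delta>_def D1_def D2_def shift_conj_diag[OF i(2)] j_def by (rule diag_op_add[OF i(1) jb, symmetric])
  define D where "D = mat (2 * n) (2 * n) (\<lambda>(k, l). if k = l then (\<lambda>x. j (x, k)) else 0 :: 'x \<Rightarrow> complex)"
  have jk: "(\<lambda>x. j (x, k)) \<in> ell_infty" for k using ji by (auto simp: ell_infty_def bounded_iff)
  have MD: "map_mat diag_op D = to_mat (2 * n) (2 * n) \<Delta>"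
  proof (rule eq_matI)
    fix k l assume "k < dim_row (to_mat (2 * n) (2 * n) \<Delta>)" "l < dim_col (to_mat (2 * n) (2 * n) \<Delta>)"
    then have kl: "k < 2 * n" "l < 2 * n" by (auto simp: to_mat_def)
    have "diag_op (if k = l then (\<lambda>x. j (x, k)) else 0) = entry k l \<Delta>"
      by (rule matrix_of_eqI) (auto simp: \<Delta>j matrix_of_entry matrix_of_diag_op[OF ji] matrix_of_diag_op[OF jk] diag_op_zero matrix_of_simps)
    then show "map_mat diag_op D $$ (k, l) = to_mat (2 * n) (2 * n) \<Delta> $$ (k, l)" using kl by (simp add: D_def to_mat_def)
  qed (auto simp: D_def to_mat_def)
  \<comment> \<open>Idempotence of \<open>\<Delta>\<close> forces the values 0 and 1, without going
    back to \<open>X1\<close> and \<open>X2\<close>.\<close>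
  have jj: "j p * j p = j p" "cnj (j p) = j p" for p
  proof -
    have "diag_op (j * j) = diag_op j" using \<Delta>\<Delta> by (simp add: \<Delta>j diag_op_mult[OF ji ji])
    from arg_cong[OF this, of "\<lambda>T. matrix_of T p p"] show 1: "j p * j p = j p"
      by (simp add: matrix_of_diag_op[OF ji] matrix_of_diag_op[OF ell_infty_closed(2)[OF ji ji]])
    then have "j p = 0 \<or> j p = 1" by simp
    then show "cnj (j p) = j p" by auto
  qed
  have "D \<in> projections ell_infty"
  proof -
    have "D * D = D"
    proof (rule eq_matI)
      fix k l assume "k < dim_row D" "l < dim_col D"
      then have kl: "k < 2 * n" "l < 2 * n" by (auto simp: D_def)
      have "(D * D) $$ (k, l) = (\<Sum>m\<in>{0..<2 * n}. D $$ (k, m) * D $$ (m, l))"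
        using kl by (simp add: D_def scalar_prod_def)
      also have "\<dots> = (\<Sum>m\<in>{0..<2 * n}. if m = k then (if k = l then (\<lambda>x. j (x, k)) else 0) else 0)"
        using kl by (intro sum.cong) (auto simp: D_def jj times_fun_def)
      also have "\<dots> = D $$ (k, l)" using kl by (simp add: D_def)
      finally show "(D * D) $$ (k, l) = D $$ (k, l)" .
    qed (auto simp: D_def)
    moreover have "mat_star D = D"
    proof (rule eq_matI)
      fix k l assume "k < dim_row D" "l < dim_col D"
      then show "mat_star D $$ (k, l) = D $$ (k, l)"
        by (auto simp: D_def mat_star_def star_fun_def star_complex_def jj fun_eq_iff)
    qed (auto simp: D_def mat_star_def)
    moreover have "elements_mat D \<subseteq> ell_infty" by (auto simp: D_def elements_mat_def jk split: if_splits)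
    ultimately show ?thesis by (simp add: projections_def D_def)
  qed
  moreover have "(P, map_mat diag_op D) \<in> mvn_rel uniform_Roe"
  proof -
    let ?Z = "to_mat (2 * n) n z"
    have 1: "mat_star ?Z * ?Z = P"
      unfolding to_mat_star to_mat_mult[OF z2, symmetric] zz unfolding p_def by (rule to_mat_to_op[OF Pn(1)])
    have 2: "?Z * mat_star ?Z = map_mat diag_op D"
      unfolding to_mat_star to_mat_mult[OF zs, symmetric] zz' MD ..
    have \<Delta>R: "\<Delta> \<in> Roe_levels (2 * n)" unfolding zz'[symmetric] by (intro alg(3,4) zR)
    have l\<Delta>: "level_proj (2 * n) * \<Delta> = \<Delta>" using \<Delta>R by (simp add: Roe_levels_def)
    have DR: "map_mat diag_op D \<in> projections uniform_Roe"
      unfolding projections_def MD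
      using elements_to_mat[OF \<Delta>R order_refl order_refl]
      by (auto simp: to_mat_star \<Delta>\<Delta> to_mat_mult[OF l\<Delta>, symmetric]) (auto simp: to_mat_def zz'[symmetric] star_mult)
    have Z: "?Z \<in> carrier_mat (dim_row (map_mat diag_op D)) (dim_row P)"
      by (simp add: to_mat_def n_def D_def)
    show ?thesis
      unfolding mvn_rel_def mem_Collect_eq prod.case
      by (intro conjI P DR bexI[OF _ Z] 1 2 elements_to_mat[OF zR order_refl n2])
  qed
  ultimately show thesis by (rule that)
qed

section \<open>Functoriality of \<open>K\<^sub>0\<close>\<close>

lemma elements_mat_subset_iff:
  "elements_mat V \<subseteq> A \<longleftrightarrow> (\<forall>i<dim_row V. \<forall>j<dim_col V. V $$ (i, j) \<in> A)"
proof
  assume *: "elements_mat V \<subseteq> A"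
  have "V $$ (i, j) \<in> elements_mat V" if "i < dim_row V" "j < dim_col V" for i j
    by (rule elements_matI[of V "dim_row V" "dim_col V"]) (use that in auto)
  with * show "\<forall>i<dim_row V. \<forall>j<dim_col V. V $$ (i, j) \<in> A" by blast
next
  assume *: "\<forall>i<dim_row V. \<forall>j<dim_col V. V $$ (i, j) \<in> A"
  show "elements_mat V \<subseteq> A"
  proof
    fix a assume "a \<in> elements_mat V"
    then obtain i j where "i < dim_row V" "j < dim_col V" "a = V $$ (i, j)"
      using elements_matD by blast
    with * show "a \<in> A" by blast
  qed
qed

section \<open>Adjoints and direct sums of matrices\<close>

lemma dim_mat_star [simp]: "dim_row (mat_star V) = dim_col V" "dim_col (mat_star V) = dim_row V"
  by (simp_all add: mat_star_def)

lemma mat_star_carrier [simp]: "mat_star V \<in> carrier_mat n m \<longleftrightarrow> V \<in> carrier_mat m n"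
  by (auto simp: mat_star_def)

lemma mat_star_index: "i < dim_col V \<Longrightarrow> j < dim_row V \<Longrightarrow> mat_star V $$ (i, j) = star (V $$ (j, i))"
  by (simp add: mat_star_def)

lemma mat_star_star [simp]: "mat_star (mat_star (V :: 'a::star_ring mat)) = V"
  by (rule eq_matI) (auto simp: mat_star_index)

lemma mat_star_zero [simp]: "mat_star (0\<^sub>m n m :: 'a::star_ring mat) = 0\<^sub>m m n"
  by (rule eq_matI) (auto simp: mat_star_index)

lemma mat_star_mult:
  assumes "V \<in> carrier_mat n m" "W \<in> carrier_mat m k"
  shows "mat_star (V * W :: 'a::star_ring mat) = mat_star W * mat_star V"
  by (rule eq_matI) (use assms in \<open>auto simp: mat_star_index scalar_prod_def star_sum star_mult\<close>)

lemma mat_star_four_block: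
  assumes "P \<in> carrier_mat n1 m1" "Q \<in> carrier_mat n1 m2" "R \<in> carrier_mat n2 m1" "S \<in> carrier_mat n2 m2"
  shows "mat_star (four_block_mat P Q R S) = four_block_mat (mat_star P) (mat_star R) (mat_star Q) (mat_star S)"
  by (rule eq_matI) (use assms in \<open>auto simp: mat_star_index\<close>)

lemma direct_sum_carrier [simp]:
  "P \<in> carrier_mat n m \<Longrightarrow> Q \<in> carrier_mat n' m' \<Longrightarrow> Defs.direct_sum P Q \<in> carrier_mat (n + n') (m + m')"
  by (auto simp: Defs.direct_sum_def)

lemma dim_direct_sum [simp]: "dim_row (Defs.direct_sum P Q) = dim_row P + dim_row Q"
  "dim_col (Defs.direct_sum P Q) = dim_col P + dim_col Q"
  by (auto simp: Defs.direct_sum_def)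

lemma direct_sum_mult:
  fixes P :: "'a::semiring_0 mat"
  assumes "P \<in> carrier_mat n m" "Q \<in> carrier_mat n' m'" "R \<in> carrier_mat m k" "S \<in> carrier_mat m' k'"
  shows "Defs.direct_sum P Q * Defs.direct_sum R S = Defs.direct_sum (P * R) (Q * S)"
proof -
  have "Defs.direct_sum P Q * Defs.direct_sum R S
      = four_block_mat (P * R + 0\<^sub>m n m' * 0\<^sub>m m' k) (P * 0\<^sub>m m k' + 0\<^sub>m n m' * S)
          (0\<^sub>m n' m * R + Q * 0\<^sub>m m' k) (0\<^sub>m n' m * 0\<^sub>m m k' + Q * S)"
    unfolding Defs.direct_sum_def using assms
    by (subst mult_four_block_mat[where ?nr1.0 = n and ?n1.0 = m and ?n2.0 = m' and ?nr2.0 = n' and ?nc1.0 = k and ?nc2.0 = k']) auto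
  then show ?thesis using assms by (simp add: Defs.direct_sum_def)
qed

lemma direct_sum_star:
  "mat_star (Defs.direct_sum P Q :: 'a::star_ring mat) = Defs.direct_sum (mat_star P) (mat_star Q)"
  unfolding Defs.direct_sum_def
  by (subst mat_star_four_block[where ?n1.0 = "dim_row P" and ?m1.0 = "dim_col P" and ?n2.0 = "dim_row Q" and ?m2.0 = "dim_col Q"])
     auto

definition star_subring :: "'a::star_ring set \<Rightarrow> bool" where
  "star_subring A \<longleftrightarrow> 0 \<in> A \<and> (\<forall>a\<in>A. \<forall>b\<in>A. a + b \<in> A \<and> a * b \<in> A) \<and> (\<forall>a\<in>A. star a \<in> A)"

context
  fixes A :: "'a::star_ring set"
  assumes A: "star_subring A"
begin

lemma star_subring_sum: "(\<And>i. i \<in> I \<Longrightarrow> f i \<in> A) \<Longrightarrow> sum f I \<in> A"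
  by (induction I rule: infinite_finite_induct) (use A in \<open>auto simp: star_subring_def\<close>)

lemma elements_mult:
  "V \<in> carrier_mat n m \<Longrightarrow> W \<in> carrier_mat m k \<Longrightarrow> elements_mat V \<subseteq> A \<Longrightarrow> elements_mat W \<subseteq> A \<Longrightarrow>
     elements_mat (V * W) \<subseteq> A"
  unfolding elements_mat_subset_iff using A
  by (auto simp: scalar_prod_def star_subring_def intro!: star_subring_sum)

lemma elements_star: "elements_mat V \<subseteq> A \<Longrightarrow> elements_mat (mat_star V) \<subseteq> A"
  unfolding elements_mat_subset_iff using A by (auto simp: mat_star_index star_subring_def)

lemma elements_four_block:
  "P \<in> carrier_mat n1 m1 \<Longrightarrow> S \<in> carrier_mat n2 m2 \<Longrightarrow> Q \<in> carrier_mat n1 m2 \<Longrightarrow> R \<in> carrier_mat n2 m1 \<Longrightarrow>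
    elements_mat P \<subseteq> A \<Longrightarrow> elements_mat Q \<subseteq> A \<Longrightarrow> elements_mat R \<subseteq> A \<Longrightarrow> elements_mat S \<subseteq> A \<Longrightarrow>
    elements_mat (four_block_mat P Q R S) \<subseteq> A"
  unfolding elements_mat_subset_iff by auto

lemma elements_zero: "elements_mat (0\<^sub>m n m) \<subseteq> A"
  unfolding elements_mat_subset_iff using A by (auto simp: star_subring_def)

lemma elements_direct_sum: "elements_mat P \<subseteq> A \<Longrightarrow> elements_mat Q \<subseteq> A \<Longrightarrow> elements_mat (Defs.direct_sum P Q) \<subseteq> A"
  unfolding Defs.direct_sum_def by (rule elements_four_block[where ?n1.0 = "dim_row P" and ?m1.0 = "dim_col P"
    and ?n2.0 = "dim_row Q" and ?m2.0 = "dim_col Q"]) (auto simp: elements_zero)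

lemma projectionsD:
  "P \<in> projections A \<Longrightarrow> P \<in> carrier_mat (dim_row P) (dim_row P)" "P \<in> projections A \<Longrightarrow> elements_mat P \<subseteq> A"
  "P \<in> projections A \<Longrightarrow> P * P = P" "P \<in> projections A \<Longrightarrow> mat_star P = P"
  by (auto simp: projections_def)

lemma projectionsI:
  "P \<in> carrier_mat n n \<Longrightarrow> elements_mat P \<subseteq> A \<Longrightarrow> P * P = P \<Longrightarrow> mat_star P = P \<Longrightarrow> P \<in> projections A"
  by (auto simp: projections_def)

lemma direct_sum_projection:
  assumes "P \<in> projections A" "Q \<in> projections A"
  shows "Defs.direct_sum P Q \<in> projections A"
proof (rule projectionsI)
  note P = projectionsD[OF assms(1)] and Q = projectionsD[OF assms(2)]
  show "Defs.direct_sum P Q \<in> carrier_mat (dim_row P + dim_row Q) (dim_row P + dim_row Q)"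
    by (rule direct_sum_carrier[OF P(1) Q(1)])
  show "elements_mat (Defs.direct_sum P Q) \<subseteq> A" by (rule elements_direct_sum[OF P(2) Q(2)])
  show "Defs.direct_sum P Q * Defs.direct_sum P Q = Defs.direct_sum P Q"
    unfolding direct_sum_mult[OF P(1) Q(1) P(1) Q(1)] P(3) Q(3) ..
  show "mat_star (Defs.direct_sum P Q) = Defs.direct_sum P Q"
    unfolding direct_sum_star P(4) Q(4) ..
qed

section \<open>Murray-von Neumann equivalence\<close>

lemma mvn_relI:
  "P \<in> projections A \<Longrightarrow> Q \<in> projections A \<Longrightarrow> V \<in> carrier_mat (dim_row Q) (dim_row P) \<Longrightarrow> elements_mat V \<subseteq> A \<Longrightarrow>
    mat_star V * V = P \<Longrightarrow> V * mat_star V = Q \<Longrightarrow> (P, Q) \<in> mvn_rel A"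
  unfolding mvn_rel_def by blast

lemma mvn_relE:
  assumes "(P, Q) \<in> mvn_rel A"
  obtains V where "P \<in> projections A" "Q \<in> projections A" "V \<in> carrier_mat (dim_row Q) (dim_row P)" "elements_mat V \<subseteq> A"
    "mat_star V * V = P" "V * mat_star V = Q"
  using assms unfolding mvn_rel_def by blast

lemma equiv_mvn_rel: "equiv (projections A) (mvn_rel A)"
proof (rule equivI)
  show "mvn_rel A \<subseteq> projections A \<times> projections A" by (auto simp: mvn_rel_def)
  show "refl_on (projections A) (mvn_rel A)"
  proof (rule refl_onI)
    fix P assume P: "P \<in> projections A"
    show "(P, P) \<in> mvn_rel A"
      by (rule mvn_relI[where V = P]) (simp_all only: P projectionsD[OF P])
  qed
  show "sym (mvn_rel A)"
  proof (rule symI)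
    fix P Q assume "(P, Q) \<in> mvn_rel A"
    then obtain V where V: "P \<in> projections A" "Q \<in> projections A" "V \<in> carrier_mat (dim_row Q) (dim_row P)" "elements_mat V \<subseteq> A"
      "mat_star V * V = P" "V * mat_star V = Q" by (rule mvn_relE)
    show "(Q, P) \<in> mvn_rel A"
      by (rule mvn_relI[where V = "mat_star V"]) (use V in \<open>auto simp: elements_star\<close>)
  qed
  show "trans (mvn_rel A)"
  proof (rule transI)
    fix P Q R assume "(P, Q) \<in> mvn_rel A" "(Q, R) \<in> mvn_rel A"
    then obtain V W where P: "P \<in> projections A" and Q: "Q \<in> projections A" and R: "R \<in> projections A" and
      V: "V \<in> carrier_mat (dim_row Q) (dim_row P)" "elements_mat V \<subseteq> A" "mat_star V * V = P" "V * mat_star V = Q" and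
      W: "W \<in> carrier_mat (dim_row R) (dim_row Q)" "elements_mat W \<subseteq> A" "mat_star W * W = Q" "W * mat_star W = R"
      by (elim mvn_relE) blast
    define p q r where "p = dim_row P" and "q = dim_row Q" and "r = dim_row R"
    have c: "V \<in> carrier_mat q p" "W \<in> carrier_mat r q" "mat_star V \<in> carrier_mat p q" "mat_star W \<in> carrier_mat q r"
      using V W by (auto simp: p_def q_def r_def)
    have s: "mat_star (W * V) = mat_star V * mat_star W" by (rule mat_star_mult[OF c(2,1)])
    \<comment> \<open>The product of the two partial isometries is again one: the middle
      \<open>Q\<close> is rewritten as \<open>V * mat_star V\<close>, which leaves \<open>P\<close>
      times itself.\<close>
    have "mat_star (W * V) * (W * V) = mat_star V * (mat_star W * W) * V"
      unfolding s using c by (simp add: assoc_mult_mat[of _ p q _ r _ p] assoc_mult_mat[of _ q r _ q _ p] assoc_mult_mat[of _ p q _ q _ p])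
    also have "\<dots> = (mat_star V * V) * (mat_star V * V)"
      unfolding W(3) V(4)[symmetric] using c
      by (simp add: assoc_mult_mat[of _ p q _ q _ p] assoc_mult_mat[of _ p q _ p _ p] assoc_mult_mat[of _ q p _ q _ p])
    finally have 1: "mat_star (W * V) * (W * V) = P" using V(3) projectionsD(3)[OF P] by simp
    have "(W * V) * mat_star (W * V) = W * (V * mat_star V) * mat_star W"
      unfolding s using c by (simp add: assoc_mult_mat[of _ r q _ p _ r] assoc_mult_mat[of _ q p _ q _ r] assoc_mult_mat[of _ r q _ q _ r])
    also have "\<dots> = (W * mat_star W) * (W * mat_star W)"
      unfolding V(4) W(3)[symmetric] using c
      by (simp add: assoc_mult_mat[of _ r q _ q _ r] assoc_mult_mat[of _ r q _ r _ r] assoc_mult_mat[of _ q r _ q _ r])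
    finally have 2: "(W * V) * mat_star (W * V) = R" using W(4) projectionsD(3)[OF R] by simp
    show "(P, R) \<in> mvn_rel A"
      by (rule mvn_relI[OF P R _ elements_mult[OF W(1) V(1) W(2) V(2)] 1 2]) (use V W in auto)
  qed
qed

lemma mvn_rel_direct_sum:
  assumes "(P, P') \<in> mvn_rel A" "(Q, Q') \<in> mvn_rel A"
  shows "(Defs.direct_sum P Q, Defs.direct_sum P' Q') \<in> mvn_rel A"
proof -
  obtain V where P: "P \<in> projections A" "P' \<in> projections A" and
    V: "V \<in> carrier_mat (dim_row P') (dim_row P)" "elements_mat V \<subseteq> A" "mat_star V * V = P" "V * mat_star V = P'"
    using assms(1) by (rule mvn_relE)
  obtain W where Q: "Q \<in> projections A" "Q' \<in> projections A" and
    W: "W \<in> carrier_mat (dim_row Q') (dim_row Q)" "elements_mat W \<subseteq> A" "mat_star W * W = Q" "W * mat_star W = Q'"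
    using assms(2) by (rule mvn_relE)
  have s: "mat_star V \<in> carrier_mat (dim_row P) (dim_row P')" "mat_star W \<in> carrier_mat (dim_row Q) (dim_row Q')"
    using V W by auto
  show ?thesis
  proof (rule mvn_relI[where V = "Defs.direct_sum V W"])
    show "mat_star (Defs.direct_sum V W) * Defs.direct_sum V W = Defs.direct_sum P Q"
      unfolding direct_sum_star direct_sum_mult[OF s V(1) W(1)] V W ..
    show "Defs.direct_sum V W * mat_star (Defs.direct_sum V W) = Defs.direct_sum P' Q'"
      unfolding direct_sum_star direct_sum_mult[OF V(1) W(1) s] V W ..
  qed (use V W P Q in \<open>auto simp: direct_sum_projection elements_direct_sum\<close>)
qed

lemma mvn_rel_direct_sum_commute:
  assumes P: "P \<in> projections A" and Q: "Q \<in> projections A"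
  shows "(Defs.direct_sum P Q, Defs.direct_sum Q P) \<in> mvn_rel A"
proof -
  define p q where "p = dim_row P" and "q = dim_row Q"
  have c: "P \<in> carrier_mat p p" "Q \<in> carrier_mat q q"
    unfolding p_def q_def by (rule projectionsD(1)[OF P], rule projectionsD(1)[OF Q])
  \<comment> \<open>The flip of the two summands cut down by the projections; its nonzero entries
    come from \<open>P\<close> and \<open>Q\<close>, so it stays over \<open>A\<close>.\<close>
  define V where "V = four_block_mat (0\<^sub>m q p) Q P (0\<^sub>m p q)"
  have V: "V \<in> carrier_mat (q + p) (p + q)" using c by (auto simp: V_def)
  have sV: "mat_star V = four_block_mat (0\<^sub>m p q) P Q (0\<^sub>m q p)"
    unfolding V_def using c
    by (subst mat_star_four_block[where ?n1.0 = q and ?m1.0 = p and ?n2.0 = p and ?m2.0 = q])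
       (auto simp: projectionsD(4)[OF P] projectionsD(4)[OF Q])
  have VV: "mat_star V * V = Defs.direct_sum P Q" "V * mat_star V = Defs.direct_sum Q P"
    unfolding sV unfolding V_def Defs.direct_sum_def using c
    by (auto simp: mult_four_block_mat[where ?nr1.0 = p and ?n1.0 = q and ?n2.0 = p and ?nr2.0 = q and ?nc1.0 = p and ?nc2.0 = q]
        mult_four_block_mat[where ?nr1.0 = q and ?n1.0 = p and ?n2.0 = q and ?nr2.0 = p and ?nc1.0 = q and ?nc2.0 = p]
        projectionsD(3)[OF P] projectionsD(3)[OF Q])
  have "elements_mat V \<subseteq> A"
    unfolding V_def by (rule elements_four_block[where ?n1.0 = q and ?m1.0 = p and ?n2.0 = p and ?m2.0 = q])
      (use c projectionsD(2)[OF P] projectionsD(2)[OF Q] in \<open>auto simp: elements_zero\<close>)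
  then show ?thesis
    by (intro mvn_relI[where V = V] direct_sum_projection P Q VV) (use V in \<open>auto simp: p_def q_def\<close>)
qed

definition mvn_class :: "'a mat \<Rightarrow> 'a mat set" where
  "mvn_class P = mvn_rel A `` {P}"

lemma mvn_class_eq_iff:
  "P \<in> projections A \<Longrightarrow> Q \<in> projections A \<Longrightarrow> mvn_class P = mvn_class Q \<longleftrightarrow> (P, Q) \<in> mvn_rel A"
  unfolding mvn_class_def using eq_equiv_class_iff[OF equiv_mvn_rel] .

lemma mvn_class_self: "P \<in> projections A \<Longrightarrow> P \<in> mvn_class P"
  unfolding mvn_class_def using equiv_class_self[OF equiv_mvn_rel] .

lemma in_mvn_class: "P' \<in> mvn_class P \<Longrightarrow> (P, P') \<in> mvn_rel A \<and> P' \<in> projections A"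
  by (auto simp: mvn_class_def mvn_rel_def)

lemma carrier_proj_monoid: "carrier (proj_monoid A) = mvn_class ` projections A"
  by (auto simp: proj_monoid_def quotient_def mvn_class_def)

text \<open>The product of the monoid is a union over all representatives;
  \<open>mvn_rel_direct_sum\<close> makes all sets in this union the same class.\<close>

lemma mult_mvn_class:
  assumes "P \<in> projections A" "Q \<in> projections A"
  shows "mvn_class P \<otimes>\<^bsub>proj_monoid A\<^esub> mvn_class Q = mvn_class (Defs.direct_sum P Q)"
proof -
  have eq: "mvn_rel A `` {Defs.direct_sum P' Q'} = mvn_class (Defs.direct_sum P Q)"
    if "P' \<in> mvn_class P" "Q' \<in> mvn_class Q" for P' Q'
  proof -
    have "(Defs.direct_sum P Q, Defs.direct_sum P' Q') \<in> mvn_rel A"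
      using that by (intro mvn_rel_direct_sum) (auto dest: in_mvn_class)
    moreover have "Defs.direct_sum P' Q' \<in> projections A" "Defs.direct_sum P Q \<in> projections A"
      using that assms by (auto intro!: direct_sum_projection dest: in_mvn_class)
    ultimately have "mvn_class (Defs.direct_sum P Q) = mvn_class (Defs.direct_sum P' Q')" by (simp add: mvn_class_eq_iff)
    then show ?thesis by (simp add: mvn_class_def)
  qed
  have "(\<Union>P'\<in>mvn_class P. \<Union>Q'\<in>mvn_class Q. mvn_rel A `` {Defs.direct_sum P' Q'})
      = (\<Union>P'\<in>mvn_class P. \<Union>Q'\<in>mvn_class Q. mvn_class (Defs.direct_sum P Q))"
    by (intro SUP_cong refl eq)
  also have "\<dots> = mvn_class (Defs.direct_sum P Q)" using mvn_class_self assms by blast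
  finally show ?thesis by (simp add: proj_monoid_def)
qed

lemma comm_monoid_proj_monoid: "comm_monoid (proj_monoid A)"
proof (rule comm_monoidI)
  have z: "0\<^sub>m 0 0 \<in> projections A" by (rule projectionsI[where n = 0]) (auto simp: elements_zero)
  have one: "\<one>\<^bsub>proj_monoid A\<^esub> = mvn_class (0\<^sub>m 0 0)" by (simp add: proj_monoid_def mvn_class_def)
  show "\<one>\<^bsub>proj_monoid A\<^esub> \<in> carrier (proj_monoid A)" unfolding one carrier_proj_monoid using z by blast
  fix x assume "x \<in> carrier (proj_monoid A)"
  then obtain P where P: "P \<in> projections A" "x = mvn_class P" by (auto simp: carrier_proj_monoid)
  have "Defs.direct_sum (0\<^sub>m 0 0) P = P" by (rule eq_matI) (auto simp: Defs.direct_sum_def)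
  then show "\<one>\<^bsub>proj_monoid A\<^esub> \<otimes>\<^bsub>proj_monoid A\<^esub> x = x" by (simp add: one P mult_mvn_class z)
  fix y assume "y \<in> carrier (proj_monoid A)"
  then obtain Q where Q: "Q \<in> projections A" "y = mvn_class Q" by (auto simp: carrier_proj_monoid)
  show "x \<otimes>\<^bsub>proj_monoid A\<^esub> y \<in> carrier (proj_monoid A)"
    using P Q by (auto simp: carrier_proj_monoid mult_mvn_class direct_sum_projection)
  show "x \<otimes>\<^bsub>proj_monoid A\<^esub> y = y \<otimes>\<^bsub>proj_monoid A\<^esub> x"
    using P Q by (simp add: mult_mvn_class mvn_class_eq_iff direct_sum_projection mvn_rel_direct_sum_commute)
  fix w assume "w \<in> carrier (proj_monoid A)"
  then obtain R where R: "R \<in> projections A" "w = mvn_class R" by (auto simp: carrier_proj_monoid)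
  have "Defs.direct_sum (Defs.direct_sum P Q) R = Defs.direct_sum P (Defs.direct_sum Q R)"
    unfolding Defs.direct_sum_def by (rule assoc_four_block_mat[symmetric])
  then show "x \<otimes>\<^bsub>proj_monoid A\<^esub> y \<otimes>\<^bsub>proj_monoid A\<^esub> w = x \<otimes>\<^bsub>proj_monoid A\<^esub> (y \<otimes>\<^bsub>proj_monoid A\<^esub> w)"
    using P Q R by (simp add: mult_mvn_class direct_sum_projection)
qed

end

section \<open>Grothendieck groups and the induced map\<close>

lemma equiv_grothendieck_rel:
  fixes M (structure)
  assumes "comm_monoid M"
  shows "equiv (carrier M \<times> carrier M) (grothendieck_rel M)"
proof (rule equivI)
  interpret comm_monoid M by fact
  show "grothendieck_rel M \<subseteq> (carrier M \<times> carrier M) \<times> carrier M \<times> carrier M"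
    by (auto simp: grothendieck_rel_def)
  show "refl_on (carrier M \<times> carrier M) (grothendieck_rel M)"
    by (rule refl_onI) (auto simp: grothendieck_rel_def)
  show "sym (grothendieck_rel M)"
    by (rule symI) (auto simp: grothendieck_rel_def eq_commute)
  show "trans (grothendieck_rel M)"
  proof (rule transI)
    fix x y z assume xy: "(x, y) \<in> grothendieck_rel M" and yz: "(y, z) \<in> grothendieck_rel M"
    obtain a b c d f g where s: "x = (a, b)" "y = (c, d)" "z = (f, g)" by (metis surj_pair)
    from xy yz obtain e e' where c: "a \<in> carrier M" "b \<in> carrier M" "c \<in> carrier M" "d \<in> carrier M" "f \<in> carrier M" "g \<in> carrier M"
      "e \<in> carrier M" "e' \<in> carrier M" and eq: "a \<otimes> d \<otimes> e = c \<otimes> b \<otimes> e" "c \<otimes> g \<otimes> e' = f \<otimes> d \<otimes> e'"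
      by (auto simp: s grothendieck_rel_def)
    \<comment> \<open>Transitivity without cancellation: both witnesses together with the middle
      term \<open>d\<close> form the new witness.\<close>
    have "a \<otimes> g \<otimes> (d \<otimes> e \<otimes> e') = (a \<otimes> d \<otimes> e) \<otimes> (g \<otimes> e')" using c by (simp add: m_ac)
    also have "\<dots> = (c \<otimes> g \<otimes> e') \<otimes> (b \<otimes> e)" unfolding eq(1) using c by (simp add: m_ac)
    also have "\<dots> = f \<otimes> b \<otimes> (d \<otimes> e \<otimes> e')" unfolding eq(2) using c by (simp add: m_ac)
    finally show "(x, z) \<in> grothendieck_rel M"
      using c by (auto simp: s grothendieck_rel_def intro!: bexI[of _ "d \<otimes> e \<otimes> e'"])
  qed
qed

text \<open>The hypothesis on \<open>B\<close>-projections makes the induced map of monoids surjective.\<close>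

lemma K0_map_surj:
  fixes A :: "'a::star_ring set" and B :: "'b::star_ring set"
  assumes A: "star_subring A" and B: "star_subring B"
    and \<phi>: "\<And>a. a \<in> A \<Longrightarrow> \<phi> a \<in> B" "\<And>a b. a \<in> A \<Longrightarrow> b \<in> A \<Longrightarrow> \<phi> (a + b) = \<phi> a + \<phi> b"
      "\<And>a b. a \<in> A \<Longrightarrow> b \<in> A \<Longrightarrow> \<phi> (a * b) = \<phi> a * \<phi> b" "\<And>a. a \<in> A \<Longrightarrow> \<phi> (star a) = star (\<phi> a)" "\<phi> 0 = 0"
    and surj: "\<And>P. P \<in> projections B \<Longrightarrow> \<exists>D\<in>projections A. (P, map_mat \<phi> D) \<in> mvn_rel B"
  shows "K0_map B \<phi> ` carrier (K0 A) = carrier (K0 B)"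
proof -
  let ?M = "proj_monoid A" and ?N = "proj_monoid B"
  have \<phi>_sum: "\<phi> (sum f I) = (\<Sum>i\<in>I. \<phi> (f i))" if "\<And>i. i \<in> I \<Longrightarrow> f i \<in> A" for f :: "nat \<Rightarrow> 'a" and I
    using that by (induction I rule: infinite_finite_induct) (auto simp: \<phi> star_subring_sum[OF A])
  have map_mult: "map_mat \<phi> (V * W) = map_mat \<phi> V * map_mat \<phi> W"
    if "V \<in> carrier_mat n m" "W \<in> carrier_mat m k" "elements_mat V \<subseteq> A" "elements_mat W \<subseteq> A" for V W n m k
  proof (rule eq_matI)
    fix i j assume "i < dim_row (map_mat \<phi> V * map_mat \<phi> W)" "j < dim_col (map_mat \<phi> V * map_mat \<phi> W)"
    then have ij: "i < n" "j < k" using that by auto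
    have e: "V $$ (i, l) \<in> A" "W $$ (l, j) \<in> A" if "l < m" for l
      using \<open>V \<in> carrier_mat n m\<close> \<open>W \<in> carrier_mat m k\<close> \<open>elements_mat V \<subseteq> A\<close> \<open>elements_mat W \<subseteq> A\<close> ij that
      unfolding elements_mat_subset_iff by auto
    have "map_mat \<phi> (V * W) $$ (i, j) = \<phi> (\<Sum>l\<in>{0..<m}. V $$ (i, l) * W $$ (l, j))"
      using that ij by (simp add: scalar_prod_def)
    also have "\<dots> = (\<Sum>l\<in>{0..<m}. \<phi> (V $$ (i, l) * W $$ (l, j)))"
      using A e by (intro \<phi>_sum) (auto simp: star_subring_def)
    also have "\<dots> = (\<Sum>l\<in>{0..<m}. \<phi> (V $$ (i, l)) * \<phi> (W $$ (l, j)))"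
      using e by (intro sum.cong) (auto simp: \<phi>)
    also have "\<dots> = (map_mat \<phi> V * map_mat \<phi> W) $$ (i, j)" using that ij by (simp add: scalar_prod_def)
    finally show "map_mat \<phi> (V * W) $$ (i, j) = (map_mat \<phi> V * map_mat \<phi> W) $$ (i, j)" .
  qed (use that in auto)
  have map_star: "map_mat \<phi> (mat_star V) = mat_star (map_mat \<phi> V)" if "elements_mat V \<subseteq> A" for V
    by (rule eq_matI) (use that in \<open>auto simp: mat_star_index elements_mat_subset_iff \<phi>\<close>)
  have map_elements: "elements_mat (map_mat \<phi> V) \<subseteq> B" if "elements_mat V \<subseteq> A" for V
    using that by (auto simp: elements_mat_subset_iff \<phi>)
  have map_proj: "map_mat \<phi> P \<in> projections B" if P: "P \<in> projections A" for P
  proof (rule projectionsI[OF B, of _ "dim_row P"])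
    note d = projectionsD[OF A P]
    show "map_mat \<phi> P \<in> carrier_mat (dim_row P) (dim_row P)" unfolding map_carrier_mat by (rule d(1))
    show "elements_mat (map_mat \<phi> P) \<subseteq> B" by (rule map_elements[OF d(2)])
    show "map_mat \<phi> P * map_mat \<phi> P = map_mat \<phi> P" unfolding map_mult[OF d(1,1,2,2), symmetric] d(3) ..
    show "mat_star (map_mat \<phi> P) = map_mat \<phi> P" unfolding map_star[OF d(2), symmetric] d(4) ..
  qed
  have map_rel: "(map_mat \<phi> P, map_mat \<phi> Q) \<in> mvn_rel B" if PQ: "(P, Q) \<in> mvn_rel A" for P Q
  proof -
    obtain V where P: "P \<in> projections A" "Q \<in> projections A" and V: "V \<in> carrier_mat (dim_row Q) (dim_row P)"
      "elements_mat V \<subseteq> A" "mat_star V * V = P" "V * mat_star V = Q"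
      using PQ by (rule mvn_relE[OF A])
    have s: "mat_star V \<in> carrier_mat (dim_row P) (dim_row Q)" "elements_mat (mat_star V) \<subseteq> A"
      using V elements_star[OF A] by auto
    show ?thesis
    proof (rule mvn_relI[OF B, where V = "map_mat \<phi> V"])
      show "mat_star (map_mat \<phi> V) * map_mat \<phi> V = map_mat \<phi> P"
        unfolding map_star[OF V(2), symmetric] map_mult[OF s(1) V(1) s(2) V(2), symmetric] V(3) ..
      show "map_mat \<phi> V * mat_star (map_mat \<phi> V) = map_mat \<phi> Q"
        unfolding map_star[OF V(2), symmetric] map_mult[OF V(1) s(1) V(2) s(2), symmetric] V(4) ..
    qed (use V P map_proj map_elements in auto)
  qed
  have pm: "proj_map B \<phi> (mvn_class A P) = mvn_class B (map_mat \<phi> P)" if P: "P \<in> projections A" for P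
  proof -
    have "mvn_rel B `` {map_mat \<phi> P'} = mvn_class B (map_mat \<phi> P)" if P': "P' \<in> mvn_class A P" for P'
    proof -
      have "(P, P') \<in> mvn_rel A" "P' \<in> projections A" using in_mvn_class[OF A P'] by auto
      then have "mvn_class B (map_mat \<phi> P) = mvn_class B (map_mat \<phi> P')"
        using mvn_class_eq_iff[OF B map_proj[OF P] map_proj, of P'] map_rel by blast
      then show ?thesis by (simp add: mvn_class_def[OF B])
    qed
    then have "proj_map B \<phi> (mvn_class A P) = (\<Union>P'\<in>mvn_class A P. mvn_class B (map_mat \<phi> P))"
      unfolding proj_map_def by (intro SUP_cong refl)
    then show ?thesis using mvn_class_self[OF A P] by auto
  qed
  have map_ds: "map_mat \<phi> (Defs.direct_sum P Q) = Defs.direct_sum (map_mat \<phi> P) (map_mat \<phi> Q)" for P Q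
    by (rule eq_matI) (auto simp: Defs.direct_sum_def \<phi>)
  have pm_carrier: "proj_map B \<phi> c \<in> carrier ?N" if "c \<in> carrier ?M" for c
    using that by (auto simp: carrier_proj_monoid[OF A] carrier_proj_monoid[OF B] pm map_proj)
  have pm_mult: "proj_map B \<phi> (c \<otimes>\<^bsub>?M\<^esub> d) = proj_map B \<phi> c \<otimes>\<^bsub>?N\<^esub> proj_map B \<phi> d"
    if "c \<in> carrier ?M" "d \<in> carrier ?M" for c d
    using that by (auto simp: carrier_proj_monoid[OF A] mult_mvn_class[OF A] mult_mvn_class[OF B] pm map_proj map_ds
        direct_sum_projection[OF A])
  have pm_surj: "\<exists>d\<in>carrier ?M. c = proj_map B \<phi> d" if c: "c \<in> carrier ?N" for c
  proof -
    obtain P where P: "P \<in> projections B" "c = mvn_class B P" using c by (auto simp: carrier_proj_monoid[OF B])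
    obtain D where D: "D \<in> projections A" "(P, map_mat \<phi> D) \<in> mvn_rel B" using surj[OF P(1)] by blast
    have "c = proj_map B \<phi> (mvn_class A D)"
      unfolding P(2) pm[OF D(1)] using mvn_class_eq_iff[OF B P(1) map_proj[OF D(1)]] D(2) by simp
    then show ?thesis using D(1) by (auto simp: carrier_proj_monoid[OF A])
  qed
  interpret M: comm_monoid ?M by (rule comm_monoid_proj_monoid[OF A])
  note eM = equiv_grothendieck_rel[OF comm_monoid_proj_monoid[OF A]]
  note eN = equiv_grothendieck_rel[OF comm_monoid_proj_monoid[OF B]]
  \<comment> \<open>The induced map is a union over all representatives of a formal difference; all
    of them have the same image, so the union collapses to one class.\<close>
  have km: "K0_map B \<phi> (grothendieck_rel ?M `` {(c, d)}) = grothendieck_rel ?N `` {(proj_map B \<phi> c, proj_map B \<phi> d)}"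
    if cd: "c \<in> carrier ?M" "d \<in> carrier ?M" for c d
  proof -
    have "grothendieck_rel ?N `` {(proj_map B \<phi> c', proj_map B \<phi> d')} = grothendieck_rel ?N `` {(proj_map B \<phi> c, proj_map B \<phi> d)}"
      if "((c, d), (c', d')) \<in> grothendieck_rel ?M" for c' d'
    proof (rule equiv_class_eq[OF eN, symmetric])
      from that obtain e where c': "c' \<in> carrier ?M" "d' \<in> carrier ?M" "e \<in> carrier ?M"
        and e: "c \<otimes>\<^bsub>?M\<^esub> d' \<otimes>\<^bsub>?M\<^esub> e = c' \<otimes>\<^bsub>?M\<^esub> d \<otimes>\<^bsub>?M\<^esub> e"
        by (auto simp: grothendieck_rel_def)
      have "proj_map B \<phi> c \<otimes>\<^bsub>?N\<^esub> proj_map B \<phi> d' \<otimes>\<^bsub>?N\<^esub> proj_map B \<phi> e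
          = proj_map B \<phi> c' \<otimes>\<^bsub>?N\<^esub> proj_map B \<phi> d \<otimes>\<^bsub>?N\<^esub> proj_map B \<phi> e"
        using arg_cong[OF e, of "proj_map B \<phi>"] cd c' by (simp add: pm_mult)
      then show "((proj_map B \<phi> c, proj_map B \<phi> d), (proj_map B \<phi> c', proj_map B \<phi> d')) \<in> grothendieck_rel ?N"
        using cd c' pm_carrier by (auto simp: grothendieck_rel_def)
    qed
    then have "K0_map B \<phi> (grothendieck_rel ?M `` {(c, d)})
        = (\<Union>z\<in>grothendieck_rel ?M `` {(c, d)}. grothendieck_rel ?N `` {(proj_map B \<phi> c, proj_map B \<phi> d)})"
      unfolding K0_map_def by (intro SUP_cong refl) auto
    moreover have "(c, d) \<in> grothendieck_rel ?M `` {(c, d)}"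
      by (rule equiv_class_self[OF eM]) (use cd in auto)
    ultimately show ?thesis by auto
  qed
  have carr: "carrier (K0 A) = (\<lambda>z. grothendieck_rel ?M `` {z}) ` (carrier ?M \<times> carrier ?M)"
    "carrier (K0 B) = (\<lambda>z. grothendieck_rel ?N `` {z}) ` (carrier ?N \<times> carrier ?N)"
    by (auto simp: K0_def grothendieck_group_def quotient_def)
  show ?thesis
  proof
    show "K0_map B \<phi> ` carrier (K0 A) \<subseteq> carrier (K0 B)"
      unfolding carr using pm_carrier by (auto simp: km)
    show "carrier (K0 B) \<subseteq> K0_map B \<phi> ` carrier (K0 A)"
    proof
      fix y assume "y \<in> carrier (K0 B)"
      then obtain c d where cd: "c \<in> carrier ?N" "d \<in> carrier ?N" "y = grothendieck_rel ?N `` {(c, d)}"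
        by (auto simp: carr)
      \<comment> \<open>The two terms of a formal difference are lifted independently of each other,
        so surjectivity on the monoids is enough.\<close>
      obtain c' d' where c': "c' \<in> carrier ?M" "d' \<in> carrier ?M" "c = proj_map B \<phi> c'" "d = proj_map B \<phi> d'"
        using pm_surj[OF cd(1)] pm_surj[OF cd(2)] by blast
      have "y = K0_map B \<phi> (grothendieck_rel ?M `` {(c', d')})" using cd c' by (simp add: km)
      then show "y \<in> K0_map B \<phi> ` carrier (K0 A)" unfolding carr using c' by blast
    qed
  qed
qed

theorem theorem1p7:
  assumes "bounded_geometry TYPE('x::metric_space)"
    and "asdim_le_one TYPE('x)"
  shows "K0_map (uniform_Roe :: 'x bop set) diag_op ` carrier (K0 (ell_infty :: ('x \<Rightarrow> complex) set))
           = carrier (K0 (uniform_Roe :: 'x bop set))"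
proof (rule K0_map_surj)
  show "star_subring (ell_infty :: ('x \<Rightarrow> complex) set)"
    by (simp add: star_subring_def)
  show "star_subring (uniform_Roe :: 'x bop set)"
    by (simp add: star_subring_def uniform_Roe_closed uniform_Roe_zero_one)
  show "\<exists>D\<in>projections ell_infty. (P, map_mat diag_op D) \<in> mvn_rel uniform_Roe"
    if "P \<in> projections (uniform_Roe :: 'x bop set)" for P
    using projection_equivalent_diagonal[OF assms that] by blast
qed (simp_all add: diag_op_in_uniform_Roe diag_op_add diag_op_mult diag_op_star diag_op_zero)

end
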